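(* Let $k,n\in\mathbb{N}=\{1,2,\ldots\}$ with $1\le k<n$, let $K\in\mathbb{N}$, let $X$ be a Stein manifold, and let $P\colon X\to J^K_{0,0}(\mathbb{C}^n)_{\mathfrak{g}_0^{n,k}}$, $x\mapsto P_x$, be a holomorphic family of $K$-jets at the origin pointwise fixing the linear subspace $\{z_{k+1}=\cdots=z_n=0\}$. Then there exists a holomorphic map $F\colon X\to\mathrm{Aut}_{\mathfrak{g}_0^{n,k}}(\mathbb{C}^n)$ such that for any $x\in X$ the following hold: (i) $F_x(z)=P_x(z)+O(|z|^{K+1})$ for $z\to 0$; (ii) $F_x(z_1,\ldots,z_k,0,\ldots,0)=(z_1,\ldots,z_k,0,\ldots,0)$ for any $(z_1,\ldots,z_k)\in\mathbb{C}^k$.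
   Context: $\mathfrak{g}_0^{n,k}$ is the Lie algebra of holomorphic vector fields on $\mathbb{C}^n$ vanishing on $\{z_{k+1}=\cdots=z_n=0\}\cong\mathbb{C}^k$. For a holomorphic vector field $V$, $\varphi_V^t$ denotes its flow at time $t$. For a Lie algebra $\mathfrak{g}$ of holomorphic vector fields on $\mathbb{C}^n$ and $p\in\mathbb{C}^n$, $J^K_{p,\ast}(\mathbb{C}^n)_{\mathfrak{g}}$ is the set of $K$-jets at $p$ (Taylor polynomials of order $K$ at $p$) of the form $[\varphi_{V_N}^{t_N}\circ\cdots\circ\varphi_{V_1}^{t_1}]_p^K$ with $V_1,\ldots,V_N\in\mathfrak{g}$, and $J^K_{0,0}(\mathbb{C}^n)_{\mathfrak{g}}$ is the set of those jets at $p=0$ that send $0$ to $0$. (For $\mathfrak{g}=\mathfrak{g}_0^{n,k}$ the vector fields vanish at $0$, so all these flows are defined near $0$ and all such jets fix $0$.) Jets are identified with polynomial maps $\mathbb{C}^n\to\mathbb{C}^n$ of degree at most $K$, and a family $x\mapsto P_x$ is holomorphic if it is holomorphic as a map into the finite-dimensional complex vector space of such polynomial maps. $\mathrm{Aut}_{\mathfrak{g}}(\mathbb{C}^n)$ is the subgroup of the holomorphic automorphism group $\mathrm{Aut}(\mathbb{C}^n)$ generated by the time-$1$ flows of complete vector fields in $\mathfrak{g}$. A map $F$ from $X$ to (a subgroup of) $\mathrm{Aut}(\mathbb{C}^n)$ is holomorphic if $X\times\mathbb{C}^n\to\mathbb{C}^n$, $(x,z)\mapsto F_x(z):=F(x)(z)$,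 is holomorphic. *)

theory Defs
  imports "HOL-Analysis.Analysis" "HOL-Algebra.Generated_Groups" "HOL-Library.Landau_Symbols"
begin

section \<open>Complex normed vector spaces and holomorphic maps\<close>

class complex_normed_vector = real_normed_vector +
  fixes scaleC :: "complex \<Rightarrow> 'a \<Rightarrow> 'a"  (infixr "*\<^sub>C" 75)
  assumes scaleC_add_right: "c *\<^sub>C (x + y) = c *\<^sub>C x + c *\<^sub>C y"
    and scaleC_add_left: "(c + d) *\<^sub>C x = c *\<^sub>C x + d *\<^sub>C x"
    and scaleC_scaleC: "c *\<^sub>C d *\<^sub>C x = (c * d) *\<^sub>C x"
    and scaleC_of_real: "complex_of_real r *\<^sub>C x = r *\<^sub>R x"
    and norm_scaleC: "norm (c *\<^sub>C x) = cmod c * norm x"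

instantiation complex :: complex_normed_vector
begin
definition scaleC_complex :: "complex \<Rightarrow> complex \<Rightarrow> complex" where
  "scaleC_complex c x = c * x"
instance
  by standard (simp_all add: scaleC_complex_def algebra_simps norm_mult scaleR_conv_of_real)
end

instantiation vec :: (complex_normed_vector, finite) complex_normed_vector
begin
definition scaleC_vec :: "complex \<Rightarrow> 'a ^ 'b \<Rightarrow> 'a ^ 'b" where
  "scaleC_vec c x = (\<chi> i. c *\<^sub>C x $ i)"
instance
  by standard
    (simp_all add: scaleC_vec_def vec_eq_iff scaleC_add_right scaleC_add_left scaleC_scaleC
      scaleC_of_real norm_vec_def norm_scaleC L2_set_right_distrib)
end

instantiation prod :: (complex_normed_vector, complex_normed_vector) complex_normed_vector
begin
definition scaleC_prod :: "complex \<Rightarrow> 'a \<times> 'b \<Rightarrow> 'a \<times> 'b" where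
  "scaleC_prod c x = (c *\<^sub>C fst x, c *\<^sub>C snd x)"
instance
proof
  fix c :: complex and x :: "'a \<times> 'b"
  have "sqrt ((cmod c * norm (fst x))\<^sup>2 + (cmod c * norm (snd x))\<^sup>2)
      = sqrt ((cmod c)\<^sup>2 * ((norm (fst x))\<^sup>2 + (norm (snd x))\<^sup>2))"
    by (simp add: power_mult_distrib distrib_left)
  then show "norm (c *\<^sub>C x) = cmod c * norm x"
    by (simp add: scaleC_prod_def norm_prod_def norm_scaleC real_sqrt_mult)
qed (simp_all add: scaleC_prod_def prod_eq_iff scaleC_add_right scaleC_add_left scaleC_scaleC
      scaleC_of_real)
end

definition clinear_map :: "('a::complex_normed_vector \<Rightarrow> 'b::complex_normed_vector) \<Rightarrow> bool" where
  "clinear_map D \<longleftrightarrow>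
    (\<forall>v w. D (v + w) = D v + D w) \<and> (\<forall>c v. D (c *\<^sub>C v) = c *\<^sub>C D v)"

definition csubspace :: "'a::complex_normed_vector set \<Rightarrow> bool" where
  "csubspace E \<longleftrightarrow>
    0 \<in> E \<and> (\<forall>v\<in>E. \<forall>w\<in>E. v + w \<in> E) \<and> (\<forall>c. \<forall>v\<in>E. c *\<^sub>C v \<in> E)"

text \<open>
  Complex Frechet differentiability at every point. It is meant for sets that are open in the whole
  space or relatively open in a complex linear subspace; in the latter case only the restriction of
  the derivative to the subspace is determined, and a complex linear map on the subspace always
  extends to the whole (finite-dimensional) space.
\<close>
definition holo_on ::
  "'a set \<Rightarrow> ('a::complex_normed_vector \<Rightarrow> 'b::complex_normed_vector) \<Rightarrow> bool" where
  "holo_on S f \<longleftrightarrow> (\<forall>z\<in>S. \<exists>D. (f has_derivative D) (at z within S) \<and> clinear_map D)"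

lemma holo_on_complex_iff:
  fixes f :: "complex \<Rightarrow> complex"
  shows "holo_on S f \<longleftrightarrow> f holomorphic_on S"
proof
  assume *: "holo_on S f"
  show "f holomorphic_on S"
    unfolding holomorphic_on_def
  proof
    fix z assume "z \<in> S"
    then obtain D where D: "(f has_derivative D) (at z within S)" "clinear_map D"
      using * unfolding holo_on_def by blast
    have "D v = D 1 * v" for v
      using D(2) unfolding clinear_map_def scaleC_complex_def
      by (metis mult.commute mult.right_neutral)
    then have "D = (*) (D 1)"
      by blast
    then show "f field_differentiable at z within S"
      using D(1) unfolding field_differentiable_def has_field_derivative_def by metis
  qed
next
  assume "f holomorphic_on S"
  then show "holo_on S f"
    unfolding holo_on_def holomorphic_on_def field_differentiable_def has_field_derivative_def
      clinear_map_def scaleC_complex_def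
    by (metis distrib_left mult.left_commute)
qed


section \<open>Stein manifolds\<close>

text \<open>
  The model space \<open>E\<close> is a complex linear subspace of some \<open>complex ^ 'm\<close>, so that every
  finite dimension, including 0, occurs. An atlas is a set of pairs of a chart domain and a chart.
\<close>

type_synonym ('a, 'e) atlas = "('a set \<times> ('a \<Rightarrow> 'e)) set"

definition complex_manifold ::
  "'a topology \<Rightarrow> 'e::complex_normed_vector set \<Rightarrow> ('a, 'e) atlas \<Rightarrow> bool" where
  "complex_manifold X E A \<longleftrightarrow>
     Hausdorff_space X \<and> second_countable X \<and> csubspace E \<and>
     (\<Union>(U, \<phi>)\<in>A. U) = topspace X \<and>
     (\<forall>(U, \<phi>)\<in>A. openin X U \<and> openin (top_of_set E) (\<phi> ` U) \<and>
        homeomorphic_map (subtopology X U) (top_of_set (\<phi> ` U)) \<phi>) \<and>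
     (\<forall>(U, \<phi>)\<in>A. \<forall>(V, \<psi>)\<in>A. holo_on (\<phi> ` (U \<inter> V)) (\<psi> \<circ> inv_into U \<phi>))"

definition holo_map ::
  "('a, 'e::complex_normed_vector) atlas \<Rightarrow> ('a \<Rightarrow> 'b::complex_normed_vector) \<Rightarrow> bool" where
  "holo_map A f \<longleftrightarrow>
    (\<forall>(U, \<phi>)\<in>A. holo_on (\<phi> ` U) (f \<circ> inv_into U \<phi>))"

text \<open>The product of a manifold with the vector space \<open>'b\<close>.\<close>
definition atlas_times_UNIV ::
  "('a, 'e) atlas \<Rightarrow> ('a \<times> 'b, 'e \<times> 'b) atlas" where
  "atlas_times_UNIV A = (\<lambda>(U, \<phi>). (U \<times> UNIV, map_prod \<phi> id)) ` A"

definition holo_hull ::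
  "'a topology \<Rightarrow> ('a, 'e::complex_normed_vector) atlas \<Rightarrow> 'a set \<Rightarrow> 'a set" where
  "holo_hull X A C = {x \<in> topspace X.
     \<forall>f :: 'a \<Rightarrow> complex. holo_map A f \<longrightarrow> cmod (f x) \<le> (SUP y\<in>C. cmod (f y))}"

text \<open>\<open>C \<noteq> {}\<close> because the supremum of the empty set of reals is unspecified.\<close>
definition stein_manifold ::
  "'a topology \<Rightarrow> 'e::complex_normed_vector set \<Rightarrow> ('a, 'e) atlas \<Rightarrow> bool" where
  "stein_manifold X E A \<longleftrightarrow>
     complex_manifold X E A \<and>
     (\<forall>x\<in>topspace X. \<forall>y\<in>topspace X. x \<noteq> y \<longrightarrow>
        (\<exists>f :: 'a \<Rightarrow> complex. holo_map A f \<and> f x \<noteq> f y)) \<and>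
     (\<forall>C. compactin X C \<and> C \<noteq> {} \<longrightarrow> compactin X (holo_hull X A C))"


section \<open>Holomorphic vector fields and their flows\<close>

text \<open>
  Vector fields on \<open>\<complex>\<^sup>n\<close> are maps of \<open>complex ^ 'n\<close> to itself. The index type is linearly ordered so
  that one can speak of the first \<open>k\<close> coordinates; \<open>card {..<i}\<close> is the position of the index \<open>i\<close>,
  counted from 0.
\<close>
definition coord_subspace :: "nat \<Rightarrow> (complex ^ 'n::{finite,linorder}) set" where
  "coord_subspace k = {z. \<forall>i. k \<le> card {..<i} \<longrightarrow> z $ i = 0}"

definition vanishing_fields ::
  "nat \<Rightarrow> (complex ^ 'n::{finite,linorder} \<Rightarrow> complex ^ 'n::{finite,linorder}) set" where
  "vanishing_fields k = {V. holo_on UNIV V \<and> (\<forall>z\<in>coord_subspace k. V z = 0)}"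

definition integral_curve ::
  "('a::complex_normed_vector \<Rightarrow> 'a) \<Rightarrow> complex set \<Rightarrow> (complex \<Rightarrow> 'a) \<Rightarrow> bool" where
  "integral_curve V T \<gamma> \<longleftrightarrow>
    (\<forall>s\<in>T. (\<gamma> has_derivative (\<lambda>h. h *\<^sub>C V (\<gamma> s))) (at s within T))"

text \<open>
  The flow at the complex time \<open>t\<close> follows the integral curve along the segment from 0 to \<open>t\<close>. For
  real \<open>t\<close> this is the usual real-time flow.
\<close>
definition flow_domain :: "('a::complex_normed_vector \<Rightarrow> 'a) \<Rightarrow> complex \<Rightarrow> 'a set" where
  "flow_domain V t = {p. \<exists>\<gamma>. integral_curve V (closed_segment 0 t) \<gamma> \<and> \<gamma> 0 = p}"

definition flow :: "('a::complex_normed_vector \<Rightarrow> 'a) \<Rightarrow> complex \<Rightarrow> 'a \<Rightarrow> 'a" where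
  "flow V t p = (THE q. \<exists>\<gamma>. integral_curve V (closed_segment 0 t) \<gamma> \<and> \<gamma> 0 = p \<and> \<gamma> t = q)"

definition complete_field :: "('a::complex_normed_vector \<Rightarrow> 'a) \<Rightarrow> bool" where
  "complete_field V \<longleftrightarrow> (\<forall>p. \<exists>\<gamma>. integral_curve V UNIV \<gamma> \<and> \<gamma> 0 = p)"

text \<open>
  Finite compositions of flows; the head of the list acts first.
\<close>
fun flows ::
  "(('a::complex_normed_vector \<Rightarrow> 'a) \<times> complex) list \<Rightarrow> 'a \<Rightarrow> 'a" where
  "flows [] z = z"
| "flows ((V, t) # ws) z = flows ws (flow V t z)"

fun flows_defined ::
  "(('a::complex_normed_vector \<Rightarrow> 'a) \<times> complex) list \<Rightarrow> 'a \<Rightarrow> bool" where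
  "flows_defined [] z \<longleftrightarrow> True"
| "flows_defined ((V, t) # ws) z \<longleftrightarrow> z \<in> flow_domain V t \<and> flows_defined ws (flow V t z)"


section \<open>Jets\<close>

text \<open>
  The Taylor polynomial of order \<open>K\<close> at \<open>p\<close>: the summand of index \<open>j\<close> is the homogeneous term
  \<open>D\<^sup>jf(p)(z - p, \<dots>, z - p) / j!\<close>, computed componentwise as a derivative along the line through
  \<open>p\<close> and \<open>z\<close>.
\<close>
definition taylor_poly ::
  "nat \<Rightarrow> complex ^ 'n \<Rightarrow> (complex ^ 'n \<Rightarrow> complex ^ 'n) \<Rightarrow> complex ^ 'n \<Rightarrow> complex ^ 'n" where
  "taylor_poly K p f z =
    (\<chi> i. \<Sum>j\<le>K. (deriv ^^ j) (\<lambda>s. f (p + s *\<^sub>C (z - p)) $ i) 0 / fact j)"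

text \<open>\<open>J\<^sup>K\<^sub>p\<^sub>,\<^sub>*(\<complex>\<^sup>n)\<close> and \<open>J\<^sup>K\<^sub>0\<^sub>,\<^sub>0(\<complex>\<^sup>n)\<close> with respect to a set \<open>\<gg>\<close> of vector fields.\<close>
definition flow_jets ::
  "nat \<Rightarrow> complex ^ 'n \<Rightarrow> (complex ^ 'n \<Rightarrow> complex ^ 'n) set \<Rightarrow> (complex ^ 'n \<Rightarrow> complex ^ 'n) set"
  where "flow_jets K p \<gg> = {taylor_poly K p (flows ws) | ws.
    set ws \<subseteq> \<gg> \<times> UNIV \<and> eventually (flows_defined ws) (nhds p)}"

definition flow_jets00 ::
  "nat \<Rightarrow> (complex ^ 'n \<Rightarrow> complex ^ 'n) set \<Rightarrow> (complex ^ 'n \<Rightarrow> complex ^ 'n) set" where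
  "flow_jets00 K \<gg> = {Q \<in> flow_jets K 0 \<gg>. Q 0 = 0}"

definition monomial :: "('n::finite \<Rightarrow> nat) \<Rightarrow> complex ^ 'n \<Rightarrow> complex" where
  "monomial \<alpha> z = (\<Prod>i\<in>UNIV. z $ i ^ \<alpha> i)"

text \<open>
  Holomorphic maps into the space of polynomial self-maps of \<open>\<complex>\<^sup>n\<close> of degree at most \<open>K\<close>, in
  coordinates with respect to the basis of monomials.
\<close>
definition holo_poly_family ::
  "'a topology \<Rightarrow> ('a, 'e::complex_normed_vector) atlas \<Rightarrow> nat \<Rightarrow>
    ('a \<Rightarrow> complex ^ 'n \<Rightarrow> complex ^ 'n) \<Rightarrow> bool" where
  "holo_poly_family X A K P \<longleftrightarrow>
    (\<exists>c :: ('n \<Rightarrow> nat) \<Rightarrow> 'a \<Rightarrow> complex ^ 'n.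
       (\<forall>\<alpha>. holo_map A (c \<alpha>)) \<and>
       (\<forall>x\<in>topspace X. \<forall>z. P x z = (\<Sum>\<alpha> | sum \<alpha> UNIV \<le> K. monomial \<alpha> z *\<^sub>C c \<alpha> x)))"


section \<open>Automorphisms\<close>

definition Aut_Cn :: "(complex ^ 'n \<Rightarrow> complex ^ 'n) monoid" where
  "Aut_Cn = \<lparr>carrier = {f. bij f \<and> holo_on UNIV f \<and> holo_on UNIV (inv_into UNIV f)},
     monoid.mult = (\<circ>), one = id\<rparr>"

definition Aut_fields ::
  "(complex ^ 'n \<Rightarrow> complex ^ 'n) set \<Rightarrow> (complex ^ 'n \<Rightarrow> complex ^ 'n) set" where
  "Aut_fields \<gg> = generate Aut_Cn {flow V 1 | V. V \<in> \<gg> \<and> complete_field V}"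

end

theory Submission
  imports Defs "HOL-Complex_Analysis.Cauchy_Integral_Formula" "HOL-Real_Asymp.Real_Asymp"
begin

text \<open>
  The differential of a flow at the fixed point 0 is injective, so the linear part \<open>M\<^sub>x\<close> of \<open>P\<^sub>x\<close> is an
  invertible matrix that is the identity on the subspace. For fixed \<open>x\<close>, Gaussian elimination by
  columns writes \<open>M\<^sub>x\<close> as a product of time-one flows of complete linear fields; no factorization that
  is holomorphic in \<open>x\<close> is needed, because \<open>M\<^sub>x\<close> itself depends holomorphically on \<open>x\<close>. Dividing by
  \<open>M\<^sub>x\<close>, one may assume that \<open>P\<^sub>x\<close> is tangent to the identity, and correct the jet degree by degree.
  Every homogeneous field of degree \<open>d \<ge> 2\<close> that vanishes on the subspace is a linear combination of
  homogeneous complete fields in \<open>\<gg>\<close> with explicit flows (shears, overshears, and diagonal fields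
  times a monomial first integral). Flowing along these for times that are the holomorphic coefficients
  of the error term of degree \<open>d\<close> removes that term.
\<close>

section \<open>Complex scalars\<close>

text \<open>The jets come from flows of arbitrary, possibly incomplete fields, whereas the
  automorphisms must come from complete ones. All that is kept of the origin of \<open>P x\<close>,
  besides its fixing the subspace, is that its linear part is injective. The obstacle is then that a
  monomial field such as \<open>z_j^2\<close> in direction \<open>j\<close> is not complete. It has
  to be reached as a linear combination of complete fields, although automorphisms can only be
  composed, not added. This works because, modulo terms of degree above \<open>d\<close>, composing
  a map tangent to the identity with the flow of a homogeneous field of degree
  \<open>d \<ge> 2\<close> adds that field; hence the prior division by the linear part. Membership
  in the group is required for each \<open>x\<close> separately, which is why the linear part may be
  factorized pointwise. Since the error vanishes on the subspace, only monomials divisible by a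
  transversal coordinate occur in it. The assumption \<open>1 \<le> k\<close> supplies the second
  coordinate without which \<open>z_j^2\<close> in direction \<open>j\<close> could not be
  reached.\<close>

lemma scaleC_complex_eq [simp]: "c *\<^sub>C (x::complex) = c * x"
  by (simp add: scaleC_complex_def)

lemma scaleC_vec_nth [simp]: "(c *\<^sub>C v) $ i = c *\<^sub>C (v $ i)"
  by (simp add: scaleC_vec_def)

lemma scaleC_zero_left [simp]: "0 *\<^sub>C v = 0"
  by (metis norm_scaleC norm_eq_zero mult_zero_left norm_zero)

lemma scaleC_zero_right [simp]: "c *\<^sub>C 0 = 0"
  by (metis norm_scaleC norm_eq_zero mult_zero_right norm_zero)

lemma scaleC_one_left [simp]: "1 *\<^sub>C v = v"
  using scaleC_of_real[of 1 v] by simp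

lemma scaleC_minus_right: "c *\<^sub>C (x - y) = c *\<^sub>C x - c *\<^sub>C y"
  by (metis add_diff_cancel diff_add_cancel scaleC_add_right)

lemma bounded_linear_scaleC_right: "bounded_linear (\<lambda>v. c *\<^sub>C v)"
proof
  show "c *\<^sub>C (r *\<^sub>R v) = r *\<^sub>R (c *\<^sub>C v)" for r and v :: 'a
    by (metis mult.commute scaleC_of_real scaleC_scaleC)
  show "\<exists>K. \<forall>v::'a. norm (c *\<^sub>C v) \<le> norm v * K"
    by (intro exI[of _ "cmod c"]) (auto simp: norm_scaleC mult.commute)
qed (simp add: scaleC_add_right)

lemma bounded_linear_scaleC_left: "bounded_linear (\<lambda>c. c *\<^sub>C v)"
proof
  show "(r *\<^sub>R c) *\<^sub>C v = r *\<^sub>R (c *\<^sub>C v)" for r c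
    by (metis scaleC_of_real scaleC_scaleC scaleR_conv_of_real)
  show "\<exists>K. \<forall>c. norm (c *\<^sub>C v) \<le> norm c * K"
    by (auto simp: norm_scaleC)
qed (simp add: scaleC_add_left)

lemma has_derivative_vec_iff:
  fixes f :: "'a::real_normed_vector \<Rightarrow> 'b::real_normed_vector ^ 'n"
  shows "(f has_derivative D) (at z within S) \<longleftrightarrow>
    (\<forall>i. ((\<lambda>z. f z $ i) has_derivative (\<lambda>v. D v $ i)) (at z within S))"
proof
  assume "(f has_derivative D) (at z within S)"
  then show "\<forall>i. ((\<lambda>z. f z $ i) has_derivative (\<lambda>v. D v $ i)) (at z within S)"
    by (auto intro: bounded_linear.has_derivative[OF bounded_linear_vec_nth])
next
  assume *: "\<forall>i. ((\<lambda>z. f z $ i) has_derivative (\<lambda>v. D v $ i)) (at z within S)"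
  have bl: "bounded_linear (axis i :: 'b \<Rightarrow> 'b ^ 'n)" for i
  proof
    show "\<exists>K. \<forall>x. norm (axis i x :: 'b ^ 'n) \<le> norm x * K"
    proof (intro exI allI)
      fix x :: 'b
      have "norm (axis i x :: 'b ^ 'n) \<le> (\<Sum>j\<in>UNIV. norm ((axis i x :: 'b ^ 'n) $ j))"
        unfolding norm_vec_def by (intro L2_set_le_sum) simp
      also have "\<dots> = (\<Sum>j\<in>UNIV. if j = i then norm x else 0)"
        by (intro sum.cong) (auto simp: axis_def)
      finally show "norm (axis i x :: 'b ^ 'n) \<le> norm x * 1"
        by simp
    qed
  qed (auto simp: axis_def vec_eq_iff)
  have sum_axis: "(\<Sum>i\<in>UNIV. axis i (v $ i)) = v" for v :: "'b ^ 'n"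
    by (simp add: vec_eq_iff axis_def if_distrib cong: if_cong)
  have "((\<lambda>z. \<Sum>i\<in>UNIV. axis i (f z $ i)) has_derivative (\<lambda>v. \<Sum>i\<in>UNIV. axis i (D v $ i))) (at z within S)"
    by (intro has_derivative_sum bounded_linear.has_derivative[OF bl]) (use * in auto)
  then show "(f has_derivative D) (at z within S)"
    by (simp add: sum_axis)
qed

section \<open>Calculus of holomorphic maps\<close>

lemma clinear_map_nth: "clinear_map D \<Longrightarrow> clinear_map (\<lambda>v. D v $ i)"
  by (simp add: clinear_map_def)

lemma holo_on_vec_iff: "holo_on S f \<longleftrightarrow> (\<forall>i. holo_on S (\<lambda>z. f z $ i))"
proof
  assume "holo_on S f"
  then show "\<forall>i. holo_on S (\<lambda>z. f z $ i)"
    unfolding holo_on_def has_derivative_vec_iff by (fast intro: clinear_map_nth)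
next
  assume *: "\<forall>i. holo_on S (\<lambda>z. f z $ i)"
  show "holo_on S f"
    unfolding holo_on_def
  proof
    fix z assume "z \<in> S"
    then have "\<forall>i. \<exists>D. ((\<lambda>z. f z $ i) has_derivative D) (at z within S) \<and> clinear_map D"
      using * unfolding holo_on_def by blast
    then obtain D where D: "\<And>i. ((\<lambda>z. f z $ i) has_derivative D i) (at z within S)" "\<And>i. clinear_map (D i)"
      by metis
    show "\<exists>D. (f has_derivative D) (at z within S) \<and> clinear_map D"
      using D by (intro exI[of _ "\<lambda>v. \<chi> i. D i v"]) (auto simp: has_derivative_vec_iff clinear_map_def vec_eq_iff)
  qed
qed

lemma holo_on_cong:
  assumes "holo_on S f" "\<And>z. z \<in> S \<Longrightarrow> f z = g z"
  shows "holo_on S g"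
  using assms unfolding holo_on_def by (metis has_derivative_transform)

lemma holo_on_compose:
  assumes g: "holo_on T g" and f: "holo_on S f" and "f ` S \<subseteq> T"
  shows "holo_on S (\<lambda>z. g (f z))"
  unfolding holo_on_def
proof
  fix z assume z: "z \<in> S"
  obtain D where D: "(f has_derivative D) (at z within S)" "clinear_map D"
    using f z by (auto simp: holo_on_def)
  obtain D' where D': "(g has_derivative D') (at (f z) within T)" "clinear_map D'"
    using g z assms(3) by (force simp: holo_on_def)
  have "((\<lambda>x. g (f x)) has_derivative (\<lambda>x. D' (D x))) (at z within S)"
    using has_derivative_in_compose[OF D(1) has_derivative_subset[OF D'(1) assms(3)]] .
  moreover have "clinear_map (\<lambda>x. D' (D x))"
    using D(2) D'(2) by (simp add: clinear_map_def)
  ultimately show "\<exists>D. ((\<lambda>x. g (f x)) has_derivative D) (at z within S) \<and> clinear_map D"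
    by blast
qed

lemma holo_on_const: "holo_on S (\<lambda>_. c)"
  unfolding holo_on_def clinear_map_def by (auto intro!: exI[of _ "\<lambda>_. 0"])

lemma holo_on_linear:
  assumes "bounded_linear D" "clinear_map D"
  shows "holo_on S D"
  unfolding holo_on_def using assms bounded_linear_imp_has_derivative by blast

lemma holo_on_add:
  assumes "holo_on S f" "holo_on S g"
  shows "holo_on S (\<lambda>z. f z + g z)"
  unfolding holo_on_def
proof
  fix z assume z: "z \<in> S"
  obtain D where D: "(f has_derivative D) (at z within S)" "clinear_map D"
    using assms z by (auto simp: holo_on_def)
  obtain D' where D': "(g has_derivative D') (at z within S)" "clinear_map D'"
    using assms z by (auto simp: holo_on_def)
  have "clinear_map (\<lambda>h. D h + D' h)"
    using D(2) D'(2) by (simp add: clinear_map_def scaleC_add_right)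
  then show "\<exists>D. ((\<lambda>z. f z + g z) has_derivative D) (at z within S) \<and> clinear_map D"
    using has_derivative_add[OF D(1) D'(1)] by blast
qed

lemma holo_on_mult:
  fixes f g :: "_ \<Rightarrow> complex"
  assumes "holo_on S f" "holo_on S g"
  shows "holo_on S (\<lambda>z. f z * g z)"
  unfolding holo_on_def
proof
  fix z assume z: "z \<in> S"
  obtain D where D: "(f has_derivative D) (at z within S)" "clinear_map D"
    using assms z by (auto simp: holo_on_def)
  obtain D' where D': "(g has_derivative D') (at z within S)" "clinear_map D'"
    using assms z by (auto simp: holo_on_def)
  have "clinear_map (\<lambda>h. f z * D' h + D h * g z)"
    using D(2) D'(2) by (simp add: clinear_map_def algebra_simps)
  then show "\<exists>D. ((\<lambda>z. f z * g z) has_derivative D) (at z within S) \<and> clinear_map D"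
    using has_derivative_mult[OF D(1) D'(1)] by blast
qed

lemma holo_on_nth: "holo_on S (\<lambda>z. z $ i)"
  by (intro holo_on_linear bounded_linear_vec_nth) (simp add: clinear_map_def)

lemma holo_on_ident: "holo_on S (\<lambda>z. z)"
  by (intro holo_on_linear bounded_linear_ident) (simp add: clinear_map_def)

lemma holo_on_subset: "holo_on S f \<Longrightarrow> T \<subseteq> S \<Longrightarrow> holo_on T f"
  unfolding holo_on_def by (meson has_derivative_subset subsetD)

lemma holo_on_continuous: "holo_on S f \<Longrightarrow> continuous_on S f"
  unfolding holo_on_def continuous_on_eq_continuous_within using has_derivative_continuous by blast

lemma holo_on_line: "holo_on S (\<lambda>s. p + s *\<^sub>C v)"
  by (intro holo_on_add holo_on_const holo_on_linear bounded_linear_scaleC_left)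
    (simp add: clinear_map_def scaleC_add_left scaleC_scaleC)

section \<open>Integral curves\<close>

text \<open>Cauchy's estimate on the complex line through \<open>p\<close> and \<open>q\<close>
  bounds the derivative of each component along the segment, given a bound \<open>M\<close> for
  \<open>V\<close> on the ball of radius \<open>2 * R\<close>. The factor \<open>CARD('m)\<close>
  pays for passing from components to the norm.\<close>

lemma holo_lipschitz_on_ball:
  fixes V :: "complex ^ 'n \<Rightarrow> complex ^ 'm"
  assumes V: "holo_on UNIV V" and R: "R > 0"
  obtains C where "C \<ge> 0"
    "\<And>p q. norm p \<le> R \<Longrightarrow> norm q \<le> R \<Longrightarrow> norm (V p - V q) \<le> C * norm (p - q)"
proof -
  have "compact (V ` cball 0 (2 * R))"
    using holo_on_continuous[OF V] by (meson compact_cball compact_continuous_image continuous_on_subset top_greatest)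
  then obtain M where M: "\<And>z. norm z \<le> 2 * R \<Longrightarrow> norm (V z) \<le> M"
    using compact_imp_bounded bounded_iff by (metis (no_types, lifting) imageI mem_cball_0)
  define C where "C = CARD('m) * (M / R)"
  have "M \<ge> 0" using M[of 0] R norm_ge_zero[of "V 0"] by (simp del: norm_ge_zero)
  then have "C \<ge> 0" using R by (simp add: C_def)
  moreover have "norm (V p - V q) \<le> C * norm (p - q)" if p: "norm p \<le> R" and q: "norm q \<le> R" for p q
  proof (cases "p = q")
    case False
    \<comment> \<open>With this radius the circles about parameters of the segment are mapped by the
      line into the ball of radius \<open>2 * R\<close>. The resulting bound \<open>M / r\<close> is
      proportional to \<open>norm (p - q)\<close>.\<close>
    define r where "r = R / norm (p - q)"
    have r: "r > 0" using False R by (simp add: r_def)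
    have comp: "norm (V p $ i - V q $ i) \<le> (M / R) * norm (p - q)" for i
    proof -
      define g where "g = (\<lambda>s. V (q + s *\<^sub>C (p - q)) $ i)"
      have hol: "g holomorphic_on UNIV"
        unfolding g_def holo_on_complex_iff[symmetric]
        by (rule holo_on_vec_iff[THEN iffD1, rule_format, OF holo_on_compose[OF V holo_on_line]]) simp
      have seg: "norm (q + s *\<^sub>C (p - q)) \<le> R" if "s \<in> closed_segment 0 1" for s
      proof -
        obtain u where u: "0 \<le> u" "u \<le> 1" "s = of_real u"
          using \<open>s \<in> closed_segment 0 1\<close> by (auto simp: closed_segment_def scaleR_conv_of_real)
        have "q + s *\<^sub>C (p - q) = (1 - u) *\<^sub>R q + u *\<^sub>R p"
          by (simp add: u scaleC_of_real algebra_simps)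
        also have "norm \<dots> \<le> (1 - u) * norm q + u * norm p"
          using u by (metis abs_of_nonneg diff_ge_0_iff_ge norm_scaleR norm_triangle_ineq)
        also have "\<dots> \<le> (1 - u) * R + u * R"
          using u p q by (intro add_mono mult_left_mono) auto
        finally show ?thesis by (simp add: algebra_simps)
      qed
      have bd: "norm (deriv g s) \<le> M / r" if s: "s \<in> closed_segment 0 1" for s
      proof -
        have "norm ((deriv ^^ 1) g s) \<le> fact 1 * M / r ^ 1"
        proof (rule Cauchy_inequality)
          show "g holomorphic_on ball s r" "continuous_on (cball s r) g"
            using hol holomorphic_on_subset holomorphic_on_imp_continuous_on by blast+
          fix w assume w: "norm (s - w) = r"
          have "q + w *\<^sub>C (p - q) = (q + s *\<^sub>C (p - q)) - (s - w) *\<^sub>C (p - q)"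
            by (simp add: vec_eq_iff algebra_simps)
          then have "norm (q + w *\<^sub>C (p - q)) \<le> norm (q + s *\<^sub>C (p - q)) + norm ((s - w) *\<^sub>C (p - q))"
            by (simp only: norm_triangle_ineq4)
          also have "\<dots> \<le> R + r * norm (p - q)"
            using seg[OF s] w by (intro add_mono) (auto simp: norm_scaleC)
          also have "\<dots> = 2 * R" using False by (simp add: r_def)
          finally show "norm (g w) \<le> M"
            unfolding g_def by (rule order_trans[OF Finite_Cartesian_Product.norm_nth_le M])
        qed (use r in auto)
        then show ?thesis by simp
      qed
      have "norm (g 1 - g 0) \<le> (M / r) * norm (1 - 0 :: complex)"
      proof (rule field_differentiable_bound[where S="closed_segment 0 1" and f'="deriv g"])
        show "(g has_field_derivative deriv g z) (at z within closed_segment 0 1)" for z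
          using hol by (meson UNIV_I has_field_derivative_at_within holomorphic_derivI open_UNIV)
      qed (use bd in auto)
      also have "M / r = (M / R) * norm (p - q)" by (simp add: r_def)
      finally show ?thesis by (simp add: g_def)
    qed
    have "norm (V p - V q) \<le> (\<Sum>i\<in>UNIV. norm ((V p - V q) $ i))"
      unfolding norm_vec_def by (intro L2_set_le_sum) simp
    also have "\<dots> \<le> (\<Sum>i\<in>(UNIV::'m set). (M / R) * norm (p - q))"
      using comp by (intro sum_mono) auto
    also have "\<dots> = C * norm (p - q)" by (simp add: C_def)
    finally show ?thesis .
  qed auto
  ultimately show thesis using that by blast
qed

text \<open>Multiplied by \<open>exp (- 2 * C * u)\<close> the squared norm decreases, by
  \<open>exp (2 * C * u)\<close> it increases; squaring keeps it differentiable where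
  \<open>d\<close> vanishes. The second inequality bounds \<open>d b\<close> from below, which later
  makes the differential of a flow injective.\<close>

lemma gronwall:
  fixes d :: "real \<Rightarrow> 'a::real_inner"
  assumes der: "\<And>u. u \<in> {0..b} \<Longrightarrow> (d has_vector_derivative d' u) (at u within {0..b})"
    and bd: "\<And>u. u \<in> {0..b} \<Longrightarrow> norm (d' u) \<le> C * norm (d u)"
    and b: "0 \<le> b"
  shows "norm (d b) \<le> exp (C * b) * norm (d 0)" "norm (d 0) \<le> exp (C * b) * norm (d b)"
proof -
  have cont: "continuous_on {0..b} d"
    using der by (meson continuous_on_eq_continuous_within has_vector_derivative_continuous)
  have D: "((\<lambda>u. exp (c * u) * (d u \<bullet> d u)) has_real_derivative
      exp (c * u) * (2 * (d u \<bullet> d' u) + c * (d u \<bullet> d u))) (at u)" if u: "0 < u" "u < b" for u c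
  proof -
    have "at u within {0..b} = at u"
      using u by (simp add: at_within_Icc_at)
    then have "(d has_vector_derivative d' u) (at u)"
      using der[of u] u by simp
    then have "(d has_derivative (\<lambda>h. h *\<^sub>R d' u)) (at u)"
      by (simp add: has_vector_derivative_def)
    then have "((\<lambda>u. d u \<bullet> d u) has_derivative (\<lambda>h. d u \<bullet> h *\<^sub>R d' u + h *\<^sub>R d' u \<bullet> d u)) (at u)"
      by (intro has_derivative_inner)
    then have "((\<lambda>u. d u \<bullet> d u) has_real_derivative 2 * (d u \<bullet> d' u)) (at u)"
      unfolding has_field_derivative_def
      by (rule has_derivative_eq_rhs) (auto simp: inner_commute algebra_simps)
    then show ?thesis
      by (auto intro!: derivative_eq_intros simp: algebra_simps)
  qed
  have dd: "\<bar>d u \<bullet> d' u\<bar> \<le> C * (d u \<bullet> d u)" if "u \<in> {0..b}" for u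
  proof -
    have "\<bar>d u \<bullet> d' u\<bar> \<le> norm (d u) * norm (d' u)" by (rule Cauchy_Schwarz_ineq2)
    also have "\<dots> \<le> norm (d u) * (C * norm (d u))" using bd[OF that] by (intro mult_left_mono) auto
    also have "\<dots> = C * (d u \<bullet> d u)"
      by (simp add: power2_norm_eq_inner[symmetric] power2_eq_square)
    finally show ?thesis .
  qed
  have "exp (- 2 * C * b) * (d b \<bullet> d b) \<le> exp (- 2 * C * 0) * (d 0 \<bullet> d 0)"
  proof (rule DERIV_nonpos_imp_decreasing_open[OF b])
    fix u assume u: "0 < u" "u < b"
    show "\<exists>y. ((\<lambda>u. exp (- 2 * C * u) * (d u \<bullet> d u)) has_real_derivative y) (at u) \<and> y \<le> 0"
      using D[OF u, of "-2 * C"] dd[of u] u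
      by (intro exI conjI) (auto simp: mult_le_0_iff)
  qed (intro continuous_intros cont)
  then have "d b \<bullet> d b \<le> exp (2 * C * b) * (d 0 \<bullet> d 0)"
    by (simp add: exp_minus field_simps)
  then have "(norm (d b))\<^sup>2 \<le> (exp (C * b) * norm (d 0))\<^sup>2"
    by (simp add: power2_norm_eq_inner power_mult_distrib exp_double[symmetric] mult.assoc)
  then show "norm (d b) \<le> exp (C * b) * norm (d 0)"
    by (rule power2_le_imp_le) simp
  have "- (exp (2 * C * b) * (d b \<bullet> d b)) \<le> - (exp (2 * C * 0) * (d 0 \<bullet> d 0))"
  proof (rule DERIV_nonpos_imp_decreasing_open[OF b])
    fix u assume u: "0 < u" "u < b"
    show "\<exists>y. ((\<lambda>u. - (exp (2 * C * u) * (d u \<bullet> d u))) has_real_derivative y) (at u) \<and> y \<le> 0"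
      using DERIV_minus[OF D[OF u, of "2 * C"]] dd[of u] u
      by (intro exI conjI) (auto simp: mult_le_0_iff zero_le_mult_iff)
  qed (intro continuous_intros cont)
  then have "(norm (d 0))\<^sup>2 \<le> (exp (C * b) * norm (d b))\<^sup>2"
    by (simp add: power2_norm_eq_inner power_mult_distrib exp_double[symmetric] mult.assoc)
  then show "norm (d 0) \<le> exp (C * b) * norm (d b)"
    by (rule power2_le_imp_le) simp
qed

text \<open>Trades the complex time \<open>t\<close> for real time one and the field
  \<open>t *\<^sub>C V\<close>, so that the real estimates apply.\<close>

lemma integral_curve_real:
  assumes "integral_curve V (closed_segment 0 t) \<gamma>" and u: "u \<in> {0..1}"
  shows "((\<lambda>u. \<gamma> (of_real u * t)) has_vector_derivative t *\<^sub>C V (\<gamma> (of_real u * t))) (at u within {0..1})"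
proof -
  have seg: "(\<lambda>u. of_real u * t) ` {0..1::real} \<subseteq> closed_segment 0 t"
    by (auto simp: closed_segment_def scaleR_conv_of_real)
  then have "of_real u * t \<in> closed_segment 0 t" using u by blast
  then have *: "(\<gamma> has_derivative (\<lambda>h. h *\<^sub>C V (\<gamma> (of_real u * t)))) (at (of_real u * t) within closed_segment 0 t)"
    using assms(1) by (simp add: integral_curve_def)
  have "((\<lambda>u. of_real u * t) has_derivative (\<lambda>h. of_real h * t)) (at u within {0..1})"
    by (intro derivative_eq_intros refl) auto
  from has_derivative_in_compose[OF this has_derivative_subset[OF * seg]]
  show ?thesis
    by (simp add: has_vector_derivative_def scaleC_scaleC[symmetric] scaleC_of_real)
qed

text \<open>Needed for the definite description in \<open>flow\<close>. By compactness both curves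
  lie in one ball, on which \<open>V\<close> is Lipschitz, and their difference starts at 0.\<close>

lemma integral_curve_unique:
  fixes V :: "complex ^ 'n \<Rightarrow> complex ^ 'n"
  assumes V: "holo_on UNIV V"
    and c1: "integral_curve V (closed_segment 0 t) \<gamma>1"
    and c2: "integral_curve V (closed_segment 0 t) \<gamma>2"
    and eq: "\<gamma>1 0 = \<gamma>2 0"
  shows "\<gamma>1 t = \<gamma>2 t"
proof -
  have "continuous_on (closed_segment 0 t) \<gamma>1" "continuous_on (closed_segment 0 t) \<gamma>2"
    using c1 c2 unfolding integral_curve_def continuous_on_eq_continuous_within
    using has_derivative_continuous by blast+
  then have "bounded (\<gamma>1 ` closed_segment 0 t \<union> \<gamma>2 ` closed_segment 0 t)"
    by (intro compact_imp_bounded compact_Un compact_continuous_image) auto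
  then obtain R where R: "R > 0" "\<And>s. s \<in> closed_segment 0 t \<Longrightarrow> norm (\<gamma>1 s) \<le> R \<and> norm (\<gamma>2 s) \<le> R"
    unfolding bounded_pos by auto
  obtain C where C: "\<And>p q. norm p \<le> R \<Longrightarrow> norm q \<le> R \<Longrightarrow> norm (V p - V q) \<le> C * norm (p - q)"
    using holo_lipschitz_on_ball[OF V R(1)] by metis
  have "norm (\<gamma>1 (of_real 1 * t) - \<gamma>2 (of_real 1 * t)) \<le>
      exp ((cmod t * C) * 1) * norm (\<gamma>1 (of_real 0 * t) - \<gamma>2 (of_real 0 * t))"
  proof (rule gronwall)
    fix u :: real assume u: "u \<in> {0..1}"
    show "((\<lambda>u. \<gamma>1 (of_real u * t) - \<gamma>2 (of_real u * t)) has_vector_derivative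
        t *\<^sub>C V (\<gamma>1 (of_real u * t)) - t *\<^sub>C V (\<gamma>2 (of_real u * t))) (at u within {0..1})"
      by (intro has_vector_derivative_diff integral_curve_real c1 c2 u)
    have "of_real u * t \<in> closed_segment 0 t"
      using u by (auto simp: closed_segment_def scaleR_conv_of_real)
    then show "norm (t *\<^sub>C V (\<gamma>1 (of_real u * t)) - t *\<^sub>C V (\<gamma>2 (of_real u * t)))
        \<le> cmod t * C * norm (\<gamma>1 (of_real u * t) - \<gamma>2 (of_real u * t))"
      unfolding scaleC_minus_right[symmetric] norm_scaleC mult.assoc
      by (intro mult_left_mono C) (use R in auto)
  qed auto
  then show ?thesis by (simp add: eq)
qed

lemma flow_eq:
  fixes V :: "complex ^ 'n \<Rightarrow> complex ^ 'n"
  assumes "holo_on UNIV V" "integral_curve V (closed_segment 0 t) \<gamma>"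
  shows "flow V t (\<gamma> 0) = \<gamma> t"
  unfolding flow_def
  by (rule the_equality) (use assms integral_curve_unique in blast)+

text \<open>Euler's method with \<open>N\<close> steps on \<open>[0, 1]\<close>. Its iterates are finite compositions of the field
  and hence holomorphic in the initial value, and so is their uniform limit, the flow.\<close>

lemma euler_estimates:
  fixes W :: "'v::real_inner \<Rightarrow> 'v"
  assumes lip: "\<And>p q. norm p \<le> R \<Longrightarrow> norm q \<le> R \<Longrightarrow> norm (W p - W q) \<le> C * norm (p - q)"
    and W0: "W 0 = 0" and C: "C \<ge> 0" and R: "R > 0"
    and der: "\<And>u. u \<in> {0..1} \<Longrightarrow> (\<gamma> has_vector_derivative W (\<gamma> u)) (at u within {0..1})"
    and small: "exp C * norm (\<gamma> 0) < R"
  shows "norm (\<gamma> 0) \<le> exp C * norm (\<gamma> 1)"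
    and "N > 0 \<Longrightarrow> norm (\<gamma> 1 - ((\<lambda>z. z + (1 / real N) *\<^sub>R W z) ^^ N) (\<gamma> 0)) \<le> exp C * (3 * C\<^sup>2 * R) / N"
proof -
  have Wbd: "norm (W p) \<le> C * norm p" if "norm p \<le> R" for p
    using lip[of p 0] that W0 R by simp
  have cont: "continuous_on {0..1} \<gamma>"
    using der by (meson continuous_on_eq_continuous_within has_vector_derivative_continuous)
  have expC: "exp (C * u) \<le> exp C" if "u \<le> 1" for u
    using that C by (simp add: mult_left_le)
  have g0: "norm (\<gamma> 0) < R"
    using small mult_right_mono[of 1 "exp C" "norm (\<gamma> 0)"] C by simp
  \<comment> \<open>First exit time: \<open>S\<close> collects the times at which the norm equals
    \<open>R\<close>. Up to the first of them the Lipschitz bound holds, so Gronwall keeps the norm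
    at that time below \<open>R\<close>, a contradiction.\<close>
  have below: "norm (\<gamma> u) < R" if u: "u \<in> {0..1}" for u
  proof (rule ccontr)
    assume "\<not> norm (\<gamma> u) < R"
    have contn: "continuous_on {0..v} (\<lambda>u. norm (\<gamma> u))" if "v \<le> 1" for v
      using that by (intro continuous_on_norm continuous_on_subset[OF cont]) auto
    have ivt: "\<exists>w. 0 \<le> w \<and> w \<le> v \<and> norm (\<gamma> w) = R" if "v \<in> {0..1}" "R \<le> norm (\<gamma> v)" for v
      using IVT'[of "\<lambda>u. norm (\<gamma> u)" 0 R v] contn[of v] that g0 by auto
    define S where "S = {v \<in> {0..1}. norm (\<gamma> v) = R}"
    obtain w where "0 \<le> w" "w \<le> u" "norm (\<gamma> w) = R"
      using ivt[OF u] \<open>\<not> norm (\<gamma> u) < R\<close> by auto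
    then have "w \<in> S" using u by (simp add: S_def)
    then have "S \<noteq> {}" by blast
    moreover have "closed S"
      unfolding S_def using contn[of 1] by (intro continuous_closed_preimage_constant) auto
    moreover have bS: "bdd_below S" by (auto simp: S_def)
    ultimately have "Inf S \<in> S" by (intro closed_contains_Inf)
    then have m: "Inf S \<in> {0..1}" "norm (\<gamma> (Inf S)) = R" by (auto simp: S_def)
    have le: "norm (\<gamma> v) \<le> R" if v: "v \<in> {0..Inf S}" for v
    proof (rule ccontr)
      assume nle: "\<not> norm (\<gamma> v) \<le> R"
      then obtain w where w: "0 \<le> w" "w \<le> v" "norm (\<gamma> w) = R"
        using ivt[of v] v m by auto
      then have "w \<in> S" using v m by (auto simp: S_def)
      then have "Inf S \<le> w" using bS by (rule cInf_lower)
      then have "w = v" using w v by simp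
      then show False using nle w by simp
    qed
    have "norm (\<gamma> (Inf S)) \<le> exp (C * Inf S) * norm (\<gamma> 0)"
    proof (rule gronwall)
      show "(\<gamma> has_vector_derivative W (\<gamma> u)) (at u within {0..Inf S})" if "u \<in> {0..Inf S}" for u
        using der[of u] m that by (auto intro: has_vector_derivative_within_subset)
      show "norm (W (\<gamma> u)) \<le> C * norm (\<gamma> u)" if "u \<in> {0..Inf S}" for u
        using Wbd le that by blast
    qed (use m in auto)
    also have "\<dots> \<le> exp C * norm (\<gamma> 0)"
      using m expC by (intro mult_right_mono) auto
    finally show False using small m by simp
  qed
  then have bel: "norm (\<gamma> u) \<le> R" if "u \<in> {0..1}" for u
    using that by force
  have "norm (\<gamma> 0) \<le> exp (C * 1) * norm (\<gamma> 1)"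
    by (rule gronwall(2)[of 1 \<gamma> "\<lambda>u. W (\<gamma> u)"]) (use der Wbd bel in auto)
  then show "norm (\<gamma> 0) \<le> exp C * norm (\<gamma> 1)" by simp
  assume N: "N > 0"
  define h where "h = 1 / real N"
  have h: "h > 0" using N by (simp add: h_def)
  define T where "T = (\<lambda>z. z + h *\<^sub>R W z)"
  \<comment> \<open>Local error in units of \<open>h\<^sup>2\<close>: within one step the curve
    moves by at most \<open>3 * C * R * h\<close> (see \<open>near\<close>), so its velocity changes
    by at most \<open>C * (3 * C * R * h)\<close>, and this acts for the time
    \<open>h\<close>.\<close>
  define D where "D = 3 * C\<^sup>2 * R"
  have D: "D \<ge> 0" using R by (simp add: D_def)
  have step: "norm (\<gamma> (u + h) - T (\<gamma> u)) \<le> D * h\<^sup>2" if u: "0 \<le> u" "u + h \<le> 1" for u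
  proof -
    have sub: "{u..u + h} \<subseteq> {0..1}" using u h by auto
    have der': "(\<gamma> has_vector_derivative W (\<gamma> v)) (at v within S)" if "v \<in> S" "S \<subseteq> {u..u + h}" for v S
      by (rule has_vector_derivative_within_subset[OF der]) (use sub that in blast)+
    have Wb: "norm (W (\<gamma> v)) \<le> C * R" if "v \<in> {u..u + h}" for v
      using Wbd[of "\<gamma> v"] bel[of v] sub that C by (smt (verit) mult_left_mono subsetD)
    have near: "norm (\<gamma> v - \<gamma> u) \<le> 3 * C * R * h" if v: "v \<in> {u..u + h}" for v
    proof -
      have "norm (\<gamma> v - \<gamma> u - (v - u) *\<^sub>R W (\<gamma> u)) \<le> norm (v - u) * (2 * (C * R))"
      proof (rule vector_differentiable_bound_linearization[where S="{u..u + h}"])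
        fix w assume w: "w \<in> {u..u + h}"
        show "norm (W (\<gamma> w) - W (\<gamma> u)) \<le> 2 * (C * R)"
          using norm_triangle_ineq4[of "W (\<gamma> w)" "W (\<gamma> u)"] Wb[OF w] Wb[of u] h by simp
      qed (use v h der' in \<open>auto simp: closed_segment_eq_real_ivl\<close>)
      moreover have "norm ((v - u) *\<^sub>R W (\<gamma> u)) \<le> norm (v - u) * (C * R)"
        using Wb[of u] h by (auto intro!: mult_left_mono)
      ultimately have "norm (\<gamma> v - \<gamma> u) \<le> norm (v - u) * (3 * (C * R))"
        using norm_triangle_sub[of "\<gamma> v - \<gamma> u" "(v - u) *\<^sub>R W (\<gamma> u)"] by (simp add: algebra_simps)
      also have "\<dots> \<le> h * (3 * (C * R))"
        using v C R by (intro mult_right_mono) auto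
      finally show ?thesis by (simp add: algebra_simps)
    qed
    have "norm (\<gamma> (u + h) - \<gamma> u - (u + h - u) *\<^sub>R W (\<gamma> u)) \<le> norm (u + h - u) * (C * (3 * C * R * h))"
    proof (rule vector_differentiable_bound_linearization[where S="{u..u + h}"])
      fix w assume w: "w \<in> {u..u + h}"
      have "norm (W (\<gamma> w) - W (\<gamma> u)) \<le> C * norm (\<gamma> w - \<gamma> u)"
        by (intro lip bel) (use w sub h u in auto)
      also have "\<dots> \<le> C * (3 * C * R * h)"
        using near[OF w] C by (intro mult_left_mono)
      finally show "norm (W (\<gamma> w) - W (\<gamma> u)) \<le> C * (3 * C * R * h)" .
    qed (use h der' in \<open>auto simp: closed_segment_eq_real_ivl\<close>)
    then show ?thesis
      using h by (simp add: T_def D_def power2_eq_square algebra_simps)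
  qed
  have pw: "(1 + h * C) ^ j \<le> exp C" if "j \<le> N" for j
  proof -
    have "(1 + h * C) ^ j \<le> (1 + h * C) ^ N"
      using that h C by (intro power_increasing) auto
    also have "\<dots> \<le> exp (h * C) ^ N"
      using h C by (intro power_mono) auto
    also have "\<dots> = exp C" using N by (simp add: exp_of_nat_mult[symmetric] h_def)
    finally show ?thesis .
  qed
  \<comment> \<open>The Euler iterates have to stay in the ball too, for the Lipschitz bound to
    apply to them; \<open>small\<close> leaves exactly the room for the factor \<open>exp C\<close>
    of \<open>pw\<close>.\<close>
  have Tn: "norm ((T ^^ j) (\<gamma> 0)) \<le> (1 + h * C) ^ j * norm (\<gamma> 0)" if "j \<le> N" for j
    using that
  proof (induction j)
    case (Suc j)
    define e where "e = (T ^^ j) (\<gamma> 0)"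
    have e: "norm e \<le> (1 + h * C) ^ j * norm (\<gamma> 0)" using Suc by (simp add: e_def)
    also have "\<dots> \<le> exp C * norm (\<gamma> 0)" using pw[of j] Suc by (intro mult_right_mono) auto
    finally have "norm (W e) \<le> C * norm e" using small by (intro Wbd) simp
    then have "h * norm (W e) \<le> h * (C * norm e)" using h by (intro mult_left_mono) auto
    then have "norm e + norm (h *\<^sub>R W e) \<le> (1 + h * C) * norm e"
      using h by (simp only: norm_scaleR abs_of_pos distrib_right mult.assoc mult_1 add_le_cancel_left)
    then have "norm (T e) \<le> (1 + h * C) * norm e"
      unfolding T_def using norm_triangle_ineq order_trans by blast
    also have "\<dots> \<le> (1 + h * C) * ((1 + h * C) ^ j * norm (\<gamma> 0))"
      using e h C by (intro mult_left_mono) auto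
    finally show ?case by (simp add: e_def mult.assoc)
  qed simp
  \<comment> \<open>Each of the \<open>j\<close> steps adds at most \<open>D * h\<^sup>2\<close>,
    amplified by at most \<open>(1 + h * C) ^ j\<close>. At \<open>j = N\<close> this is of order
    \<open>N * h\<^sup>2 = 1 / N\<close>.\<close>
  have err: "norm (\<gamma> (j * h) - (T ^^ j) (\<gamma> 0)) \<le> j * (D * h\<^sup>2) * (1 + h * C) ^ j" if "j \<le> N" for j
    using that
  proof (induction j)
    case (Suc j)
    define e where "e = (T ^^ j) (\<gamma> 0)"
    have jh: "real j * h + h \<le> 1" "0 \<le> real j * h"
      using Suc.prems N h by (auto simp: h_def field_simps)
    have "norm e \<le> exp C * norm (\<gamma> 0)"
      unfolding e_def using Tn[of j] pw[of j] Suc.prems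
      by (meson Suc_leD mult_right_mono norm_ge_zero order_trans)
    then have "norm (W (\<gamma> (j * h)) - W e) \<le> C * norm (\<gamma> (j * h) - e)"
      using small jh h by (intro lip bel) auto
    then have "h * norm (W (\<gamma> (j * h)) - W e) \<le> h * (C * norm (\<gamma> (j * h) - e))"
      using h by (intro mult_left_mono) auto
    moreover have "T (\<gamma> (j * h)) - T e = (\<gamma> (j * h) - e) + h *\<^sub>R (W (\<gamma> (j * h)) - W e)"
      by (simp add: T_def algebra_simps)
    ultimately have "norm (T (\<gamma> (j * h)) - T e) \<le> (1 + h * C) * norm (\<gamma> (j * h) - e)"
      using norm_triangle_ineq[of "\<gamma> (j * h) - e" "h *\<^sub>R (W (\<gamma> (j * h)) - W e)"] h
      by (simp only: norm_scaleR abs_of_pos distrib_right mult.assoc mult_1)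
    also have "\<dots> \<le> (1 + h * C) * (j * (D * h\<^sup>2) * (1 + h * C) ^ j)"
      using Suc h C by (intro mult_left_mono) (auto simp: e_def)
    finally have "norm (T (\<gamma> (j * h)) - T e) \<le> j * (D * h\<^sup>2) * (1 + h * C) ^ Suc j"
      by (simp add: algebra_simps)
    moreover have "norm (\<gamma> (j * h + h) - T (\<gamma> (j * h))) \<le> D * h\<^sup>2 * (1 + h * C) ^ Suc j"
    proof -
      have "1 \<le> (1 + h * C) ^ Suc j" using h C by (intro one_le_power) auto
      then have "D * h\<^sup>2 * 1 \<le> D * h\<^sup>2 * (1 + h * C) ^ Suc j" using D by (intro mult_left_mono) auto
      then show ?thesis using step[OF jh(2,1)] by simp
    qed
    ultimately have "norm (\<gamma> (j * h + h) - T e) \<le> D * h\<^sup>2 * (1 + h * C) ^ Suc j + j * (D * h\<^sup>2) * (1 + h * C) ^ Suc j"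
      using norm_triangle_ineq[of "\<gamma> (j * h + h) - T (\<gamma> (j * h))" "T (\<gamma> (j * h)) - T e"] by simp
    then show ?case by (simp add: e_def algebra_simps)
  qed simp
  have "norm (\<gamma> 1 - (T ^^ N) (\<gamma> 0)) \<le> N * (D * h\<^sup>2) * (1 + h * C) ^ N"
    using err[of N] N by (simp add: h_def)
  also have "\<dots> \<le> N * (D * h\<^sup>2) * exp C"
    using pw[of N] D by (intro mult_left_mono) auto
  also have "\<dots> = exp C * D / N"
    using N by (simp add: h_def power2_eq_square)
  finally show "norm (\<gamma> 1 - ((\<lambda>z. z + (1 / real N) *\<^sub>R W z) ^^ N) (\<gamma> 0)) \<le> exp C * (3 * C\<^sup>2 * R) / N"
    by (simp add: T_def D_def h_def)
qed

section \<open>Holomorphy and lower bounds of flows along holomorphic curves\<close>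

lemma holo_on_scaleC: "holo_on S f \<Longrightarrow> holo_on S (\<lambda>z. c *\<^sub>C f z)"
  by (rule holo_on_compose[OF holo_on_linear[OF bounded_linear_scaleC_right]])
    (auto simp: clinear_map_def scaleC_add_right scaleC_scaleC mult.commute)

lemma holo_on_scaleR: "holo_on S f \<Longrightarrow> holo_on S (\<lambda>z. r *\<^sub>R f z)"
  using holo_on_scaleC[of S f "of_real r"] by (simp add: scaleC_of_real)

lemma holo_on_funpow:
  fixes f :: "'a::complex_normed_vector \<Rightarrow> 'a"
  shows "holo_on UNIV f \<Longrightarrow> holo_on UNIV (f ^^ n)"
proof (induction n)
  case (Suc n)
  then show ?case using holo_on_compose[of UNIV f UNIV "f ^^ n"] by (simp add: o_def)
qed (simp add: holo_on_ident id_def)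

text \<open>Taylor polynomials are computed along complex lines, so holomorphy in one variable
  suffices. A general curve \<open>c\<close> is allowed because the next flow acts on the image of a
  line under the previous one. The lower bound is the reversed Gronwall estimate, with
  \<open>exp (- C)\<close> as \<open>\<delta>\<close>.\<close>

lemma flow_along_curve:
  fixes V :: "complex ^ 'n \<Rightarrow> complex ^ 'n" and c :: "complex \<Rightarrow> complex ^ 'n"
  assumes V: "holo_on UNIV V" "V 0 = 0" and r0: "r0 > 0"
    and c: "holo_on (ball 0 r0) c" "c 0 = 0"
    and dom: "\<And>s. s \<in> ball 0 r0 \<Longrightarrow> c s \<in> flow_domain V t"
  obtains r \<delta> where "0 < r" "r \<le> r0" "0 < \<delta>" "holo_on (ball 0 r) (\<lambda>s. flow V t (c s))"
    "flow V t 0 = 0" "\<And>s. s \<in> ball 0 r \<Longrightarrow> \<delta> * norm (c s) \<le> norm (flow V t (c s))"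
proof -
  define W where "W = (\<lambda>z. t *\<^sub>C V z)"
  have W: "holo_on UNIV W" "W 0 = 0" using V by (simp_all add: W_def holo_on_scaleC)
  obtain C where C: "C \<ge> 0"
    "\<And>p q. norm p \<le> 1 \<Longrightarrow> norm q \<le> 1 \<Longrightarrow> norm (W p - W q) \<le> C * norm (p - q)"
    using holo_lipschitz_on_ball[OF W(1), of 1] by auto
  have "isCont c 0"
    using holo_on_continuous[OF c(1)] r0 by (simp add: continuous_on_eq_continuous_at)
  then have "((\<lambda>s. exp C * norm (c s)) \<longlongrightarrow> exp C * norm (c 0)) (at 0)"
    by (intro tendsto_intros) (simp add: isCont_def)
  then have "eventually (\<lambda>s. exp C * norm (c s) < 1) (at 0)"
    using c(2) by (intro order_tendstoD) auto
  then obtain r1 where r1: "r1 > 0" "\<And>s. s \<noteq> 0 \<Longrightarrow> norm s < r1 \<Longrightarrow> exp C * norm (c s) < 1"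
    unfolding eventually_at by (auto simp: dist_norm)
  \<comment> \<open>On this disc all initial values satisfy the smallness condition of
    \<open>euler_estimates\<close> with \<open>R = 1\<close>, whence one rate of convergence for all
    \<open>s\<close>.\<close>
  define r where "r = min r0 r1"
  have r: "r > 0" "r \<le> r0" using r0 r1 by (auto simp: r_def)
  define T where "T = (\<lambda>N z. z + (1 / real N) *\<^sub>R W z)"
  have main: "norm (c s) \<le> exp C * norm (flow V t (c s)) \<and>
      (\<forall>N>0. norm (flow V t (c s) - (T N ^^ N) (c s)) \<le> exp C * (3 * C\<^sup>2 * 1) / N)"
    if s: "s \<in> ball 0 r" for s
  proof -
    have small: "exp C * norm (c s) < 1" using r1(2)[of s] s c(2) by (cases "s = 0") (auto simp: r_def)
    have "c s \<in> flow_domain V t" using dom s by (simp add: r_def)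
    then obtain \<gamma> where g: "integral_curve V (closed_segment 0 t) \<gamma>" "\<gamma> 0 = c s"
      by (auto simp: flow_domain_def)
    have fl: "flow V t (c s) = \<gamma> t" using flow_eq[OF V(1) g(1)] g(2) by simp
    note e = euler_estimates[where \<gamma>="\<lambda>u. \<gamma> (of_real u * t)" and W=W and R=1, OF C(2) W(2) C(1) zero_less_one]
    show ?thesis
      using e integral_curve_real[OF g(1)] small g(2) fl by (simp add: W_def T_def)
  qed
  have "holo_on (ball 0 r) (\<lambda>s. flow V t (c s))"
    unfolding holo_on_vec_iff holo_on_complex_iff
  proof
    fix i
    show "(\<lambda>s. flow V t (c s) $ i) holomorphic_on ball 0 r"
    proof (rule holomorphic_uniform_sequence)
      fix N
      have "holo_on UNIV (T N ^^ N)"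
        unfolding T_def by (intro holo_on_funpow holo_on_add holo_on_ident holo_on_scaleR W)
      then have "holo_on (ball 0 r) (\<lambda>s. (T N ^^ N) (c s))"
        by (rule holo_on_compose) (use r in \<open>auto intro: holo_on_subset[OF c(1)]\<close>)
      then show "(\<lambda>s. (T N ^^ N) (c s) $ i) holomorphic_on ball 0 r"
        using holo_on_vec_iff holo_on_complex_iff by metis
    next
      have ul: "uniform_limit (ball 0 r) (\<lambda>N s. (T N ^^ N) (c s) $ i) (\<lambda>s. flow V t (c s) $ i) sequentially"
      proof (rule uniform_limitI)
        fix e :: real assume e: "e > 0"
        have "(\<lambda>N. exp C * (3 * C\<^sup>2 * 1) / real N) \<longlonglongrightarrow> 0"
          by real_asymp
        then have "eventually (\<lambda>N. exp C * (3 * C\<^sup>2 * 1) / real N < e) sequentially"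
          using e by (rule order_tendstoD)
        then show "\<forall>\<^sub>F N in sequentially. \<forall>s\<in>ball 0 r. dist ((T N ^^ N) (c s) $ i) (flow V t (c s) $ i) < e"
          using eventually_gt_at_top[of 0]
        proof eventually_elim
          case (elim N)
          have "dist ((T N ^^ N) (c s) $ i) (flow V t (c s) $ i) \<le> norm (flow V t (c s) - (T N ^^ N) (c s))" for s
            using Finite_Cartesian_Product.norm_nth_le[of "flow V t (c s) - (T N ^^ N) (c s)" i]
            by (simp add: dist_norm norm_minus_commute)
          then show ?case using main elim by (meson order_le_less_trans)
        qed
      qed
      fix x :: complex assume "x \<in> ball 0 r"
      then obtain d where "d > 0" "cball x d \<subseteq> ball 0 r"
        using open_contains_cball open_ball by blast
      then show "\<exists>d>0. cball x d \<subseteq> ball 0 r \<and>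
          uniform_limit (cball x d) (\<lambda>N s. (T N ^^ N) (c s) $ i) (\<lambda>s. flow V t (c s) $ i) sequentially"
        using ul uniform_limit_on_subset by blast
    qed auto
  qed
  moreover have "flow V t 0 = 0"
  proof -
    have "integral_curve V (closed_segment 0 t) (\<lambda>_. 0)"
      using V by (simp add: integral_curve_def)
    from flow_eq[OF V(1) this] show ?thesis by simp
  qed
  moreover have "exp (- C) * norm (c s) \<le> norm (flow V t (c s))" if "s \<in> ball 0 r" for s
    using main[OF that] by (simp add: exp_minus field_simps)
  ultimately show thesis using that[of r "exp (- C)"] r by simp
qed

lemma flows_along_curve:
  fixes c :: "complex \<Rightarrow> complex ^ 'n"
  assumes "\<And>V t. (V, t) \<in> set ws \<Longrightarrow> holo_on UNIV V \<and> V 0 = 0" and "r0 > 0"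
    and "holo_on (ball 0 r0) c" "c 0 = 0"
    and "\<And>s. s \<in> ball 0 r0 \<Longrightarrow> flows_defined ws (c s)"
  shows "\<exists>r>0. \<exists>\<delta>>0. holo_on (ball 0 r) (\<lambda>s. flows ws (c s)) \<and>
    flows ws 0 = 0 \<and> (\<forall>s\<in>ball 0 r. \<delta> * norm (c s) \<le> norm (flows ws (c s)))"
  using assms
proof (induction ws arbitrary: c r0)
  case Nil
  then show ?case by (intro exI[of _ r0] exI[of _ 1] conjI) auto
next
  case (Cons w ws)
  obtain V t where w: "w = (V, t)" by force
  obtain r \<delta> where r: "0 < r" "r \<le> r0" "0 < \<delta>" "holo_on (ball 0 r) (\<lambda>s. flow V t (c s))"
    "flow V t 0 = 0" "\<And>s. s \<in> ball 0 r \<Longrightarrow> \<delta> * norm (c s) \<le> norm (flow V t (c s))"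
    by (rule flow_along_curve[of V r0 c t]) (use Cons.prems w in auto)
  obtain r' \<delta>' where r': "0 < r'" "0 < \<delta>'" "holo_on (ball 0 r') (\<lambda>s. flows ws (flow V t (c s)))"
    "flows ws 0 = 0" "\<And>s. s \<in> ball 0 r' \<Longrightarrow> \<delta>' * norm (flow V t (c s)) \<le> norm (flows ws (flow V t (c s)))"
    using Cons.IH[of r "\<lambda>s. flow V t (c s)"] Cons.prems r w by force
  show ?case
  proof (intro exI conjI ballI)
    show "min r r' > 0" "\<delta>' * \<delta> > 0" using r r' by auto
    show "holo_on (ball 0 (min r r')) (\<lambda>s. flows (w # ws) (c s))"
      using r'(3) by (auto simp: w intro: holo_on_subset)
    show "flows (w # ws) 0 = 0" using r r' w by simp
    fix s :: complex assume s: "s \<in> ball 0 (min r r')"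
    have "\<delta>' * \<delta> * norm (c s) \<le> \<delta>' * norm (flow V t (c s))"
      using r(6)[of s] s r' by (simp add: mult.assoc)
    also have "\<dots> \<le> norm (flows ws (flow V t (c s)))"
      using r'(5)[of s] s by simp
    finally show "\<delta>' * \<delta> * norm (c s) \<le> norm (flows (w # ws) (c s))" by (simp add: w)
  qed
qed

text \<open>If all first derivatives along the line vanished, the composed flow at
  \<open>s *\<^sub>C z\<close> would be of smaller order than \<open>s\<close>, against its lower
  bound \<open>\<delta> * norm (s *\<^sub>C z)\<close>. Since \<open>1 \<le> K\<close>, the linear
  term survives the truncation to \<open>P\<close>.\<close>

lemma flow_jet_derivative:
  fixes P :: "complex ^ 'n::{finite,linorder} \<Rightarrow> complex ^ 'n::{finite,linorder}"
  assumes "P \<in> flow_jets00 K (vanishing_fields k)" "1 \<le> K" "z \<noteq> 0"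
  shows "\<exists>i D. D \<noteq> 0 \<and> ((\<lambda>s. P (s *\<^sub>C z) $ i) has_field_derivative D) (at 0)"
proof -
  obtain ws where ws: "P = taylor_poly K 0 (flows ws)" "set ws \<subseteq> vanishing_fields k \<times> UNIV"
    "eventually (flows_defined ws) (nhds 0)"
    using assms(1) by (auto simp: flow_jets00_def flow_jets_def)
  obtain e where e: "e > 0" "\<And>p. norm p < e \<Longrightarrow> flows_defined ws p"
    using ws(3) unfolding eventually_nhds_metric by (auto simp: dist_norm)
  define f where "f = flows ws"
  have "\<exists>r>0. \<exists>\<delta>>0. holo_on (ball 0 r) (\<lambda>s. flows ws (s *\<^sub>C z)) \<and>
      flows ws 0 = 0 \<and> (\<forall>s\<in>ball 0 r. \<delta> * norm (s *\<^sub>C z) \<le> norm (flows ws (s *\<^sub>C z)))"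
  proof (rule flows_along_curve)
    show "e / norm z > 0" using e assms(3) by simp
    show "holo_on (ball 0 (e / norm z)) (\<lambda>s. s *\<^sub>C z)"
      using holo_on_line[of _ 0 z] by simp
    show "flows_defined ws (s *\<^sub>C z)" if "s \<in> ball 0 (e / norm z)" for s
      using that e assms(3) by (auto simp: norm_scaleC field_simps)
    show "holo_on UNIV V \<and> V 0 = 0" if "(V, t) \<in> set ws" for V t
      using that ws(2) by (auto simp: vanishing_fields_def coord_subspace_def)
  qed simp
  then obtain r \<delta> where r: "r > 0" "\<delta> > 0" "holo_on (ball 0 r) (\<lambda>s. f (s *\<^sub>C z))" "f 0 = 0"
    "\<And>s. s \<in> ball 0 r \<Longrightarrow> \<delta> * norm (s *\<^sub>C z) \<le> norm (f (s *\<^sub>C z))"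
    unfolding f_def by blast
  define g where "g = (\<lambda>i s. f (s *\<^sub>C z) $ i)"
  have g: "g i holomorphic_on ball 0 r" for i
    using r(3) unfolding g_def holo_on_vec_iff[of _ "\<lambda>s. f (s *\<^sub>C z)"] holo_on_complex_iff by blast
  \<comment> \<open>\<open>taylor_poly\<close> differentiates anew along the line through each point
    \<open>s *\<^sub>C z\<close>. Rescaling that line identifies the values of \<open>P\<close> with
    the ordinary Taylor polynomial in \<open>s\<close>; the radius \<open>r / (norm s + 1)\<close>
    also covers \<open>s = 0\<close>.\<close>
  have P: "P (s *\<^sub>C z) $ i = (\<Sum>j\<le>K. s ^ j * ((deriv ^^ j) (g i) 0 / fact j))" for s i
  proof -
    have "(deriv ^^ j) (\<lambda>w. g i (s * w)) 0 = s ^ j * (deriv ^^ j) (g i) (s * 0)" for j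
    proof (rule higher_deriv_compose_linear[OF g])
      fix w :: complex assume "w \<in> ball 0 (r / (norm s + 1))"
      then have "norm w * (norm s + 1) < r"
        by (simp add: pos_less_divide_eq add_nonneg_pos)
      moreover have "norm s * norm w \<le> norm w * (norm s + 1)"
        by (simp add: algebra_simps)
      ultimately show "s * w \<in> ball 0 r" by (simp add: norm_mult)
    qed (use r in \<open>auto simp: add_nonneg_pos\<close>)
    then show ?thesis
      by (simp add: ws(1) taylor_poly_def f_def[symmetric] g_def scaleC_scaleC mult.commute)
  qed
  have der: "((\<lambda>s. P (s *\<^sub>C z) $ i) has_field_derivative deriv (g i) 0) (at 0)" for i
  proof -
    define a where "a = (\<lambda>j. (deriv ^^ j) (g i) 0 / fact j)"
    have "((\<lambda>s. \<Sum>j\<le>K. s ^ j * a j) has_field_derivative (\<Sum>j\<le>K. (of_nat j * 0 ^ (j - 1)) * a j)) (at 0)"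
      by (auto intro!: derivative_eq_intros sum.cong)
    also have "(\<Sum>j\<le>K. (of_nat j * 0 ^ (j - 1)) * a j) = (\<Sum>j\<le>K. if j = 1 then a 1 else 0)"
      by (intro sum.cong) (auto simp: power_0_left)
    also have "\<dots> = deriv (g i) 0"
      using assms(2) by (simp add: a_def)
    finally show ?thesis by (simp add: P a_def)
  qed
  have "\<exists>i. deriv (g i) 0 \<noteq> 0"
  proof (rule ccontr)
    assume "\<not> ?thesis"
    then have "(g i has_field_derivative 0) (at 0)" for i
      using holomorphic_derivI[OF g[of i] open_ball, of 0] r(1) by simp
    then have "((\<lambda>s. f (s *\<^sub>C z)) has_derivative (\<lambda>_. 0)) (at 0)"
      by (auto simp: has_derivative_vec_iff g_def has_field_derivative_def mult_zero_left[abs_def])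
    then have "((\<lambda>s. norm (f (s *\<^sub>C z)) / norm s) \<longlongrightarrow> 0) (at 0)"
      using r(4) by (simp add: has_derivative_at)
    then have "eventually (\<lambda>s. norm (f (s *\<^sub>C z)) / norm s < \<delta> * norm z) (at 0)"
      using r(2) assms(3) by (intro order_tendstoD) auto
    moreover have "eventually (\<lambda>s. s \<in> ball 0 r - {0}) (at 0)"
      using r(1) by (intro eventually_at_in_open) auto
    ultimately have "eventually (\<lambda>s::complex. False) (at 0)"
    proof eventually_elim
      case (elim s)
      then show ?case using r(5)[of s] by (auto simp: norm_scaleC field_simps)
    qed
    then show False by simp
  qed
  then show ?thesis using der by blast
qed

section \<open>Holomorphic functions on a manifold\<close>

lemma holo_map_const: "holo_map A (\<lambda>_. c)"
  by (simp add: holo_map_def o_def holo_on_const split_beta)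

lemma holo_map_add: "holo_map A f \<Longrightarrow> holo_map A g \<Longrightarrow> holo_map A (\<lambda>x. f x + g x)"
  by (force simp: holo_map_def o_def intro: holo_on_add)

lemma holo_map_mult:
  fixes f g :: "_ \<Rightarrow> complex"
  shows "holo_map A f \<Longrightarrow> holo_map A g \<Longrightarrow> holo_map A (\<lambda>x. f x * g x)"
  by (force simp: holo_map_def o_def intro: holo_on_mult)

lemma holo_map_entire:
  assumes "e holomorphic_on UNIV" "holo_map A f"
  shows "holo_map A (\<lambda>x. e (f x))"
proof -
  have "holo_on UNIV e" using assms(1) holo_on_complex_iff by blast
  then show ?thesis
    using assms(2) by (force simp: holo_map_def o_def intro: holo_on_compose)
qed

lemma holo_map_sum:
  "(\<And>i. i \<in> S \<Longrightarrow> holo_map A (f i)) \<Longrightarrow> holo_map A (\<lambda>x. \<Sum>i\<in>S. f i x)"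
  by (induction S rule: infinite_finite_induct) (auto intro: holo_map_const holo_map_add)

lemma holo_map_prod:
  fixes f :: "_ \<Rightarrow> _ \<Rightarrow> complex"
  shows "(\<And>i. i \<in> S \<Longrightarrow> holo_map A (f i)) \<Longrightarrow> holo_map A (\<lambda>x. \<Prod>i\<in>S. f i x)"
  by (induction S rule: infinite_finite_induct) (auto intro: holo_map_const holo_map_mult)

lemma holo_map_vec_iff: "holo_map A f \<longleftrightarrow> (\<forall>i. holo_map A (\<lambda>x. f x $ i))"
proof -
  have "holo_on S (f \<circ> g) \<longleftrightarrow> (\<forall>i. holo_on S ((\<lambda>x. f x $ i) \<circ> g))" for S g
    unfolding o_def by (rule holo_on_vec_iff)
  then show ?thesis unfolding holo_map_def by fast
qed

lemma holo_map_inverse: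
  assumes "holo_map A f" "\<And>x. x \<in> (\<Union>(U, \<phi>)\<in>A. U) \<Longrightarrow> f x \<noteq> (0::complex)"
  shows "holo_map A (\<lambda>x. inverse (f x))"
  unfolding holo_map_def
proof (clarify)
  fix U \<phi> assume U: "(U, \<phi>) \<in> A"
  have "holo_on (- {0}) (inverse :: complex \<Rightarrow> complex)"
    unfolding holo_on_complex_iff by (intro holomorphic_intros) auto
  moreover have "holo_on (\<phi> ` U) (f \<circ> inv_into U \<phi>)"
    using U assms(1) by (auto simp: holo_map_def)
  moreover have "(f \<circ> inv_into U \<phi>) ` (\<phi> ` U) \<subseteq> - {0}"
  proof clarsimp
    fix u assume "u \<in> U" "f (inv_into U \<phi> (\<phi> u)) = 0"
    then show False using assms(2)[of "inv_into U \<phi> (\<phi> u)"] U inv_into_into[of "\<phi> u" \<phi> U] by force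
  qed
  ultimately show "holo_on (\<phi> ` U) ((\<lambda>x. inverse (f x)) \<circ> inv_into U \<phi>)"
    using holo_on_compose[of "- {0}" inverse "\<phi> ` U" "f \<circ> inv_into U \<phi>"] by (simp add: o_def)
qed

lemma holo_on_fst: "holo_on S fst"
  by (intro holo_on_linear bounded_linear_fst) (simp add: clinear_map_def scaleC_prod_def)

lemma holo_on_snd: "holo_on S snd"
  by (intro holo_on_linear bounded_linear_snd) (simp add: clinear_map_def scaleC_prod_def)

lemma
  assumes M: "complex_manifold X E (A :: ('a, 'e::complex_normed_vector) atlas)"
  shows holo_map_times_fst: "holo_map A f \<Longrightarrow>
      holo_map (atlas_times_UNIV A :: ('a \<times> 'b::complex_normed_vector, _) atlas) (\<lambda>(x, z). f x)"
    and holo_map_times_snd: "holo_on UNIV g \<Longrightarrow>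
      holo_map (atlas_times_UNIV A :: ('a \<times> 'b, _) atlas) (\<lambda>(x, z). g z)"
proof -
  have inv: "inv_into (U \<times> (UNIV :: 'b set)) (map_prod \<phi> id) w = (inv_into U \<phi> (fst w), snd w)"
    if U: "(U, \<phi>) \<in> A" and w: "w \<in> \<phi> ` U \<times> UNIV" for U \<phi> w
  proof -
    have "inj_on \<phi> U"
    proof -
      have "homeomorphic_map (subtopology X U) (top_of_set (\<phi> ` U)) \<phi>" "openin X U"
        using M U unfolding complex_manifold_def by fastforce+
      then show ?thesis
        by (metis homeomorphic_imp_injective_map topspace_subtopology_subset openin_subset)
    qed
    moreover obtain u z where "w = (\<phi> u, z)" "u \<in> U" using w by auto
    ultimately show ?thesis
      using inv_into_f_f[of "map_prod \<phi> id" "U \<times> UNIV" "(u, z)"]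
      by (simp add: map_prod_inj_on inv_into_f_f)
  qed
  have img: "map_prod \<phi> id ` (U \<times> (UNIV :: 'b set)) = \<phi> ` U \<times> UNIV" for U and \<phi> :: "'a \<Rightarrow> 'e"
    by force
  show "holo_map (atlas_times_UNIV A :: ('a \<times> 'b, _) atlas) (\<lambda>(x, z). f x)" if "holo_map A f"
    unfolding holo_map_def atlas_times_UNIV_def
  proof clarify
    fix U \<phi> assume U: "(U, \<phi>) \<in> A"
    have "holo_on (\<phi> ` U \<times> (UNIV :: 'b set)) (\<lambda>w. (f \<circ> inv_into U \<phi>) (fst w))"
      by (rule holo_on_compose[where T="\<phi> ` U", OF _ holo_on_fst]) (use U that in \<open>fastforce simp: holo_map_def o_def\<close>)+
    then show "holo_on (map_prod \<phi> id ` (U \<times> (UNIV :: 'b set)))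
        ((\<lambda>(x, z). f x) \<circ> inv_into (U \<times> UNIV) (map_prod \<phi> id))"
      unfolding img by (rule holo_on_cong) (simp add: inv[OF U])
  qed
  show "holo_map (atlas_times_UNIV A :: ('a \<times> 'b, _) atlas) (\<lambda>(x, z). g z)" if "holo_on UNIV g"
    unfolding holo_map_def atlas_times_UNIV_def
  proof clarify
    fix U \<phi> assume U: "(U, \<phi>) \<in> A"
    have "holo_on (\<phi> ` U \<times> (UNIV :: 'b set)) (\<lambda>w. g (snd w))"
      by (rule holo_on_compose[OF that holo_on_snd]) simp
    then show "holo_on (map_prod \<phi> id ` (U \<times> (UNIV :: 'b set)))
        ((\<lambda>(x, z). g z) \<circ> inv_into (U \<times> UNIV) (map_prod \<phi> id))"
      unfolding img by (rule holo_on_cong) (simp add: inv[OF U])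
  qed
qed

section \<open>Families of jets\<close>

lemma monomial_add: "monomial (\<lambda>i. \<alpha> i + \<beta> i) z = monomial \<alpha> z * monomial \<beta> z"
  by (simp add: monomial_def power_add prod.distrib)

lemma monomial_zero: "monomial (\<lambda>_. 0) z = 1"
  by (simp add: monomial_def)

lemma monomial_single: "monomial (\<lambda>l. if l = i then 1 else 0) z = z $ i"
proof -
  have "monomial (\<lambda>l. if l = i then 1 else 0) z = (\<Prod>l\<in>UNIV. if l = i then z $ i else 1)"
    unfolding monomial_def by (intro prod.cong) auto
  then show ?thesis by simp
qed

lemma norm_monomial_le: "norm (monomial \<alpha> z) \<le> norm z ^ sum \<alpha> UNIV"
proof -
  have "norm (monomial \<alpha> z) \<le> (\<Prod>i\<in>UNIV. norm z ^ \<alpha> i)"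
    unfolding monomial_def prod_norm[symmetric] norm_power
    by (intro prod_mono conjI power_mono Finite_Cartesian_Product.norm_nth_le) auto
  then show ?thesis by (simp add: power_sum)
qed

definition proj_coord :: "nat \<Rightarrow> complex ^ 'n::{finite,linorder} \<Rightarrow> complex ^ 'n::{finite,linorder}" where
  "proj_coord k z = (\<chi> i. if k \<le> card {..<i} then 0 else z $ i)"

lemma norm_proj_coord_le: "norm (proj_coord k z) \<le> norm z"
  unfolding norm_vec_def by (intro L2_set_mono) (auto simp: proj_coord_def)

lemma proj_coord_in: "proj_coord k z \<in> coord_subspace k"
  by (simp add: proj_coord_def coord_subspace_def)

lemma proj_coord_id: "z \<in> coord_subspace k \<Longrightarrow> proj_coord k z = z"
  by (auto simp: proj_coord_def coord_subspace_def vec_eq_iff)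

text \<open>These are the monomials in the ideal of functions vanishing on the subspace.\<close>

definition transversal :: "nat \<Rightarrow> ('n::{finite,linorder} \<Rightarrow> nat) \<Rightarrow> bool" where
  "transversal k \<alpha> \<longleftrightarrow> (\<exists>j. k \<le> card {..<j} \<and> \<alpha> j > 0)"

lemma monomial_proj_coord:
  "monomial \<alpha> (proj_coord k z) = (if transversal k \<alpha> then 0 else monomial \<alpha> z)"
proof (cases "transversal k \<alpha>")
  case True
  then obtain j where "k \<le> card {..<j}" "\<alpha> j > 0" by (auto simp: transversal_def)
  then have "proj_coord k z $ j ^ \<alpha> j = 0" by (simp add: proj_coord_def)
  then show ?thesis using True by (auto simp: monomial_def intro!: prod_zero)
next
  case False
  then show ?thesis
    unfolding monomial_def transversal_def proj_coord_def by (auto intro!: prod.cong)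
qed

text \<open>With \<open>nhds\<close> the bound includes the origin, so for positive \<open>N\<close>
  it forces \<open>h 0 = 0\<close>; \<open>C \<ge> 0\<close> lets bounds be multiplied.\<close>

definition bigo_at_0 :: "nat \<Rightarrow> (complex ^ 'n \<Rightarrow> complex) \<Rightarrow> bool" where
  "bigo_at_0 N h \<longleftrightarrow> (\<exists>C\<ge>0. eventually (\<lambda>z. norm (h z) \<le> C * norm z ^ N) (nhds 0))"

lemma bigo_at_0I:
  assumes "eventually (\<lambda>z. norm (h z) \<le> C * norm z ^ N) (nhds 0)"
  shows "bigo_at_0 N h"
  unfolding bigo_at_0_def
  by (intro exI[of _ "\<bar>C\<bar>"] conjI eventually_mono[OF assms])
    (auto elim!: order_trans intro: mult_right_mono)

lemma bigo_at_0_mono: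
  assumes "bigo_at_0 N h" "M \<le> N"
  shows "bigo_at_0 M h"
proof -
  obtain C where C: "C \<ge> 0" "eventually (\<lambda>z. norm (h z) \<le> C * norm z ^ N) (nhds 0)"
    using assms by (auto simp: bigo_at_0_def)
  have "eventually (\<lambda>z :: complex ^ 'a. norm z < 1) (nhds 0)"
    unfolding eventually_nhds_metric by (intro exI[of _ 1]) (auto simp: dist_norm)
  with C(2) show ?thesis
  proof (intro bigo_at_0I[of _ C], eventually_elim)
    case (elim z)
    have "norm z ^ N \<le> norm z ^ M" using elim assms(2) by (intro power_decreasing) auto
    then show ?case using elim C(1) by (meson mult_left_mono order_trans)
  qed
qed

lemma bigo_at_0_add:
  assumes "bigo_at_0 N f" "bigo_at_0 N g"
  shows "bigo_at_0 N (\<lambda>z. f z + g z)"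
proof -
  obtain C where C: "eventually (\<lambda>z. norm (f z) \<le> C * norm z ^ N) (nhds 0)"
    using assms by (auto simp: bigo_at_0_def)
  obtain D where D: "eventually (\<lambda>z. norm (g z) \<le> D * norm z ^ N) (nhds 0)"
    using assms by (auto simp: bigo_at_0_def)
  show ?thesis
    by (rule bigo_at_0I[of _ "C + D"], use C D in eventually_elim)
      (auto simp: distrib_right intro: order_trans[OF norm_triangle_ineq add_mono])
qed

lemma bigo_at_0_mult:
  assumes "bigo_at_0 N f" "bigo_at_0 M g"
  shows "bigo_at_0 (N + M) (\<lambda>z. f z * g z)"
proof -
  obtain C where C: "C \<ge> 0" "eventually (\<lambda>z. norm (f z) \<le> C * norm z ^ N) (nhds 0)"
    using assms by (auto simp: bigo_at_0_def)
  obtain D where D: "D \<ge> 0" "eventually (\<lambda>z. norm (g z) \<le> D * norm z ^ M) (nhds 0)"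
    using assms by (auto simp: bigo_at_0_def)
  show ?thesis
  proof (rule bigo_at_0I[of _ "C * D"], use C(2) D(2) in eventually_elim)
    case (elim z)
    have "norm (f z) * norm (g z) \<le> (C * norm z ^ N) * (D * norm z ^ M)"
      using elim C D by (intro mult_mono) auto
    then show ?case by (simp add: norm_mult power_add algebra_simps)
  qed
qed

lemma bigo_at_0_proj:
  assumes "bigo_at_0 N f"
  shows "bigo_at_0 N (\<lambda>z. f (proj_coord k z))"
proof -
  obtain C d where C: "C \<ge> 0" "d > 0" "\<And>z. norm z < d \<Longrightarrow> norm (f z) \<le> C * norm z ^ N"
    using assms unfolding bigo_at_0_def eventually_nhds_metric by (auto simp: dist_norm)
  have "norm (f (proj_coord k z)) \<le> C * norm z ^ N" if "norm z < d" for z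
  proof -
    have "norm (f (proj_coord k z)) \<le> C * norm (proj_coord k z) ^ N"
      using that norm_proj_coord_le[of k z] by (intro C) simp
    also have "\<dots> \<le> C * norm z ^ N"
      using C by (intro mult_left_mono power_mono norm_proj_coord_le) auto
    finally show ?thesis .
  qed
  then show ?thesis
    using C(2) by (intro bigo_at_0I[of _ C]) (auto simp: eventually_nhds_metric dist_norm)
qed

lemma bigo_at_0_monomial: "d \<le> sum \<alpha> UNIV \<Longrightarrow> bigo_at_0 d (\<lambda>z. c * monomial \<alpha> z)"
  by (rule bigo_at_0_mono, rule bigo_at_0I[of _ "norm c"])
    (auto simp: norm_mult intro!: mult_left_mono norm_monomial_le always_eventually)

section \<open>Calculus of truncated jets with holomorphic coefficients\<close>

locale holo_families =
  fixes X :: "'a topology" and E :: "'e::complex_normed_vector set" and A :: "('a, 'e) atlas"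
    and k K :: nat
  assumes manifold: "complex_manifold X E A" and K: "1 \<le> K"
begin

text \<open>\<open>jet d f\<close>: for every \<open>x\<close>, \<open>f x\<close> is a polynomial with terms of degree at least \<open>d\<close> and
  coefficients holomorphic in \<open>x\<close>, up to \<open>O(|z|\<^sup>K\<^sup>+\<^sup>1)\<close>. Only \<open>x\<close> in the manifold matters.\<close>
inductive jet :: "nat \<Rightarrow> ('a \<Rightarrow> complex ^ 'n \<Rightarrow> complex) \<Rightarrow> bool" where
  monomial: "holo_map A a \<Longrightarrow> d \<le> sum \<alpha> UNIV \<Longrightarrow> jet d (\<lambda>x z. a x * monomial \<alpha> z)"
| add: "jet d f \<Longrightarrow> jet d g \<Longrightarrow> jet d (\<lambda>x z. f x z + g x z)"
| remainder: "(\<And>x. x \<in> topspace X \<Longrightarrow> bigo_at_0 (K + 1) (f x)) \<Longrightarrow> jet d f"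

lemma jet_zero: "(\<And>x z. x \<in> topspace X \<Longrightarrow> f x z = 0) \<Longrightarrow> jet d f"
  by (intro remainder bigo_at_0I[of _ 0]) auto

text \<open>The difference vanishes over the manifold and so is a remainder. In this way hypotheses
  that hold only for \<open>x \<in> topspace X\<close> enter.\<close>

lemma jet_cong:
  assumes "jet d f" "\<And>x z. x \<in> topspace X \<Longrightarrow> f x z = g x z"
  shows "jet d g"
  using add[OF assms(1) jet_zero[of "\<lambda>x z. g x z - f x z"]] assms(2) by simp

lemma jet_mono: "jet d f \<Longrightarrow> e \<le> d \<Longrightarrow> jet e f"
  by (induction rule: jet.induct) (auto intro: jet.intros)

lemma jet_bigo: "jet d f \<Longrightarrow> d \<le> K + 1 \<Longrightarrow> x \<in> topspace X \<Longrightarrow> bigo_at_0 d (f x)"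
  by (induction rule: jet.induct)
    (auto intro: bigo_at_0_monomial bigo_at_0_add bigo_at_0_mono)

lemma jet_mult:
  assumes f: "jet d f" and g: "jet e g"
  shows "jet (d + e) (\<lambda>x z. f x z * g x z)"
  using f
proof (induction rule: jet.induct)
  case (add d f h)
  then show ?case using jet.add by (fastforce simp: distrib_right)
next
  case (remainder f d)
  show ?case
  proof (rule jet.remainder)
    fix x assume x: "x \<in> topspace X"
    have "bigo_at_0 (K + 1 + 0) (\<lambda>z. f x z * g x z)"
      by (intro bigo_at_0_mult remainder x jet_bigo[OF jet_mono[OF g]]) auto
    then show "bigo_at_0 (K + 1) (\<lambda>z. f x z * g x z)" by simp
  qed
next
  case (monomial a d \<alpha>)
  note mon = monomial
  from g show ?case
  proof (induction rule: jet.induct)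
    case (add e g h)
    then show ?case using jet.add by (fastforce simp: distrib_left)
  next
    case (remainder g e)
    show ?case
    proof (rule jet.remainder)
      fix x assume x: "x \<in> topspace X"
      have "bigo_at_0 (0 + (K + 1)) (\<lambda>z. a x * monomial \<alpha> z * g x z)"
        by (intro bigo_at_0_mult remainder x bigo_at_0_monomial) auto
      then show "bigo_at_0 (K + 1) (\<lambda>z. a x * monomial \<alpha> z * g x z)" by simp
    qed
  next
    case (monomial b e \<beta>)
    have "jet (d + e) (\<lambda>x z. (a x * b x) * monomial (\<lambda>i. \<alpha> i + \<beta> i) z)"
      using mon monomial by (intro jet.monomial holo_map_mult) (auto simp: sum.distrib intro: add_mono)
    then show ?case by (simp add: monomial_add algebra_simps)
  qed
qed

lemma jet_coeff: "holo_map A a \<Longrightarrow> jet 0 (\<lambda>x z. a x)"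
  using jet.monomial[of a 0 "\<lambda>_. 0"] by (simp add: monomial_zero)

lemma jet_coord: "jet 1 (\<lambda>x z. z $ i)"
  using jet.monomial[OF holo_map_const[of A 1], of 1 "\<lambda>l. if l = i then 1 else 0"]
  by (simp only: monomial_single mult_1) simp

lemma jet_scale: "holo_map A a \<Longrightarrow> jet d f \<Longrightarrow> jet d (\<lambda>x z. a x * f x z)"
  using jet_mult[OF jet_coeff] by fastforce

lemma jet_diff:
  assumes "jet d f" "jet d g"
  shows "jet d (\<lambda>x z. f x z - g x z)"
  using jet.add[OF assms(1) jet_scale[OF holo_map_const[of A "-1"] assms(2)]] by simp

lemma jet_sum: "(\<And>i. i \<in> S \<Longrightarrow> jet d (f i)) \<Longrightarrow> jet d (\<lambda>x z. \<Sum>i\<in>S. f i x z)"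
  by (induction S rule: infinite_finite_induct) (auto intro: jet.add jet_zero)

lemma jet_power: "jet d f \<Longrightarrow> jet (d * r) (\<lambda>x z. f x z ^ r)"
proof (induction r)
  case 0
  show ?case using jet_coeff[OF holo_map_const[of A 1]] by simp
next
  case (Suc r)
  then show ?case using jet_mult[of d f "d * r"] by simp
qed

text \<open>The Taylor terms of \<open>e\<close> with \<open>r \<ge> 2\<close> have order
  \<open>m * r \<ge> 2 * m\<close>. What is left after degree \<open>K\<close> is bounded by the
  power \<open>K + 1\<close> of \<open>norm (g x z)\<close>, hence a remainder because
  \<open>g\<close> has order at least 1.\<close>

lemma jet_entire:
  assumes e: "e holomorphic_on UNIV" and g: "jet m g" and m: "1 \<le> m"
  shows "jet (2 * m) (\<lambda>x z. e (g x z) - e 0 - deriv e 0 * g x z)"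
proof -
  define T where "T = (\<lambda>s. \<Sum>r\<le>K. (deriv ^^ r) e 0 * s ^ r / fact r)"
  have "continuous_on (cball 0 1) ((deriv ^^ Suc K) e)"
    using e holomorphic_higher_deriv[OF e open_UNIV]
    by (meson holomorphic_on_imp_continuous_on continuous_on_subset subset_UNIV)
  then have "bounded ((deriv ^^ Suc K) e ` cball 0 1)"
    by (intro compact_imp_bounded compact_continuous_image) auto
  then obtain B where B: "\<And>s. norm s \<le> 1 \<Longrightarrow> norm ((deriv ^^ Suc K) e s) \<le> B"
    unfolding bounded_iff by (meson imageI mem_cball_0)
  have taylor: "norm (e s - T s) \<le> B * norm s ^ Suc K / fact K" if s: "norm s \<le> 1" for s
  proof -
    have "norm ((deriv ^^ 0) e s - (\<Sum>r\<le>K. (deriv ^^ r) e 0 * (s - 0) ^ r / fact r))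
        \<le> B * norm (s - 0) ^ Suc K / fact K"
    proof (rule complex_Taylor[where S="cball 0 1"])
      show "((deriv ^^ i) e has_field_derivative (deriv ^^ Suc i) e x) (at x within cball 0 1)" for i x
        using holomorphic_derivI[OF holomorphic_higher_deriv[OF e open_UNIV, of i] open_UNIV, of x]
        by (auto intro: has_field_derivative_at_within)
    qed (use s B in auto)
    then show ?thesis by (simp add: T_def)
  qed
  have "jet (2 * m) (\<lambda>x z. e (g x z) - T (g x z))"
  proof (rule remainder)
    fix x assume x: "x \<in> topspace X"
    obtain C where C: "C \<ge> 0" "eventually (\<lambda>z. norm (g x z) \<le> C * norm z ^ 1) (nhds 0)"
      using jet_bigo[OF jet_mono[OF g m] _ x] by (auto simp: bigo_at_0_def)
    have "C * norm z < 1" if "norm z < 1 / (C + 1)" for z :: "complex ^ 'b"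
      using that C(1) norm_ge_zero[of z] by (simp add: field_simps del: norm_ge_zero)
    then have "eventually (\<lambda>z :: complex ^ 'b. C * norm z < 1) (nhds 0)"
      unfolding eventually_nhds_metric using C(1)
      by (intro exI[of _ "1 / (C + 1)"]) (auto simp: dist_norm)
    with C(2) show "bigo_at_0 (K + 1) (\<lambda>z. e (g x z) - T (g x z))"
    proof (intro bigo_at_0I[of _ "B * C ^ Suc K / fact K"], eventually_elim)
      case (elim z)
      have "B \<ge> 0" using B[of 0] norm_ge_zero[of "(deriv ^^ Suc K) e 0"] by (simp del: norm_ge_zero)
      have "norm (g x z) ^ Suc K \<le> (C * norm z) ^ Suc K"
        using elim by (intro power_mono) auto
      then have "B * norm (g x z) ^ Suc K / fact K \<le> B * (C * norm z) ^ Suc K / fact K"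
        using \<open>B \<ge> 0\<close> by (intro divide_right_mono mult_left_mono) auto
      moreover have "norm (g x z) \<le> 1" using elim by simp
      ultimately show ?case
        using taylor[of "g x z"] by (simp add: power_mult_distrib algebra_simps)
    qed
  qed
  moreover have "jet (2 * m) (\<lambda>x z. \<Sum>r\<in>{2..K}. ((deriv ^^ r) e 0 / fact r) * g x z ^ r)"
    by (intro jet_sum jet_scale holo_map_const jet_mono[OF jet_power[OF g]]) (use m in auto)
  ultimately have "jet (2 * m) (\<lambda>x z. (e (g x z) - T (g x z)) +
      (\<Sum>r\<in>{2..K}. ((deriv ^^ r) e 0 / fact r) * g x z ^ r))"
    by (rule add)
  moreover have "T s = e 0 + deriv e 0 * s + (\<Sum>r\<in>{2..K}. ((deriv ^^ r) e 0 / fact r) * s ^ r)" for s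
  proof -
    have "{..K} = insert 0 (insert 1 {2..K})" using K by auto
    then show ?thesis by (simp add: T_def)
  qed
  ultimately show ?thesis by (simp add: algebra_simps)
qed

text \<open>Subtracting the composite with \<open>proj_coord\<close> cancels exactly the monomials
  that survive on the subspace. Those left in degree \<open>d\<close> are kept as a list, so that
  sums become concatenations; a multi-index may be repeated.\<close>

lemma jet_transversal_terms:
  fixes f :: "'a \<Rightarrow> complex ^ 'n::{finite,linorder} \<Rightarrow> complex"
  assumes "jet d f"
  shows "\<exists>ts. (\<forall>(a, \<alpha>)\<in>set ts. holo_map A a \<and> sum \<alpha> UNIV = d \<and> transversal k \<alpha>) \<and>
    jet (d + 1) (\<lambda>x z. f x z - f x (proj_coord k z) - (\<Sum>(a, \<alpha>)\<leftarrow>ts. a x * monomial \<alpha> z))"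
  using assms
proof (induction rule: jet.induct)
  case (monomial a d \<alpha>)
  show ?case
  proof (cases "transversal k \<alpha>")
    case tr: True
    show ?thesis
    proof (cases "sum \<alpha> UNIV = d")
      case True
      then show ?thesis using tr monomial
        by (intro exI[of _ "[(a, \<alpha>)]"]) (auto simp: monomial_proj_coord intro: jet_zero)
    next
      case False
      then show ?thesis using tr monomial
        by (intro exI[of _ "[]"]) (auto simp: monomial_proj_coord intro!: jet.monomial)
    qed
  next
    case False
    then show ?thesis
      by (intro exI[of _ "[]"]) (auto simp: monomial_proj_coord intro: jet_zero)
  qed
next
  case (add d f g)
  then obtain ts us where
    "\<forall>(a, \<alpha>)\<in>set ts. holo_map A a \<and> sum \<alpha> UNIV = d \<and> transversal k \<alpha>"
    "jet (d + 1) (\<lambda>x z. f x z - f x (proj_coord k z) - (\<Sum>(a, \<alpha>)\<leftarrow>ts. a x * monomial \<alpha> z))"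
    "\<forall>(a, \<alpha>)\<in>set us. holo_map A a \<and> sum \<alpha> UNIV = d \<and> transversal k \<alpha>"
    "jet (d + 1) (\<lambda>x z. g x z - g x (proj_coord k z) - (\<Sum>(a, \<alpha>)\<leftarrow>us. a x * monomial \<alpha> z))"
    by blast
  then show ?case
    by (intro exI[of _ "ts @ us"] conjI)
      (auto simp: algebra_simps dest: jet.add elim!: back_subst[of "jet (d + 1)"])
next
  case (remainder f d)
  have "jet (d + 1) (\<lambda>x z. f x z)" "jet (d + 1) (\<lambda>x z. f x (proj_coord k z))"
    using remainder by (auto intro!: jet.remainder bigo_at_0_proj)
  then show ?case by (intro exI[of _ "[]"]) (auto intro: jet_diff)
qed

end

section \<open>Complete fields and their time-one flows\<close>

lemma Aut_fields_comp:
  "f \<in> Aut_fields \<gg> \<Longrightarrow> g \<in> Aut_fields \<gg> \<Longrightarrow> f \<circ> g \<in> Aut_fields \<gg>"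
  unfolding Aut_fields_def using generate.eng[of f Aut_Cn _ g] by (simp add: Aut_Cn_def)

lemma Aut_fields_id: "id \<in> Aut_fields \<gg>"
  unfolding Aut_fields_def using generate.one[of Aut_Cn] by (simp add: Aut_Cn_def)

lemma Aut_fields_flow: "V \<in> \<gg> \<Longrightarrow> complete_field V \<Longrightarrow> flow V 1 \<in> Aut_fields \<gg>"
  unfolding Aut_fields_def by (intro generate.incl) auto

text \<open>\<open>\<epsilon> s\<close> is the matrix \<open>exp (s b)\<close>. As \<open>h\<close> is a first integral of \<open>z \<mapsto> b z\<close>, the flow of
  the field \<open>h(z) b z\<close> is \<open>z \<mapsto> exp (t h(z) b) z\<close>.\<close>

lemma scaled_linear_flow:
  fixes \<epsilon> :: "'n::{finite,linorder} \<Rightarrow> 'n::{finite,linorder} \<Rightarrow> complex \<Rightarrow> complex"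
    and b :: "'n::{finite,linorder} \<Rightarrow> 'n::{finite,linorder} \<Rightarrow> complex"
    and h :: "complex ^ 'n::{finite,linorder} \<Rightarrow> complex"
  defines "M \<equiv> \<lambda>s z. \<chi> i. \<Sum>l\<in>UNIV. \<epsilon> i l s * z $ l"
    and "B \<equiv> \<lambda>z. \<chi> i. \<Sum>l\<in>UNIV. b i l * z $ l"
  assumes \<epsilon>0: "\<And>i l. \<epsilon> i l 0 = (if i = l then 1 else 0)"
    and \<epsilon>d: "\<And>i l s. (\<epsilon> i l has_field_derivative (\<Sum>q\<in>UNIV. b i q * \<epsilon> q l s)) (at s)"
    and h: "holo_on UNIV h" and inv: "\<And>s z. h (M s z) = h z"
    and van: "\<And>z. z \<in> coord_subspace k \<Longrightarrow> h z *\<^sub>C B z = 0"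
  shows "(\<lambda>z. M (h z) z) \<in> Aut_fields (vanishing_fields k)"
    and "z \<in> coord_subspace k \<Longrightarrow> M (h z) z = z"
proof -
  define V where "V = (\<lambda>z. h z *\<^sub>C B z)"
  have V: "holo_on UNIV V"
    unfolding holo_on_vec_iff
  proof
    fix i
    have "holo_on UNIV (\<lambda>z. B z $ i)"
      unfolding B_def vec_lambda_beta
    proof -
      have "holo_on UNIV (\<lambda>z :: (complex, 'n) vec. \<Sum>l\<in>S. b i l * z $ l)" for S
        by (induction S rule: infinite_finite_induct)
          (auto intro!: holo_on_const holo_on_add holo_on_mult holo_on_nth)
      then show "holo_on UNIV (\<lambda>z :: (complex, 'n) vec. \<Sum>l\<in>UNIV. b i l * z $ l)" .
    qed
    then show "holo_on UNIV (\<lambda>z. V z $ i)"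
      using holo_on_mult[OF h] by (simp add: V_def)
  qed
  have M0: "M 0 z = z" for z
    by (simp add: M_def \<epsilon>0 vec_eq_iff if_distrib[of "\<lambda>c. c * _"] cong: if_cong)
  have dM: "((\<lambda>s. M s z $ i) has_field_derivative B (M s z) $ i) (at s)" for s z i
  proof -
    have "((\<lambda>s. \<Sum>l\<in>UNIV. \<epsilon> i l s * z $ l) has_field_derivative
        (\<Sum>l\<in>UNIV. (\<Sum>q\<in>UNIV. b i q * \<epsilon> q l s) * z $ l)) (at s)"
      by (intro derivative_intros DERIV_cmult_right \<epsilon>d)
    also have "(\<Sum>l\<in>UNIV. (\<Sum>q\<in>UNIV. b i q * \<epsilon> q l s) * z $ l) = B (M s z) $ i"
      unfolding B_def M_def vec_lambda_beta sum_distrib_left sum_distrib_right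
      by (subst sum.swap) (simp add: mult.assoc)
    finally show ?thesis by (simp add: M_def)
  qed
  have curve: "integral_curve V T (\<lambda>s. M (s * h z) z)" for T z
    unfolding integral_curve_def
  proof
    fix s assume "s \<in> T"
    show "((\<lambda>s. M (s * h z) z) has_derivative (\<lambda>c. c *\<^sub>C V (M (s * h z) z))) (at s within T)"
      unfolding has_derivative_vec_iff
    proof
      fix i
      have "((\<lambda>s. M (s * h z) z $ i) has_field_derivative B (M (s * h z) z) $ i * h z) (at s within T)"
        using DERIV_chain2[OF dM DERIV_cmult_right[OF DERIV_ident]] by simp
      then show "((\<lambda>s. M (s * h z) z $ i) has_derivative (\<lambda>c. (c *\<^sub>C V (M (s * h z) z)) $ i)) (at s within T)"
        unfolding has_field_derivative_def
        by (rule has_derivative_eq_rhs) (auto simp: V_def inv mult.commute)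
    qed
  qed
  have fl: "flow V 1 z = M (h z) z" for z
    using flow_eq[OF V curve[of _ z], of 1] M0 by simp
  have "complete_field V"
    unfolding complete_field_def using curve[of UNIV] M0 by (metis mult_zero_left)
  moreover have "V \<in> vanishing_fields k"
    using V van by (simp add: vanishing_fields_def V_def)
  ultimately have "flow V 1 \<in> Aut_fields (vanishing_fields k)"
    by (intro Aut_fields_flow)
  also have "flow V 1 = (\<lambda>z. M (h z) z)" using fl by blast
  finally show "(\<lambda>z. M (h z) z) \<in> Aut_fields (vanishing_fields k)" .
  assume z: "z \<in> coord_subspace k"
  have "integral_curve V (closed_segment 0 1) (\<lambda>_. z)"
    using van[OF z] by (simp add: integral_curve_def V_def)
  from flow_eq[OF V this] show "M (h z) z = z" by (simp add: fl)
qed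

text \<open>\<open>\<integral>\<^sub>0\<^sup>s exp (c u) du\<close>\<close>
definition exp_primitive :: "complex \<Rightarrow> complex \<Rightarrow> complex" where
  "exp_primitive c s = (if c = 0 then s else (exp (s * c) - 1) / c)"

lemma exp_primitive_0: "exp_primitive c 0 = 0"
  by (simp add: exp_primitive_def)

text \<open>In this form, rather than as \<open>exp (c * s)\<close>, the derivative fits the matrix
  equation for \<open>rank_one_exp\<close> directly.\<close>

lemma DERIV_exp_primitive:
  "(exp_primitive c has_field_derivative 1 + c * exp_primitive c s) (at s)"
proof (cases "c = 0")
  case True
  then have "exp_primitive c = (\<lambda>s. s)" by (auto simp: exp_primitive_def)
  then show ?thesis using True by simp
next
  case False
  then have "exp_primitive c = (\<lambda>s. (exp (s * c) - 1) / c)" by (auto simp: exp_primitive_def)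
  then show ?thesis using False
    by (auto intro!: derivative_eq_intros)
qed

text \<open>The entry in row \<open>i\<close> and column \<open>l\<close> of
  \<open>exp (s N)\<close> for the rank-one matrix \<open>N = v e_j^T\<close>: from
  \<open>N^2 = v_j N\<close> the series sums to the identity plus
  \<open>exp_primitive (v $ j) s\<close> times \<open>N\<close>.\<close>

definition rank_one_exp :: "complex ^ 'n \<Rightarrow> 'n \<Rightarrow> 'n \<Rightarrow> 'n \<Rightarrow> complex \<Rightarrow> complex" where
  "rank_one_exp v j i l s = (if i = l then 1 else 0) + (if l = j then v $ i * exp_primitive (v $ j) s else 0)"

lemma rank_one_exp_0: "rank_one_exp v j i l 0 = (if i = l then 1 else 0)"
  by (simp add: rank_one_exp_def exp_primitive_0)

lemma DERIV_rank_one_exp: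
  "(rank_one_exp v j i l has_field_derivative
     (\<Sum>q\<in>UNIV. (if q = j then v $ i else 0) * rank_one_exp v j q l s)) (at s)"
proof -
  have "(\<Sum>q\<in>UNIV. (if q = j then v $ i else 0) * rank_one_exp v j q l s)
      = (\<Sum>q\<in>UNIV. if q = j then v $ i * rank_one_exp v j j l s else 0)"
    by (intro sum.cong) auto
  also have "\<dots> = v $ i * rank_one_exp v j j l s" by simp
  finally have *: "(\<Sum>q\<in>UNIV. (if q = j then v $ i else 0) * rank_one_exp v j q l s)
      = (if l = j then v $ i * (1 + v $ j * exp_primitive (v $ j) s) else 0)"
    by (simp add: rank_one_exp_def)
  show ?thesis
    unfolding * unfolding rank_one_exp_def[abs_def]
    by (cases "l = j") (auto intro!: derivative_eq_intros DERIV_exp_primitive)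
qed

lemma rank_one_exp_apply:
  "(\<chi> i. \<Sum>l\<in>UNIV. rank_one_exp v j i l s * z $ l) = z + (exp_primitive (v $ j) s * z $ j) *\<^sub>C v"
  by (simp add: vec_eq_iff rank_one_exp_def sum.distrib mult_delta_left mult_delta_right algebra_simps)

lemma rank_one_apply: "(\<chi> i. \<Sum>l\<in>UNIV. (if l = j then v $ i else 0) * z $ l) = (z $ j) *\<^sub>C (v :: complex ^ 'n)"
  by (simp add: vec_eq_iff mult_delta_left)

section \<open>Homogeneous polynomials\<close>

text \<open>Generated by rules instead of coefficients, so that holomorphy, the order as a jet and
  the effect of substituting a map tangent to the identity all follow by rule induction.\<close>

inductive hom_poly :: "nat \<Rightarrow> (complex ^ 'n \<Rightarrow> complex) \<Rightarrow> bool" where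
  const: "hom_poly 0 (\<lambda>z. c)"
| coord: "hom_poly 1 (\<lambda>z. z $ i)"
| mult: "hom_poly m f \<Longrightarrow> hom_poly l g \<Longrightarrow> hom_poly (m + l) (\<lambda>z. f z * g z)"
| add: "hom_poly m f \<Longrightarrow> hom_poly m g \<Longrightarrow> hom_poly m (\<lambda>z. f z + g z)"

lemma hom_poly_cmult: "hom_poly m f \<Longrightarrow> hom_poly m (\<lambda>z. c * f z)"
  using hom_poly.mult[OF hom_poly.const] by fastforce

lemma hom_poly_power: "hom_poly m f \<Longrightarrow> hom_poly (m * r) (\<lambda>z. f z ^ r)"
proof (induction r)
  case 0
  show ?case using hom_poly.const[of 1] by simp
next
  case (Suc r)
  then show ?case using hom_poly.mult[of m f "m * r"] by simp
qed

lemma hom_poly_monomial: "hom_poly (sum \<alpha> UNIV) (monomial \<alpha> :: complex ^ 'n \<Rightarrow> complex)"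
proof -
  have "hom_poly (sum \<alpha> S) (\<lambda>z :: complex ^ 'n. \<Prod>i\<in>S. z $ i ^ \<alpha> i)" if "finite S" for S
    using that
  proof induction
    case empty
    show ?case using hom_poly.const[of 1] by simp
  next
    case (insert i S)
    then show ?case
      using hom_poly.mult[OF hom_poly_power[OF hom_poly.coord[of i], of "\<alpha> i"]] by simp
  qed
  then show ?thesis by (simp add: monomial_def[abs_def])
qed

lemma hom_poly_holo: "hom_poly m h \<Longrightarrow> holo_on UNIV h"
  by (induction rule: hom_poly.induct) (auto intro: holo_on_const holo_on_nth holo_on_mult holo_on_add)

lemma hom_poly_holo_map:
  "hom_poly m h \<Longrightarrow> (\<And>i. holo_map A (\<lambda>w. F w $ i)) \<Longrightarrow> holo_map A (\<lambda>w. h (F w))"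
  by (induction rule: hom_poly.induct) (auto intro: holo_map_const holo_map_mult holo_map_add)

section \<open>Realizing homogeneous fields up to terms of higher order\<close>

context holo_families
begin

text \<open>The last clause, tangency to the identity, keeps the leading term of a homogeneous field
  unchanged when the field is evaluated at \<open>F x z\<close> instead of \<open>z\<close>.\<close>

definition admissible :: "('a \<Rightarrow> complex ^ 'n::{finite,linorder} \<Rightarrow> complex ^ 'n::{finite,linorder}) \<Rightarrow> bool" where
  "admissible F \<longleftrightarrow>
    (\<forall>x\<in>topspace X. F x \<in> Aut_fields (vanishing_fields k)) \<and>
    (\<forall>i. holo_map (atlas_times_UNIV A) (\<lambda>w. F (fst w) (snd w) $ i)) \<and>
    (\<forall>x\<in>topspace X. \<forall>z\<in>coord_subspace k. F x z = z) \<and>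
    (\<forall>i. jet 2 (\<lambda>x z. F x z $ i - z $ i))"

text \<open>Quantifying over all \<open>F\<close> and all holomorphic coefficients \<open>t\<close>
  makes the property closed under linear combinations: successive corrections add up modulo degree
  \<open>d + 1\<close>, even if the sum of the fields is not complete.\<close>

definition realizable :: "nat \<Rightarrow> (complex ^ 'n::{finite,linorder} \<Rightarrow> complex ^ 'n::{finite,linorder}) \<Rightarrow> bool" where
  "realizable d Q \<longleftrightarrow> (\<forall>F t. admissible F \<longrightarrow> holo_map A t \<longrightarrow>
     (\<exists>F'. admissible F' \<and> (\<forall>i. jet (d + 1) (\<lambda>x z. F' x z $ i - F x z $ i - t x * Q z $ i))))"

lemma realizable_zero: "realizable d (\<lambda>z. 0)"
  unfolding realizable_def
  by (intro allI impI, rule exI, rule conjI, assumption) (auto intro: jet_zero)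

lemma realizable_add:
  fixes Q R :: "complex ^ 'n::{finite,linorder} \<Rightarrow> complex ^ 'n::{finite,linorder}"
  assumes "realizable d Q" "realizable d R"
  shows "realizable d (\<lambda>z. Q z + R z)"
  unfolding realizable_def
proof (intro allI impI)
  fix F :: "'a \<Rightarrow> (complex, 'n) vec \<Rightarrow> (complex, 'n) vec" and t :: "'a \<Rightarrow> complex" assume F: "admissible F" and t: "holo_map A t"
  obtain G where G: "admissible G" "\<And>i. jet (d + 1) (\<lambda>x z. G x z $ i - F x z $ i - t x * Q z $ i)"
    using assms(1) F t unfolding realizable_def by blast
  obtain H where H: "admissible H" "\<And>i. jet (d + 1) (\<lambda>x z. H x z $ i - G x z $ i - t x * R z $ i)"
    using assms(2) G(1) t unfolding realizable_def by blast
  have "jet (d + 1) (\<lambda>x z. H x z $ i - F x z $ i - t x * (Q z + R z) $ i)" for i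
    using jet.add[OF G(2)[of i] H(2)[of i]] by (simp add: algebra_simps)
  then show "\<exists>F'. admissible F' \<and> (\<forall>i. jet (d + 1) (\<lambda>x z. F' x z $ i - F x z $ i - t x * (Q z + R z) $ i))"
    using H(1) by blast
qed

lemma realizable_scale:
  fixes Q :: "complex ^ 'n::{finite,linorder} \<Rightarrow> complex ^ 'n::{finite,linorder}"
  assumes "realizable d Q"
  shows "realizable d (\<lambda>z. c *\<^sub>C Q z)"
  unfolding realizable_def
proof (intro allI impI)
  fix F :: "'a \<Rightarrow> (complex, 'n) vec \<Rightarrow> (complex, 'n) vec" and t :: "'a \<Rightarrow> complex" assume F: "admissible F" and t: "holo_map A t"
  have "holo_map A (\<lambda>x. t x * c)" by (intro holo_map_mult holo_map_const t)
  then obtain G where G: "admissible G" "\<And>i. jet (d + 1) (\<lambda>x z. G x z $ i - F x z $ i - (t x * c) * Q z $ i)"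
    using assms(1) F unfolding realizable_def by blast
  then show "\<exists>F'. admissible F' \<and> (\<forall>i. jet (d + 1) (\<lambda>x z. F' x z $ i - F x z $ i - t x * (c *\<^sub>C Q z) $ i))"
    by (intro exI[of _ G]) (simp add: mult.assoc)
qed

text \<open>The coefficients of a polynomial in \<open>c\<close> lie in the span of its values.
  Eliminating the top degree inductively replaces a Vandermonde determinant.\<close>

lemma realizable_coefficients:
  assumes "\<And>c. c \<noteq> 0 \<Longrightarrow> realizable d (\<lambda>z. \<Sum>r\<le>N. c ^ r *\<^sub>C Q r z)" and "r \<le> N"
  shows "realizable d (Q r)"
  using assms
proof (induction N arbitrary: Q r)
  case 0
  then show ?case using "0.prems"(1)[of 1] by simp
next
  case (Suc N)
  \<comment> \<open>\<open>p(2c) - 2\<^sup>N\<^sup>+\<^sup>1 p(c)\<close> has no term of degree \<open>N + 1\<close>.\<close>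
  have low: "realizable d (Q r)" if "r \<le> N" for r
  proof -
    have "realizable d (\<lambda>z. ((2::complex) ^ r - 2 ^ Suc N) *\<^sub>C Q r z)"
    proof (rule Suc.IH[of "\<lambda>r z. (2 ^ r - 2 ^ Suc N) *\<^sub>C Q r z", OF _ that])
      fix c :: complex assume c: "c \<noteq> 0"
      have "realizable d (\<lambda>z. (\<Sum>r\<le>Suc N. (2 * c) ^ r *\<^sub>C Q r z) +
          (- (2 ^ Suc N)) *\<^sub>C (\<Sum>r\<le>Suc N. c ^ r *\<^sub>C Q r z))"
        using c by (intro realizable_add realizable_scale Suc.prems) auto
      moreover have "(\<Sum>r\<le>Suc N. (2 * c) ^ r *\<^sub>C Q r z) + (- (2 ^ Suc N)) *\<^sub>C (\<Sum>r\<le>Suc N. c ^ r *\<^sub>C Q r z)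
          = (\<Sum>r\<le>N. c ^ r *\<^sub>C (2 ^ r - 2 ^ Suc N) *\<^sub>C Q r z)" for z
        by (simp add: vec_eq_iff sum_distrib_left sum_subtractf sum_negf power_mult_distrib algebra_simps)
      ultimately show "realizable d (\<lambda>z. \<Sum>r\<le>N. c ^ r *\<^sub>C (2 ^ r - 2 ^ Suc N) *\<^sub>C Q r z)"
        by simp
    qed
    from realizable_scale[OF this, of "inverse (2 ^ r - 2 ^ Suc N)"]
    show ?thesis
    proof -
      have "(2::complex) ^ r - 2 ^ Suc N \<noteq> 0"
      proof -
        have "(2::real) ^ r < 2 ^ Suc N" using that by (intro power_strict_increasing) auto
        then have "complex_of_real (2 ^ r) \<noteq> complex_of_real (2 ^ Suc N)"
          by (metis less_irrefl of_real_eq_iff)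
        then show ?thesis by simp
      qed
      then show ?thesis
        using \<open>realizable d (\<lambda>z. inverse _ *\<^sub>C _ *\<^sub>C Q r z)\<close> by (simp add: scaleC_scaleC)
    qed
  qed
  show ?case
  proof (cases "r = Suc N")
    case False
    then show ?thesis using low Suc.prems(2) by simp
  next
    case True
    have "realizable d (\<lambda>z. \<Sum>r\<in>S. Q r z)" if "S \<subseteq> {..N}" "finite S" for S
      using that(2,1) by induction (auto intro: realizable_zero realizable_add low)
    then have "realizable d (\<lambda>z. (\<Sum>r\<le>Suc N. 1 ^ r *\<^sub>C Q r z) + (-1) *\<^sub>C (\<Sum>r\<le>N. Q r z))"
      using Suc.prems(1)[of 1] by (intro realizable_add realizable_scale) auto
    also have "(\<lambda>z. (\<Sum>r\<le>Suc N. 1 ^ r *\<^sub>C Q r z) + (-1) *\<^sub>C (\<Sum>r\<le>N. Q r z)) = Q r"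
      by (simp add: True vec_eq_iff fun_eq_iff)
    finally show ?thesis .
  qed
qed

lemma hom_poly_jet: "hom_poly m h \<Longrightarrow> jet m (\<lambda>x z. h z)"
  by (induction rule: hom_poly.induct)
    (auto intro: jet_coeff holo_map_const jet_coord[unfolded One_nat_def] jet_mult jet.add)

lemma admissible_jet_1: "admissible F \<Longrightarrow> jet 1 (\<lambda>x z. F x z $ i)"
  using jet.add[OF jet_mono[of 2 "\<lambda>x z. F x z $ i - z $ i" 1] jet_coord[of i]]
  by (simp add: admissible_def)

text \<open>Replacing \<open>z\<close> by \<open>F x z\<close> changes a coordinate only in order 2,
  and products inherit the gain of one degree from
  \<open>f(F) g(F) - f g = f(F) (g(F) - g) + (f(F) - f) g\<close>.\<close>

lemma hom_poly_jet_comp: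
  assumes "hom_poly m h" "admissible F"
  shows "jet m (\<lambda>x z. h (F x z)) \<and> jet (m + 1) (\<lambda>x z. h (F x z) - h z)"
  using assms(1)
proof induction
  case (const c)
  show ?case by (auto intro: jet_coeff holo_map_const jet_zero)
next
  case (coord i)
  show ?case using assms(2) admissible_jet_1[OF assms(2)] by (auto simp: admissible_def numeral_2_eq_2)
next
  case (add m f g)
  then have "jet m (\<lambda>x z. f (F x z) + g (F x z))"
    "jet (m + 1) (\<lambda>x z. (f (F x z) - f z) + (g (F x z) - g z))"
    by (auto intro: jet.add)
  then show ?case by (simp add: algebra_simps)
next
  case (mult m f l g)
  have "jet (m + (l + 1)) (\<lambda>x z. f (F x z) * (g (F x z) - g z))"
    using jet_mult[OF conjunct1 conjunct2] mult.IH by blast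
  moreover have "jet ((m + 1) + l) (\<lambda>x z. (f (F x z) - f z) * g z)"
    using jet_mult[OF conjunct2 hom_poly_jet] mult by blast
  ultimately have "jet (m + l + 1) (\<lambda>x z. f (F x z) * (g (F x z) - g z) + (f (F x z) - f z) * g z)"
    by (intro jet.add) (simp_all add: algebra_simps)
  moreover have "jet (m + l) (\<lambda>x z. f (F x z) * g (F x z))"
    using mult.IH jet_mult by blast
  ultimately show ?case by (simp add: algebra_simps)
qed

text \<open>The new map is \<open>exp (s b)\<close> applied to \<open>F x z\<close> with
  \<open>s = t x * h (F x z)\<close>, which has order \<open>m\<close>. Expanding the exponential to
  first order and then replacing \<open>F x z\<close> by \<open>z\<close> leaves the prescribed
  field.\<close>

lemma realizable_scaled_linear:
  fixes \<epsilon> :: "'n::{finite,linorder} \<Rightarrow> 'n::{finite,linorder} \<Rightarrow> complex \<Rightarrow> complex"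
    and b :: "'n::{finite,linorder} \<Rightarrow> 'n::{finite,linorder} \<Rightarrow> complex"
    and h :: "complex ^ 'n::{finite,linorder} \<Rightarrow> complex"
  assumes \<epsilon>0: "\<And>i l. \<epsilon> i l 0 = (if i = l then 1 else 0)"
    and \<epsilon>d: "\<And>i l s. (\<epsilon> i l has_field_derivative (\<Sum>q\<in>UNIV. b i q * \<epsilon> q l s)) (at s)"
    and h: "hom_poly m h" and m: "1 \<le> m"
    and inv: "\<And>s z. h (\<chi> i. \<Sum>l\<in>UNIV. \<epsilon> i l s * z $ l) = h z"
    and van: "\<And>z. z \<in> coord_subspace k \<Longrightarrow> h z *\<^sub>C (\<chi> i. \<Sum>l\<in>UNIV. b i l * z $ l) = 0"
  shows "realizable (m + 1) (\<lambda>z. h z *\<^sub>C (\<chi> i. \<Sum>l\<in>UNIV. b i l * z $ l))"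
  unfolding realizable_def
proof (intro allI impI)
  fix F :: "'a \<Rightarrow> (complex, 'n) vec \<Rightarrow> (complex, 'n) vec" and t :: "'a \<Rightarrow> complex" assume F: "admissible F" and t: "holo_map A t"
  define B :: "(complex, 'n) vec \<Rightarrow> (complex, 'n) vec" where "B = (\<lambda>z. \<chi> i. \<Sum>l\<in>UNIV. b i l * z $ l)"
  define M :: "complex \<Rightarrow> (complex, 'n) vec \<Rightarrow> (complex, 'n) vec" where "M = (\<lambda>s z. \<chi> i. \<Sum>l\<in>UNIV. \<epsilon> i l s * z $ l)"
  define G where "G = (\<lambda>x z. M (t x * h (F x z)) (F x z))"
  have hol: "\<epsilon> i l holomorphic_on UNIV" for i l
    using \<epsilon>d by (auto simp: holomorphic_on_open)
  have der: "deriv (\<epsilon> i l) 0 = b i l" for i l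
    using DERIV_imp_deriv[OF \<epsilon>d[of i l 0]] by (simp add: \<epsilon>0 if_distrib cong: if_cong)
  have hF: "jet m (\<lambda>x z. h (F x z))" "jet (m + 1) (\<lambda>x z. h (F x z) - h z)"
    using hom_poly_jet_comp[OF h F] by auto
  have jets: "jet (m + 2) (\<lambda>x z. G x z $ i - F x z $ i - t x * (h z *\<^sub>C B z) $ i)" for i
  proof -
    \<comment> \<open>The part of the exponential beyond first order: order \<open>2 * m\<close>
      from \<open>jet_entire\<close> and 1 from the factor, and
      \<open>2 * m + 1 \<ge> m + 2\<close>.\<close>
    have 1: "jet (m + 2) (\<lambda>x z. (\<epsilon> i l (t x * h (F x z)) - \<epsilon> i l 0 - b i l * (t x * h (F x z))) * F x z $ l)" for l
      by (rule jet_mono[OF jet_mult[OF jet_entire[OF hol[of i l] jet_scale[OF t hF(1)] m]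
          admissible_jet_1[OF F], unfolded der]]) (use m in simp)
    \<comment> \<open>The first-order part with \<open>F x z\<close> in place of \<open>z\<close>:
      both differences gain one degree by tangency to the identity.\<close>
    have 2: "jet (m + 2) (\<lambda>x z. (t x * b i l) * (h (F x z) * (F x z $ l - z $ l) + (h (F x z) - h z) * z $ l))" for l
    proof (intro jet_scale holo_map_mult holo_map_const t jet.add)
      show "jet (m + 2) (\<lambda>x z. h (F x z) * (F x z $ l - z $ l))"
        using F by (intro jet_mult hF) (auto simp: admissible_def)
      show "jet (m + 2) (\<lambda>x z. (h (F x z) - h z) * z $ l)"
        using jet_mult[OF hF(2) jet_coord[of l]] by simp
    qed
    have "jet (m + 2) (\<lambda>x z. \<Sum>l\<in>UNIV. (\<epsilon> i l (t x * h (F x z)) - \<epsilon> i l 0 - b i l * (t x * h (F x z))) * F x z $ l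
        + (t x * b i l) * (h (F x z) * (F x z $ l - z $ l) + (h (F x z) - h z) * z $ l))"
      by (intro jet_sum jet.add 1 2)
    also have "(\<lambda>x z. \<Sum>l\<in>UNIV. (\<epsilon> i l (t x * h (F x z)) - \<epsilon> i l 0 - b i l * (t x * h (F x z))) * F x z $ l
        + (t x * b i l) * (h (F x z) * (F x z $ l - z $ l) + (h (F x z) - h z) * z $ l))
      = (\<lambda>x z. G x z $ i - F x z $ i - t x * (h z *\<^sub>C B z) $ i)"
    proof (intro ext)
      fix x z
      have "(\<Sum>l\<in>UNIV. \<epsilon> i l 0 * F x z $ l) = F x z $ i"
        by (simp add: \<epsilon>0 if_distrib[of "\<lambda>c. c * _"] cong: if_cong)
      then have "G x z $ i - F x z $ i - t x * (h z *\<^sub>C B z) $ i =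
        (\<Sum>l\<in>UNIV. \<epsilon> i l (t x * h (F x z)) * F x z $ l) - (\<Sum>l\<in>UNIV. \<epsilon> i l 0 * F x z $ l)
          - (\<Sum>l\<in>UNIV. t x * (h z * (b i l * z $ l)))"
        by (simp add: G_def M_def B_def sum_distrib_left)
      then show "(\<Sum>l\<in>UNIV. (\<epsilon> i l (t x * h (F x z)) - \<epsilon> i l 0 - b i l * (t x * h (F x z))) * F x z $ l
          + (t x * b i l) * (h (F x z) * (F x z $ l - z $ l) + (h (F x z) - h z) * z $ l))
        = G x z $ i - F x z $ i - t x * (h z *\<^sub>C B z) $ i"
        by (simp add: sum_subtractf[symmetric] algebra_simps)
    qed
    finally show ?thesis .
  qed
  have "admissible G"
    unfolding admissible_def
  proof (intro conjI ballI allI)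
    fix x assume x: "x \<in> topspace X"
    \<comment> \<open>For fixed \<open>x\<close> the time \<open>t x\<close> is absorbed into the
      first integral, so that only time-one flows occur.\<close>
    have th: "holo_on UNIV (\<lambda>z. t x * h z)"
      by (intro holo_on_mult holo_on_const hom_poly_holo[OF h])
    have van': "(t x * h z) *\<^sub>C B z = 0" if "z \<in> coord_subspace k" for z
      using van[OF that] by (simp only: B_def scaleC_scaleC[symmetric] scaleC_zero_right)
    note * = scaled_linear_flow[where h="\<lambda>z. t x * h z" and \<epsilon>=\<epsilon> and b=b, OF \<epsilon>0 \<epsilon>d th]
    have flow: "(\<lambda>z. M (t x * h z) z) \<in> Aut_fields (vanishing_fields k)"
      "\<And>z. z \<in> coord_subspace k \<Longrightarrow> M (t x * h z) z = z"
      unfolding M_def by (rule *; use inv van' in \<open>simp add: B_def\<close>)+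
    have "(\<lambda>z. M (t x * h z) z) \<circ> F x \<in> Aut_fields (vanishing_fields k)"
      using F x by (intro Aut_fields_comp flow(1)) (simp add: admissible_def)
    then show "G x \<in> Aut_fields (vanishing_fields k)" by (simp add: G_def o_def)
    fix z :: "(complex, 'n) vec" assume z: "z \<in> coord_subspace k"
    then have "F x z = z" using F x by (simp add: admissible_def)
    then show "G x z = z"
      unfolding G_def using flow(2)[OF z] by simp
  next
    fix i
    have F': "holo_map (atlas_times_UNIV A) (\<lambda>w. F (fst w) (snd w) $ l)" for l
      using F by (simp add: admissible_def)
    show "holo_map (atlas_times_UNIV A) (\<lambda>w. G (fst w) (snd w) $ i)"
      unfolding G_def M_def vec_lambda_beta
      by (intro holo_map_sum holo_map_mult F' holo_map_entire[OF hol] hom_poly_holo_map[OF h]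
          holo_map_times_fst[OF manifold t, unfolded case_prod_beta])
    have "jet (m + 1) (\<lambda>x z. t x * (h z * (\<Sum>l\<in>UNIV. b i l * z $ l)))"
      by (intro jet_scale[OF t] jet_mult hom_poly_jet[OF h] jet_sum jet_scale holo_map_const jet_coord)
    then have "jet 2 (\<lambda>x z. t x * (h z *\<^sub>C B z) $ i)"
      using jet_mono[of "m + 1" _ 2] m by (simp add: B_def)
    moreover have "jet 2 (\<lambda>x z. G x z $ i - F x z $ i - t x * (h z *\<^sub>C B z) $ i)"
      by (rule jet_mono[OF jets]) simp
    moreover have "jet 2 (\<lambda>x z. F x z $ i - z $ i)"
      using F by (simp add: admissible_def)
    ultimately have "jet 2 (\<lambda>x z. t x * (h z *\<^sub>C B z) $ i +
        (G x z $ i - F x z $ i - t x * (h z *\<^sub>C B z) $ i) + (F x z $ i - z $ i))"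
      by (intro jet.add)
    then show "jet 2 (\<lambda>x z. G x z $ i - z $ i)" by simp
  qed
  then show "\<exists>F'. admissible F' \<and> (\<forall>i. jet (m + 1 + 1) (\<lambda>x z. F' x z $ i - F x z $ i -
      t x * (h z *\<^sub>C (\<chi> i. \<Sum>l\<in>UNIV. b i l * z $ l)) $ i))"
    using jets unfolding B_def by (intro exI[of _ G]) simp
qed

text \<open>A shear if \<open>v $ j = 0\<close>, an overshear otherwise. Invariance along
  \<open>v\<close> makes \<open>h\<close> a first integral, and the factor \<open>z $ j\<close>
  makes the field vanish on the subspace.\<close>

lemma realizable_rank_one:
  fixes v :: "complex ^ 'n::{finite,linorder}"
  assumes h: "hom_poly m h" and m: "1 \<le> m" and j: "k \<le> card {..<j}"
    and inv: "\<And>s z. h (z + s *\<^sub>C v) = h z"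
  shows "realizable (m + 1) (\<lambda>z. (h z * z $ j) *\<^sub>C v)"
proof -
  have "realizable (m + 1) (\<lambda>z. h z *\<^sub>C (\<chi> i. \<Sum>l\<in>UNIV. (if l = j then v $ i else 0) * z $ l))"
    by (rule realizable_scaled_linear[where \<epsilon>="rank_one_exp v j"])
      (use j m in \<open>auto simp: rank_one_exp_0 DERIV_rank_one_exp rank_one_exp_apply inv h m rank_one_apply
        coord_subspace_def\<close>)
  then show ?thesis by (simp add: rank_one_apply scaleC_scaleC)
qed

text \<open>The diagonal flow multiplies \<open>monomial \<beta>\<close> by the exponential of a
  multiple of the sum in the second hypothesis; its vanishing makes the monomial a first
  integral.\<close>

lemma realizable_diagonal:
  fixes \<mu> :: "'n::{finite,linorder} \<Rightarrow> complex"
  assumes \<beta>: "1 \<le> sum \<beta> UNIV" and \<mu>: "(\<Sum>l\<in>UNIV. of_nat (\<beta> l) * \<mu> l) = 0"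
    and van: "\<And>z l. z \<in> coord_subspace k \<Longrightarrow> monomial \<beta> z * (\<mu> l * z $ l) = 0"
  shows "realizable (sum \<beta> UNIV + 1) (\<lambda>z. monomial \<beta> z *\<^sub>C (\<chi> l. \<mu> l * z $ l))"
proof -
  have diag: "(\<Sum>l\<in>UNIV. (if i = l then a i else 0) * z $ l) = a i * z $ i" for i z and a :: "'n \<Rightarrow> complex"
    by (simp add: if_distrib[of "\<lambda>c. c * _"] cong: if_cong)
  have "realizable (sum \<beta> UNIV + 1)
      (\<lambda>z. monomial \<beta> z *\<^sub>C (\<chi> i. \<Sum>l\<in>UNIV. (if i = l then \<mu> i else 0) * z $ l))"
  proof (rule realizable_scaled_linear[where \<epsilon>="\<lambda>i l s. if i = l then exp (s * \<mu> i) else 0"])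
    show "((\<lambda>s. if i = l then exp (s * \<mu> i) else 0) has_field_derivative
        (\<Sum>q\<in>UNIV. (if i = q then \<mu> i else 0) * (if q = l then exp (s * \<mu> q) else 0))) (at s)" for i l s
    proof -
      have "(\<Sum>q\<in>UNIV. (if i = q then \<mu> i else 0) * (if q = l then exp (s * \<mu> q) else 0))
          = (\<Sum>q\<in>UNIV. if i = q then (if i = l then \<mu> i * exp (s * \<mu> i) else 0) else 0)"
        by (intro sum.cong) auto
      then show ?thesis
        by (cases "i = l") (auto intro!: derivative_eq_intros)
    qed
    show "monomial \<beta> (\<chi> i. \<Sum>l\<in>UNIV. (if i = l then exp (s * \<mu> i) else 0) * z $ l) = monomial \<beta> z" for s z
    proof -
      have "(\<Prod>i\<in>UNIV. exp (s * \<mu> i) ^ \<beta> i) = exp (\<Sum>i\<in>UNIV. of_nat (\<beta> i) * (s * \<mu> i))"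
        by (simp add: exp_sum exp_of_nat_mult)
      also have "(\<Sum>i\<in>UNIV. of_nat (\<beta> i) * (s * \<mu> i)) = s * (\<Sum>i\<in>UNIV. of_nat (\<beta> i) * \<mu> i)"
        by (simp add: sum_distrib_left algebra_simps)
      finally have "(\<Prod>i\<in>UNIV. exp (s * \<mu> i) ^ \<beta> i) = 1" by (simp add: \<mu>)
      then show ?thesis
        unfolding diag[of _ "\<lambda>i. exp (s * \<mu> i)"]
        by (simp add: monomial_def power_mult_distrib prod.distrib)
    qed
    show "monomial \<beta> z *\<^sub>C (\<chi> i. \<Sum>l\<in>UNIV. (if i = l then \<mu> i else 0) * z $ l) = 0"
      if "z \<in> coord_subspace k" for z
      using van[OF that] by (simp add: diag vec_eq_iff)
  qed (use \<beta> hom_poly_monomial in auto)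
  then show ?thesis by (simp add: diag)
qed

end

section \<open>Auxiliary facts on monomials and complex linear maps\<close>

lemma monomial_split:
  assumes "\<alpha> j > 0"
  shows "monomial \<alpha> z = monomial (\<alpha>(j := \<alpha> j - 1)) z * z $ j"
proof -
  have "monomial \<alpha> z = monomial (\<lambda>l. (\<alpha>(j := \<alpha> j - 1)) l + (if l = j then 1 else 0)) z"
    using assms by (intro arg_cong[of _ _ "\<lambda>a. monomial a z"]) auto
  then show ?thesis by (simp only: monomial_add monomial_single)
qed

lemma sum_split:
  fixes \<alpha> :: "'n::finite \<Rightarrow> nat"
  assumes "\<alpha> j > 0"
  shows "sum \<alpha> UNIV = sum (\<alpha>(j := \<alpha> j - 1)) UNIV + 1"
proof -
  have "sum \<alpha> UNIV = (\<Sum>l\<in>UNIV. (\<alpha>(j := \<alpha> j - 1)) l + (if l = j then 1 else 0))"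
    using assms by (intro sum.cong) auto
  then show ?thesis by (simp add: sum.distrib)
qed

lemma monomial_update_invariant:
  "\<alpha> i = 0 \<Longrightarrow> (\<And>l. l \<noteq> i \<Longrightarrow> w $ l = z $ l) \<Longrightarrow> monomial \<alpha> w = monomial \<alpha> z"
  unfolding monomial_def by (intro prod.cong) (metis power_0)+

lemma monomial_single_power: "monomial (\<lambda>l. if l = i then a else 0) z = z $ i ^ a"
proof -
  have "monomial (\<lambda>l. if l = i then a else 0) z = (\<Prod>l\<in>UNIV. if l = i then z $ i ^ a else 1)"
    unfolding monomial_def by (intro prod.cong) auto
  then show ?thesis by simp
qed

lemma monomial_transversal_vanishes:
  "transversal k \<alpha> \<Longrightarrow> z \<in> coord_subspace k \<Longrightarrow> monomial \<alpha> z = 0"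
  using monomial_proj_coord[of \<alpha> k z] proj_coord_id[of z k] by simp

lemma hom_poly_coord_diff: "hom_poly 1 (\<lambda>z. z $ j - c * z $ l)"
  using hom_poly.add[OF hom_poly.coord[of j] hom_poly_cmult[OF hom_poly.coord[of l], of "- c"]] by simp

lemma clinear_map_sum: "clinear_map f \<Longrightarrow> f (\<Sum>l\<in>S. g l) = (\<Sum>l\<in>S. f (g l))"
proof (induction S rule: infinite_finite_induct)
  case (infinite S)
  then show ?case unfolding clinear_map_def by (metis scaleC_zero_left sum.infinite)
next
  case empty
  then show ?case unfolding clinear_map_def by (metis scaleC_zero_left sum.empty)
qed (simp add: clinear_map_def)

lemma sum_axis: "(\<Sum>l\<in>UNIV. z $ l *\<^sub>C axis l (1::complex)) = z"
  by (simp add: vec_eq_iff axis_def mult_delta_right)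

lemma clinear_map_axis: "clinear_map f \<Longrightarrow> f z = (\<Sum>l\<in>UNIV. z $ l *\<^sub>C f (axis l 1))"
  using clinear_map_sum[of f "\<lambda>l. z $ l *\<^sub>C axis l 1" UNIV] sum_axis[of z]
  by (simp add: clinear_map_def)

section \<open>Linear automorphisms\<close>

text \<open>The map has determinant \<open>1 + w $ q\<close>, so the second hypothesis is
  invertibility; it then has a logarithm that is again of rank at most one.\<close>

lemma rank_one_Aut:
  fixes w :: "complex ^ 'n::{finite,linorder}"
  assumes q: "k \<le> card {..<q}" and w: "w $ q \<noteq> -1"
  shows "(\<lambda>z. z + z $ q *\<^sub>C w) \<in> Aut_fields (vanishing_fields k)"
proof -
  \<comment> \<open>In the second case \<open>v $ q\<close> is \<open>Ln (1 + w $ q)\<close>, so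
    \<open>exp_primitive (v $ q) 1\<close> is \<open>w $ q\<close> divided by this logarithm and
    cancels the scaling of \<open>w\<close>. If \<open>w $ q = 0\<close>, the matrix squares to zero
    and its exponential is the identity plus itself.\<close>
  define v where "v = (if w $ q = 0 then w else (Ln (1 + w $ q) / w $ q) *\<^sub>C w)"
  have v: "(exp_primitive (v $ q) 1 * c) *\<^sub>C v = c *\<^sub>C w" for c
  proof (cases "w $ q = 0")
    case True
    then show ?thesis by (simp add: v_def exp_primitive_def)
  next
    case False
    have "1 + w $ q \<noteq> 0" using w by (metis add.commute add_eq_0_iff)
    moreover from this have "Ln (1 + w $ q) \<noteq> 0"
      using False by (metis add_cancel_right_right exp_Ln exp_zero)
    ultimately show ?thesis
      using False by (simp add: v_def exp_primitive_def scaleC_scaleC)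
  qed
  have "(\<lambda>z. \<chi> i. \<Sum>l\<in>UNIV. rank_one_exp v q i l 1 * z $ l) \<in> Aut_fields (vanishing_fields k)"
    by (rule scaled_linear_flow(1)[where h="\<lambda>_. 1" and \<epsilon>="rank_one_exp v q" and
          b="\<lambda>i l. if l = q then v $ i else 0"])
      (use q in \<open>auto simp: rank_one_exp_0 DERIV_rank_one_exp holo_on_const rank_one_apply coord_subspace_def\<close>)
  then show ?thesis by (simp add: rank_one_exp_apply v)
qed

text \<open>Induction on the number of basis vectors moved by \<open>f\<close>. Each of them lies
  outside the subspace, as \<open>rank_one_Aut\<close> requires of its index.\<close>

lemma linear_Aut:
  fixes f :: "complex ^ 'n::{finite,linorder} \<Rightarrow> complex ^ 'n::{finite,linorder}"
  assumes "clinear_map f" "inj f" "\<And>z. z \<in> coord_subspace k \<Longrightarrow> f z = z"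
  shows "f \<in> Aut_fields (vanishing_fields k)"
  using assms
proof (induction "card {l. f (axis l 1) \<noteq> axis l 1}" arbitrary: f rule: less_induct)
  case less
  note lin = less.prems(1) and inj = less.prems(2) and fix_L = less.prems(3)
  show ?case
  proof (cases "\<exists>j. f (axis j 1) \<noteq> axis j 1")
    case False
    then have "f z = z" for z by (subst clinear_map_axis[OF lin]) (simp add: sum_axis)
    then have "f = id" by auto
    then show ?thesis by (simp add: Aut_fields_id)
  next
    case True
    then obtain j where j: "f (axis j 1) \<noteq> axis j 1" by blast
    have trans: "k \<le> card {..<l}" if "f (axis l 1) \<noteq> axis l 1" for l
    proof (rule ccontr)
      assume "\<not> k \<le> card {..<l}"
      then have "axis l (1::complex) \<in> coord_subspace k" by (auto simp: coord_subspace_def axis_def)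
      then show False using fix_L that by blast
    qed
    \<comment> \<open>Otherwise \<open>f (axis j 1)\<close> would be a combination of basis vectors
      fixed by \<open>f\<close>, hence fixed itself, against injectivity.\<close>
    have "\<exists>q. f (axis q 1) \<noteq> axis q 1 \<and> f (axis j 1) $ q \<noteq> 0"
    proof (rule ccontr)
      assume contra: "\<not> ?thesis"
      define m where "m = f (axis j 1)"
      have "f m = (\<Sum>l\<in>UNIV. m $ l *\<^sub>C f (axis l 1))" by (rule clinear_map_axis[OF lin])
      also have "\<dots> = (\<Sum>l\<in>UNIV. m $ l *\<^sub>C axis l 1)"
        using contra by (intro sum.cong refl) (metis m_def scaleC_zero_left)
      also have "\<dots> = f (axis j 1)" by (simp add: sum_axis m_def)
      finally show False using inj j by (auto simp: inj_on_def m_def)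
    qed
    then obtain q where q: "f (axis q 1) \<noteq> axis q 1" "f (axis j 1) $ q \<noteq> 0" by blast
    \<comment> \<open>Pivoting: if the diagonal entry of column \<open>j\<close> is zero, row
      \<open>q\<close> is added to row \<open>j\<close>.\<close>
    define g where "g = (if f (axis j 1) $ j \<noteq> 0 then f else (\<lambda>z. f z + f z $ q *\<^sub>C axis j 1))"
    have g_lin: "clinear_map g"
      using lin by (auto simp: g_def clinear_map_def scaleC_add_left scaleC_add_right scaleC_scaleC)
    have gj: "g (axis j 1) $ j \<noteq> 0" using q by (auto simp: g_def axis_def)
    have g_ax: "g (axis l 1) = axis l 1" if "f (axis l 1) = axis l 1" for l
      using that q(1) by (auto simp: g_def axis_def vec_eq_iff)
    have fg: "f \<in> Aut_fields (vanishing_fields k)" if "g \<in> Aut_fields (vanishing_fields k)"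
    proof (cases "f (axis j 1) $ j = 0")
      case True
      then have "q \<noteq> j" using q by auto
      then have f_eq: "f = (\<lambda>z. z + z $ q *\<^sub>C (- axis j 1)) \<circ> g"
        using True by (auto simp: g_def fun_eq_iff vec_eq_iff axis_def)
      have "(\<lambda>z :: (complex, 'n) vec. z + z $ q *\<^sub>C (- axis j 1)) \<in> Aut_fields (vanishing_fields k)"
        using \<open>q \<noteq> j\<close> by (intro rank_one_Aut trans q) (auto simp: axis_def)
      then show ?thesis by (subst f_eq) (rule Aut_fields_comp[OF _ that])
    qed (use that in \<open>simp add: g_def\<close>)
    define m where "m = g (axis j 1)"
    \<comment> \<open>Chosen with \<open>m + m $ j *\<^sub>C w = axis j 1\<close>: the rank-one map
      built from \<open>w\<close> turns column \<open>j\<close> of \<open>g\<close> into the basis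
      vector and leaves alone the basis vectors already fixed, whose entry at \<open>j\<close> is
      0.\<close>
    define w where "w = inverse (m $ j) *\<^sub>C (axis j 1 - m)"
    have mj: "m $ j \<noteq> 0" using gj by (simp add: m_def)
    have wj: "1 + w $ j = inverse (m $ j)" using mj by (simp add: w_def field_simps)
    define h where "h = (\<lambda>z. g z + g z $ j *\<^sub>C w)"
    have h_ax: "h (axis l 1) = axis l 1" if "f (axis l 1) = axis l 1" for l
      using g_ax[OF that] that j by (auto simp: h_def axis_def vec_eq_iff)
    have hj: "h (axis j 1) = axis j 1"
      using mj by (simp add: h_def w_def m_def[symmetric] scaleC_scaleC)
    have h_lin: "clinear_map h"
      using g_lin by (auto simp: h_def clinear_map_def scaleC_add_left scaleC_add_right scaleC_scaleC)
    \<comment> \<open>Since \<open>1 + w $ j = inverse (m $ j)\<close>, the inverse of the rank-one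
      map has the vector \<open>- m $ j *\<^sub>C w\<close>, whose entry at \<open>j\<close> is
      \<open>m $ j - 1\<close> and thus not \<open>-1\<close>.\<close>
    have g_inv: "g z = h z + h z $ j *\<^sub>C (- m $ j *\<^sub>C w)" for z
    proof -
      have "h z $ j = g z $ j * (1 + w $ j)" by (simp add: h_def algebra_simps)
      then have "h z $ j * m $ j = g z $ j" using wj mj by simp
      then have *: "h z $ j *\<^sub>C (- m $ j *\<^sub>C w) = - g z $ j *\<^sub>C w"
        by (simp only: scaleC_scaleC mult_minus_right)
      show ?thesis unfolding * by (simp add: h_def vec_eq_iff)
    qed
    have f_inv: "f z = g z + g z $ q *\<^sub>C (if f (axis j 1) $ j \<noteq> 0 then 0 else - axis j 1)" for z
    proof (cases "f (axis j 1) $ j = 0")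
      case True
      then have "q \<noteq> j" using q by auto
      then show ?thesis using True by (auto simp: g_def vec_eq_iff axis_def)
    qed (simp add: g_def)
    have "inj h"
    proof (rule injI)
      fix y z assume "h y = h z"
      then have "g y = g z" using g_inv by metis
      then have "f y = f z" using f_inv by metis
      then show "y = z" using inj by (simp add: inj_on_def)
    qed
    moreover have "h z = z" if "z \<in> coord_subspace k" for z
    proof -
      have "h z = (\<Sum>l\<in>UNIV. z $ l *\<^sub>C h (axis l 1))" by (rule clinear_map_axis[OF h_lin])
      also have "\<dots> = (\<Sum>l\<in>UNIV. z $ l *\<^sub>C axis l 1)"
      proof (intro sum.cong refl)
        fix l
        show "z $ l *\<^sub>C h (axis l 1) = z $ l *\<^sub>C axis l 1"
        proof (cases "f (axis l 1) = axis l 1")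
          case False
          then show ?thesis using trans that by (auto simp: coord_subspace_def)
        qed (simp add: h_ax)
      qed
      finally show ?thesis by (simp add: sum_axis)
    qed
    moreover have "card {l. h (axis l 1) \<noteq> axis l 1} < card {l. f (axis l 1) \<noteq> axis l 1}"
      using h_ax hj j by (intro psubset_card_mono) auto
    ultimately have "h \<in> Aut_fields (vanishing_fields k)"
      using less.hyps h_lin by blast
    moreover have "(\<lambda>z. z + z $ j *\<^sub>C (- m $ j *\<^sub>C w)) \<in> Aut_fields (vanishing_fields k)"
    proof (intro rank_one_Aut trans j)
      have "m $ j * w $ j = 1 - m $ j" using mj by (simp add: w_def)
      then show "(- m $ j *\<^sub>C w) $ j \<noteq> - 1" using mj by simp
    qed
    ultimately have "(\<lambda>z. z + z $ j *\<^sub>C (- m $ j *\<^sub>C w)) \<circ> h \<in> Aut_fields (vanishing_fields k)"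
      by (rule Aut_fields_comp[rotated])
    moreover have "(\<lambda>z. z + z $ j *\<^sub>C (- m $ j *\<^sub>C w)) \<circ> h = g"
      using g_inv by (simp add: fun_eq_iff)
    ultimately show ?thesis using fg by simp
  qed
qed

section \<open>Every transversal monomial field is realizable\<close>

context holo_families
begin

text \<open>For \<open>v = e\<^sub>l + c e\<^sub>j\<close> and \<open>u = z\<^sub>j - c z\<^sub>l\<close>, the overshears \<open>z\<^sup>\<beta>\<^sup>' u\<^sup>M z\<^sub>j v\<close> are complete; their
  coefficient at \<open>c\<^sup>a\<^sup>+\<^sup>1\<close> is a multiple of \<open>z\<^sup>\<beta> ((a + 1) z\<^sub>j e\<^sub>j - b z\<^sub>l e\<^sub>l)\<close>. Adding the complete field
  \<open>z\<^sup>\<beta> (b z\<^sub>l e\<^sub>l - a z\<^sub>j e\<^sub>j)\<close> leaves \<open>z\<^sup>\<beta> z\<^sub>j e\<^sub>j\<close>.\<close>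

lemma realizable_coordinate_overshear:
  fixes \<beta> :: "'n::{finite,linorder} \<Rightarrow> nat"
  assumes j: "k \<le> card {..<j}" and b: "\<beta> j > 0" and lj: "l \<noteq> j"
  shows "realizable (sum \<beta> UNIV + 1) (\<lambda>z. (monomial \<beta> z * z $ j) *\<^sub>C axis j 1)"
proof -
  \<comment> \<open>\<open>M\<close> is the exponent for which \<open>z_l^a z_j^b\<close> occurs in
    the expansion of \<open>(z_j - c z_l)^M\<close>, namely at \<open>c^a\<close>.\<close>
  define a b M where "a = \<beta> l" and "b = \<beta> j" and "M = a + b"
  define \<beta>' where "\<beta>' = \<beta>(l := 0, j := 0)"
  have b: "b > 0" using assms(2) by (simp add: b_def)
  have \<beta>_eq: "\<beta> = (\<lambda>i. \<beta>' i + ((if i = l then a else 0) + (if i = j then b else 0)))"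
    using lj by (auto simp: \<beta>'_def a_def b_def)
  have mon: "monomial \<beta> z = monomial \<beta>' z * (z $ l ^ a * z $ j ^ b)" for z
    by (subst \<beta>_eq) (simp add: monomial_add monomial_single_power)
  have deg: "sum \<beta> UNIV = sum \<beta>' UNIV + M"
    by (subst \<beta>_eq) (simp add: sum.distrib M_def)
  define c' where "c' = (\<lambda>r z. monomial \<beta>' z * z $ j * (of_nat (M choose r) * (-1) ^ r * z $ l ^ r * z $ j ^ (M - r)))"
  \<comment> \<open>The summand \<open>c *\<^sub>C axis j 1\<close> of \<open>v\<close> shifts the
    coefficients in direction \<open>j\<close> by one power of \<open>c\<close>: hence the index
    \<open>r - 1\<close> and the value 0 at \<open>r = 0\<close>.\<close>
  define Q :: "nat \<Rightarrow> (complex, 'n) vec \<Rightarrow> (complex, 'n) vec" where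
    "Q = (\<lambda>r z. c' r z *\<^sub>C axis l 1 + (if r = 0 then 0 else c' (r - 1) z) *\<^sub>C axis j 1)"
  have "realizable (sum \<beta> UNIV + 1) (Q (a + 1))"
  proof (rule realizable_coefficients[where N="Suc M"])
    fix c :: complex assume "c \<noteq> 0"
    define h where "h = (\<lambda>z :: (complex, 'n) vec. monomial \<beta>' z * (z $ j - c * z $ l) ^ M)"
    define v :: "(complex, 'n) vec" where "v = axis l 1 + c *\<^sub>C axis j 1"
    have "realizable (sum \<beta> UNIV + 1) (\<lambda>z. (h z * z $ j) *\<^sub>C v)"
    proof (rule realizable_rank_one[OF _ _ j])
      show "hom_poly (sum \<beta> UNIV) h"
        unfolding h_def deg
        using hom_poly.mult[OF hom_poly_monomial hom_poly_power[OF hom_poly_coord_diff, of M]] by simp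
      show "1 \<le> sum \<beta> UNIV" using b by (simp add: deg M_def)
      show "h (z + s *\<^sub>C v) = h z" for s z
      proof -
        have "monomial \<beta>' (z + s *\<^sub>C v) = monomial \<beta>' z"
          unfolding monomial_def by (intro prod.cong) (auto simp: \<beta>'_def v_def axis_def)
        then show ?thesis using lj by (simp add: h_def v_def axis_def algebra_simps)
      qed
    qed
    moreover have "(h z * z $ j) *\<^sub>C v = (\<Sum>r\<le>Suc M. c ^ r *\<^sub>C Q r z)" for z
    proof -
      have "(z $ j - c * z $ l) ^ M = (\<Sum>r\<le>M. of_nat (M choose r) * (- (c * z $ l)) ^ r * z $ j ^ (M - r))"
        using binomial_ring[of "- (c * z $ l)" "z $ j" M] by (simp add: algebra_simps)
      also have "\<dots> = (\<Sum>r\<le>M. c ^ r * (of_nat (M choose r) * (-1) ^ r * z $ l ^ r * z $ j ^ (M - r)))"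
        by (intro sum.cong refl) (simp add: power_mult_distrib power_minus[of "c * z $ l"])
      finally have h: "h z * z $ j = (\<Sum>r\<le>M. c ^ r * c' r z)"
        by (simp add: h_def c'_def sum_distrib_left sum_distrib_right algebra_simps)
      \<comment> \<open>The extra term \<open>r = Suc M\<close> vanishes with its binomial
        coefficient, so that both directions share the range up to \<open>Suc M\<close>.\<close>
      have "(\<Sum>r\<le>Suc M. c ^ r * c' r z) = h z * z $ j"
        by (simp add: h c'_def)
      moreover have "(\<Sum>r\<le>Suc M. c ^ r * (if r = 0 then 0 else c' (r - 1) z)) = c * (h z * z $ j)"
        unfolding sum.atMost_Suc_shift h by (simp add: sum_distrib_left algebra_simps)
      moreover have "(\<Sum>r\<le>Suc M. c ^ r *\<^sub>C Q r z) = (\<Sum>r\<le>Suc M. c ^ r * c' r z) *\<^sub>C axis l 1 +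
          (\<Sum>r\<le>Suc M. c ^ r * (if r = 0 then 0 else c' (r - 1) z)) *\<^sub>C axis j 1"
        unfolding vec_eq_iff Q_def
        by (simp only: sum_component scaleC_vec_nth vector_add_component scaleC_complex_eq
            sum_distrib_right sum.distrib distrib_left mult.assoc) simp
      ultimately show ?thesis by (simp add: v_def vec_eq_iff algebra_simps)
    qed
    ultimately show "realizable (sum \<beta> UNIV + 1) (\<lambda>z. \<Sum>r\<le>Suc M. c ^ r *\<^sub>C Q r z)"
      by simp
  qed (simp add: M_def)
  moreover define s :: complex where "s = (-1) ^ a * of_nat (M choose a)"
  have s: "s \<noteq> 0" by (simp add: s_def M_def)
  define \<mu> :: "'n \<Rightarrow> complex" where "\<mu> = (\<lambda>i. if i = l then of_nat b else if i = j then - of_nat a else 0)"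
  have "realizable (sum \<beta> UNIV + 1) (\<lambda>z. monomial \<beta> z *\<^sub>C (\<chi> i. \<mu> i * z $ i))"
  proof (rule realizable_diagonal)
    show "1 \<le> sum \<beta> UNIV" using b by (simp add: deg M_def)
    have "(\<Sum>i\<in>UNIV. of_nat (\<beta> i) * \<mu> i) =
        (\<Sum>i\<in>UNIV. (if i = l then of_nat (a * b) else 0) - (if i = j then of_nat (a * b) else 0))"
      using lj by (intro sum.cong) (auto simp: \<mu>_def a_def b_def)
    also have "\<dots> = 0" by (simp add: sum_subtractf)
    finally show "(\<Sum>i\<in>UNIV. of_nat (\<beta> i) * \<mu> i) = 0" .
    have "transversal k \<beta>" using assms by (auto simp: transversal_def)
    then show "monomial \<beta> z * (\<mu> i * z $ i) = 0" if "z \<in> coord_subspace k" for z i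
      using that by (simp add: monomial_transversal_vanishes)
  qed
  ultimately have "realizable (sum \<beta> UNIV + 1) (\<lambda>z. (of_nat (a + 1) / s) *\<^sub>C Q (a + 1) z
      + monomial \<beta> z *\<^sub>C (\<chi> i. \<mu> i * z $ i))"
    by (intro realizable_add realizable_scale)
  moreover have "(of_nat (a + 1) / s) *\<^sub>C Q (a + 1) z + monomial \<beta> z *\<^sub>C (\<chi> i. \<mu> i * z $ i)
      = (monomial \<beta> z * z $ j) *\<^sub>C axis j 1" for z
  proof -
    have ca: "c' a z = s * (monomial \<beta> z * z $ j)"
      by (simp add: c'_def s_def mon M_def algebra_simps)
    \<comment> \<open>Compares the coefficients at \<open>a + 1\<close> and \<open>a\<close>, which
      belong to the directions \<open>l\<close> and \<open>j\<close> of \<open>Q (a + 1)\<close>;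
      scaling by \<open>of_nat (a + 1) / s\<close> turns them into the integers \<open>b\<close> and
      \<open>a + 1\<close> up to sign.\<close>
    have "Suc a * (M choose Suc a) = (M - a) * (M choose a)"
      by (simp only: binomial_absorption binomial_absorb_comp)
    then have "of_nat (Suc a * (M choose Suc a)) = (of_nat (b * (M choose a)) :: complex)"
      by (simp add: M_def del: of_nat_mult of_nat_Suc)
    then have bin: "of_nat (a + 1) * of_nat (M choose Suc a) = (of_nat b * of_nat (M choose a) :: complex)"
      by (simp only: of_nat_mult Suc_eq_plus1)
    have "z $ j ^ b = z $ j * z $ j ^ (M - Suc a)"
      using b by (simp add: M_def power_eq_if)
    then have "of_nat (a + 1) * c' (a + 1) z =
        - ((-1) ^ a * (of_nat (a + 1) * of_nat (M choose Suc a)) * (monomial \<beta>' z * (z $ l ^ a * z $ j ^ b) * z $ l))"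
      by (simp add: c'_def algebra_simps)
    also have "\<dots> = - (of_nat b * s * (monomial \<beta> z * z $ l))"
      unfolding bin by (simp add: s_def mon algebra_simps)
    finally have ca1: "of_nat (a + 1) * c' (a + 1) z = - (of_nat b * s * (monomial \<beta> z * z $ l))" .
    have 1: "(of_nat (a + 1) / s) * c' (a + 1) z = - (of_nat b * (monomial \<beta> z * z $ l))"
    proof -
      have "(of_nat (a + 1) / s) * c' (a + 1) z = (of_nat (a + 1) * c' (a + 1) z) / s" by simp
      then show ?thesis unfolding ca1 using s by simp
    qed
    have 2: "(of_nat (a + 1) / s) * c' a z = of_nat (a + 1) * (monomial \<beta> z * z $ j)"
      unfolding ca using s by simp
    have Q: "(of_nat (a + 1) / s) *\<^sub>C Q (a + 1) z =
        ((of_nat (a + 1) / s) * c' (a + 1) z) *\<^sub>C axis l 1 + ((of_nat (a + 1) / s) * c' a z) *\<^sub>C axis j 1"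
      by (simp add: Q_def scaleC_add_right scaleC_scaleC)
    show ?thesis
      unfolding Q 1 2 using lj by (auto simp: vec_eq_iff axis_def \<mu>_def algebra_simps)
  qed
  ultimately show ?thesis by simp
qed

text \<open>If \<open>z_i\<close> is absent, the field is a shear. Otherwise let
  \<open>\<beta>\<close> lack one factor \<open>z_i\<close>. If \<open>monomial \<beta>\<close>
  still vanishes on the subspace, an overshear serves, combined with a diagonal field when
  \<open>i \<noteq> j\<close>. If not, \<open>z_i\<close> is the only transversal coordinate that
  occurs, with exponent one, and the field itself is of the diagonal kind with first integral
  \<open>monomial \<beta>\<close>.\<close>

lemma realizable_monomial:
  fixes \<alpha> :: "'n::{finite,linorder} \<Rightarrow> nat"
  assumes k: "1 \<le> k" and tr: "transversal k \<alpha>" and d: "2 \<le> sum \<alpha> UNIV"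
  shows "realizable (sum \<alpha> UNIV) (\<lambda>z. monomial \<alpha> z *\<^sub>C axis i 1)"
proof (cases "\<alpha> i = 0")
  case True
  obtain j where j: "k \<le> card {..<j}" "\<alpha> j > 0" using tr by (auto simp: transversal_def)
  define \<beta> where "\<beta> = \<alpha>(j := \<alpha> j - 1)"
  have \<beta>: "sum \<alpha> UNIV = sum \<beta> UNIV + 1" "\<And>z. monomial \<alpha> z = monomial \<beta> z * z $ j"
    using sum_split[of \<alpha> j] monomial_split[of \<alpha> j] j by (auto simp: \<beta>_def)
  have "realizable (sum \<beta> UNIV + 1) (\<lambda>z. (monomial \<beta> z * z $ j) *\<^sub>C axis i 1)"
  proof (rule realizable_rank_one[OF hom_poly_monomial _ j(1)])
    show "1 \<le> sum \<beta> UNIV" using d \<beta> by simp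
    show "monomial \<beta> (z + s *\<^sub>C axis i 1) = monomial \<beta> z" for s z
      using True j by (intro monomial_update_invariant[of _ i]) (auto simp: \<beta>_def axis_def)
  qed
  then show ?thesis by (simp add: \<beta>)
next
  case False
  define \<beta> where "\<beta> = \<alpha>(i := \<alpha> i - 1)"
  have \<beta>: "sum \<alpha> UNIV = sum \<beta> UNIV + 1" "\<And>z. monomial \<alpha> z = monomial \<beta> z * z $ i"
    using sum_split[of \<alpha> i] monomial_split[of \<alpha> i] False by (auto simp: \<beta>_def)
  have d': "1 \<le> sum \<beta> UNIV" using d \<beta> by simp
  show ?thesis
  proof (cases "transversal k \<beta>")
    case True
    then obtain j where j: "k \<le> card {..<j}" "\<beta> j > 0" by (auto simp: transversal_def)
    \<comment> \<open>Here \<open>1 \<le> k\<close> enters: a transversal index has a predecessor,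
      which serves as the second coordinate for the overshears.\<close>
    have "{..<j} \<noteq> {}" using j(1) k by (metis card.empty not_one_le_zero order_trans)
    then obtain l where "l < j" by auto
    then have over: "realizable (sum \<beta> UNIV + 1) (\<lambda>z. (monomial \<beta> z * z $ j) *\<^sub>C axis j 1)"
      using realizable_coordinate_overshear[of j \<beta> l] j by simp
    show ?thesis
    proof (cases "i = j")
      case True
      then show ?thesis using over by (simp add: \<beta>)
    next
      case ij: False
      \<comment> \<open>The diagonal field is \<open>\<beta>_j z_i e_i - \<beta>_i z_j e_j\<close>
        times the monomial; \<open>\<beta>_i\<close> times the overshear cancels its second
        part.\<close>
      define \<mu> :: "'n \<Rightarrow> complex" where
        "\<mu> = (\<lambda>q. if q = i then of_nat (\<beta> j) else if q = j then - of_nat (\<beta> i) else 0)"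
      have "realizable (sum \<beta> UNIV + 1) (\<lambda>z. monomial \<beta> z *\<^sub>C (\<chi> q. \<mu> q * z $ q))"
      proof (rule realizable_diagonal[OF d'])
        have "(\<Sum>q\<in>UNIV. of_nat (\<beta> q) * \<mu> q) =
            (\<Sum>q\<in>UNIV. (if q = i then of_nat (\<beta> i * \<beta> j) else 0) - (if q = j then of_nat (\<beta> i * \<beta> j) else 0))"
          using ij by (intro sum.cong) (auto simp: \<mu>_def)
        also have "\<dots> = 0" by (simp add: sum_subtractf)
        finally show "(\<Sum>q\<in>UNIV. of_nat (\<beta> q) * \<mu> q) = 0" .
        show "monomial \<beta> z * (\<mu> q * z $ q) = 0" if "z \<in> coord_subspace k" for z q
          using that True by (simp add: monomial_transversal_vanishes)
      qed
      with over have "realizable (sum \<beta> UNIV + 1) (\<lambda>z. inverse (of_nat (\<beta> j)) *\<^sub>C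
          (of_nat (\<beta> i) *\<^sub>C (monomial \<beta> z * z $ j) *\<^sub>C axis j 1 + monomial \<beta> z *\<^sub>C (\<chi> q. \<mu> q * z $ q)))"
        by (intro realizable_add realizable_scale)
      moreover have "inverse (of_nat (\<beta> j)) *\<^sub>C
          (of_nat (\<beta> i) *\<^sub>C (monomial \<beta> z * z $ j) *\<^sub>C axis j 1 + monomial \<beta> z *\<^sub>C (\<chi> q. \<mu> q * z $ q))
          = monomial \<alpha> z *\<^sub>C axis i 1" for z
        using ij j by (auto simp: vec_eq_iff axis_def \<mu>_def \<beta>)
      ultimately show ?thesis by (simp add: \<beta>)
    qed
  next
    case nt: False
    then have i: "k \<le> card {..<i}" and "\<beta> i = 0"
      using tr unfolding transversal_def \<beta>_def by (metis fun_upd_other fun_upd_same gr0I)+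
    have "realizable (sum \<beta> UNIV + 1) (\<lambda>z. monomial \<beta> z *\<^sub>C (\<chi> q. (if q = i then 1 else 0) * z $ q))"
      by (rule realizable_diagonal[OF d'])
        (use i \<open>\<beta> i = 0\<close> in \<open>auto simp: mult_delta_right coord_subspace_def\<close>)
    moreover have "monomial \<beta> z *\<^sub>C (\<chi> q. (if q = i then 1 else 0) * z $ q) = monomial \<alpha> z *\<^sub>C axis i 1" for z
      by (auto simp: vec_eq_iff axis_def \<beta>)
    ultimately show ?thesis by (simp add: \<beta>)
  qed
qed

end

section \<open>Correcting the jet degree by degree\<close>

lemma monomial_degree_one:
  fixes \<alpha> :: "'n::finite \<Rightarrow> nat"
  assumes "sum \<alpha> UNIV = 1"
  shows "monomial \<alpha> z = (\<Sum>l\<in>UNIV. monomial \<alpha> (axis l 1) * z $ l)"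
proof -
  obtain q where "\<alpha> q = 1" "\<And>l. l \<noteq> q \<Longrightarrow> \<alpha> l = 0"
    using assms sum_eq_1_iff[of UNIV \<alpha>] by (metis finite UNIV_I)
  then have "\<alpha> = (\<lambda>l. if l = q then 1 else 0)" by auto
  then show ?thesis by (simp add: monomial_single axis_def mult_delta_left)
qed

context holo_families
begin

lemma admissible_add_terms:
  fixes F :: "'a \<Rightarrow> complex ^ 'n::{finite,linorder} \<Rightarrow> complex ^ 'n::{finite,linorder}"
  assumes k: "1 \<le> k" and d: "2 \<le> d" and F: "admissible F"
    and ts: "\<forall>(a, \<alpha>)\<in>set ts. holo_map A a \<and> sum \<alpha> UNIV = d \<and> transversal k \<alpha>"
  shows "\<exists>F'. admissible F' \<and> (\<forall>l. jet (d + 1)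
    (\<lambda>x z. F' x z $ l - F x z $ l - (\<Sum>(a, \<alpha>)\<leftarrow>ts. a x * monomial \<alpha> z) * axis i 1 $ l))"
  using ts
proof (induction ts)
  case Nil
  show ?case by (rule exI[of _ F]) (auto intro: F jet_zero)
next
  case (Cons t ts)
  obtain a \<alpha> where t: "t = (a, \<alpha>)" by force
  obtain G where G: "admissible G" "\<And>l. jet (d + 1)
      (\<lambda>x z. G x z $ l - F x z $ l - (\<Sum>(a, \<alpha>)\<leftarrow>ts. a x * monomial \<alpha> z) * axis i 1 $ l)"
    using Cons by auto
  have re: "realizable d (\<lambda>z. monomial \<alpha> z *\<^sub>C axis i 1)"
    using realizable_monomial[OF k, of \<alpha> i] Cons.prems d by (simp add: t)
  have "holo_map A a" using Cons.prems by (simp add: t)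
  from re[unfolded realizable_def, rule_format, OF G(1) this]
  obtain H where H: "admissible H" "\<And>l. jet (d + 1)
      (\<lambda>x z. H x z $ l - G x z $ l - a x * (monomial \<alpha> z *\<^sub>C axis i 1) $ l)"
    by blast
  have "jet (d + 1) (\<lambda>x z. H x z $ l - F x z $ l -
      (\<Sum>(a, \<alpha>)\<leftarrow>t # ts. a x * monomial \<alpha> z) * axis i 1 $ l)" for l
    using jet.add[OF G(2)[of l] H(2)[of l]] by (simp add: t algebra_simps)
  then show ?case using H(1) by blast
qed

text \<open>\<open>P x\<close> and \<open>F x\<close> agree on the subspace, so subtracting from
  their difference its composite with \<open>proj_coord\<close> changes nothing. Its terms of degree
  \<open>d\<close> are therefore transversal, and these are realizable.\<close>

lemma admissible_improve:
  fixes F P :: "'a \<Rightarrow> complex ^ 'n::{finite,linorder} \<Rightarrow> complex ^ 'n::{finite,linorder}"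
  assumes k: "1 \<le> k" and d: "2 \<le> d" and F: "admissible F"
    and P: "\<And>x z. x \<in> topspace X \<Longrightarrow> z \<in> coord_subspace k \<Longrightarrow> P x z = z"
    and jet_d: "\<And>i. jet d (\<lambda>x z. P x z $ i - F x z $ i)"
  shows "\<exists>F'. admissible F' \<and> (\<forall>i. jet (d + 1) (\<lambda>x z. P x z $ i - F' x z $ i))"
proof -
  have ex: "\<exists>ts. (\<forall>(a, \<alpha>)\<in>set ts. holo_map A a \<and> sum \<alpha> UNIV = d \<and> transversal k \<alpha>) \<and>
    jet (d + 1) (\<lambda>x z. P x z $ i - F x z $ i - (\<Sum>(a, \<alpha>)\<leftarrow>ts. a x * monomial \<alpha> z))" for i
  proof -
    obtain ts where ts: "\<forall>(a, \<alpha>)\<in>set ts. holo_map A a \<and> sum \<alpha> UNIV = d \<and> transversal k \<alpha>"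
      "jet (d + 1) (\<lambda>x z. (P x z $ i - F x z $ i) - (P x (proj_coord k z) $ i - F x (proj_coord k z) $ i)
        - (\<Sum>(a, \<alpha>)\<leftarrow>ts. a x * monomial \<alpha> z))"
      using jet_transversal_terms[OF jet_d[of i]] by blast
    have "jet (d + 1) (\<lambda>x z. P x z $ i - F x z $ i - (\<Sum>(a, \<alpha>)\<leftarrow>ts. a x * monomial \<alpha> z))"
      by (rule jet_cong[OF ts(2)]) (use P F in \<open>simp add: proj_coord_in admissible_def\<close>)
    then show ?thesis using ts(1) by blast
  qed
  from choice[OF allI[OF ex]] obtain ts where *: "\<forall>i. (\<forall>(a, \<alpha>)\<in>set (ts i). holo_map A a \<and> sum \<alpha> UNIV = d \<and> transversal k \<alpha>) \<and>
      jet (d + 1) (\<lambda>x z. P x z $ i - F x z $ i - (\<Sum>(a, \<alpha>)\<leftarrow>ts i. a x * monomial \<alpha> z))" ..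
  note ts = conjunct1[OF spec[OF *]] conjunct2[OF spec[OF *]]
  have "\<exists>F'. admissible F' \<and> (\<forall>l. jet (d + 1)
    (\<lambda>x z. F' x z $ l - F x z $ l - (\<Sum>i\<in>S. (\<Sum>(a, \<alpha>)\<leftarrow>ts i. a x * monomial \<alpha> z) * axis i 1 $ l)))"
    if "finite S" for S
    using that
  proof induction
    case empty
    show ?case by (rule exI[of _ F]) (auto intro: F jet_zero)
  next
    case (insert i S)
    then obtain G where G: "admissible G" "\<And>l. jet (d + 1)
        (\<lambda>x z. G x z $ l - F x z $ l - (\<Sum>i\<in>S. (\<Sum>(a, \<alpha>)\<leftarrow>ts i. a x * monomial \<alpha> z) * axis i 1 $ l))"
      by blast
    obtain H where H: "admissible H" "\<And>l. jet (d + 1)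
        (\<lambda>x z. H x z $ l - G x z $ l - (\<Sum>(a, \<alpha>)\<leftarrow>ts i. a x * monomial \<alpha> z) * axis i 1 $ l)"
      using admissible_add_terms[OF k d G(1) ts(1), of i] by blast
    have "jet (d + 1) (\<lambda>x z. H x z $ l - F x z $ l -
        (\<Sum>i\<in>insert i S. (\<Sum>(a, \<alpha>)\<leftarrow>ts i. a x * monomial \<alpha> z) * axis i 1 $ l))" for l
      using jet.add[OF G(2)[of l] H(2)[of l]] insert.hyps by (simp add: algebra_simps)
    then show ?case using H(1) by blast
  qed
  from this[of UNIV] obtain G where G: "admissible G" "\<And>l. jet (d + 1)
      (\<lambda>x z. G x z $ l - F x z $ l - (\<Sum>i\<in>UNIV. (\<Sum>(a, \<alpha>)\<leftarrow>ts i. a x * monomial \<alpha> z) * axis i 1 $ l))"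
    by auto
  have "jet (d + 1) (\<lambda>x z. P x z $ l - G x z $ l)" for l
    using jet_diff[OF ts(2)[of l] G(2)[of l]] by (simp add: axis_def mult_delta_right)
  then show ?thesis using G(1) by blast
qed

lemma admissible_id: "admissible (\<lambda>x z. z)"
  unfolding admissible_def
  using Aut_fields_id holo_map_times_snd[OF manifold holo_on_nth]
  by (auto simp: id_def case_prod_beta' intro: jet_zero)

lemma tangent_to_id_realized:
  fixes P :: "'a \<Rightarrow> complex ^ 'n::{finite,linorder} \<Rightarrow> complex ^ 'n::{finite,linorder}"
  assumes k: "1 \<le> k"
    and P: "\<And>x z. x \<in> topspace X \<Longrightarrow> z \<in> coord_subspace k \<Longrightarrow> P x z = z"
    and jet_2: "\<And>i. jet 2 (\<lambda>x z. P x z $ i - z $ i)"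
  shows "\<exists>F. admissible F \<and> (\<forall>i. jet (d + 2) (\<lambda>x z. P x z $ i - F x z $ i))"
proof (induction d)
  case 0
  show ?case using admissible_id jet_2 by (intro exI[of _ "\<lambda>x z. z"]) (simp add: numeral_2_eq_2)
next
  case (Suc d)
  then obtain F where "admissible F" "\<And>i. jet (d + 2) (\<lambda>x z. P x z $ i - F x z $ i)" by blast
  then show ?case using admissible_improve[OF k _ _ P, of "d + 2" F] by simp
qed

text \<open>Beyond the projection only transversal terms occur: none in degree 0, and linear forms
  \<open>L i x\<close> in degree 1. So \<open>M x\<close> is the projection plus forms that vanish
  on the subspace.\<close>

lemma poly_family_linear_part:
  fixes P :: "'a \<Rightarrow> complex ^ 'n::{finite,linorder} \<Rightarrow> complex ^ 'n::{finite,linorder}"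
  assumes P: "\<And>x z. x \<in> topspace X \<Longrightarrow> z \<in> coord_subspace k \<Longrightarrow> P x z = z"
    and hol: "holo_poly_family X A K P"
  obtains M :: "'a \<Rightarrow> ((complex, 'n::{finite,linorder}) vec, 'n::{finite,linorder}) vec" where "\<And>i l. holo_map A (\<lambda>x. M x $ i $ l)"
    "\<And>x z. z \<in> coord_subspace k \<Longrightarrow> M x *v z = z"
    "\<And>i. jet 2 (\<lambda>x z. P x z $ i - (M x *v z) $ i)"
proof -
  obtain c :: "('n \<Rightarrow> nat) \<Rightarrow> 'a \<Rightarrow> (complex, 'n) vec" where c: "\<And>\<alpha>. holo_map A (c \<alpha>)"
    "\<And>x z. x \<in> topspace X \<Longrightarrow> P x z = (\<Sum>\<alpha> | sum \<alpha> UNIV \<le> K. monomial \<alpha> z *\<^sub>C c \<alpha> x)"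
    using hol unfolding holo_poly_family_def by blast
  have jet0: "jet 0 (\<lambda>x z. P x z $ i)" for i
  proof -
    have "jet 0 (\<lambda>x z. \<Sum>\<alpha> | sum \<alpha> UNIV \<le> K. c \<alpha> x $ i * monomial \<alpha> z)"
      using c(1) holo_map_vec_iff by (intro jet_sum jet.monomial) blast+
    then show ?thesis
      by (rule jet_cong) (simp add: c(2) mult.commute)
  qed
  have jet_proj: "jet 1 (\<lambda>x z. proj_coord k z $ i)" for i
    using jet_coord[of i] by (cases "k \<le> card {..<i}") (auto simp: proj_coord_def intro: jet_zero)
  have P_proj: "P x (proj_coord k z) = proj_coord k z" if "x \<in> topspace X" for x z
    using P[OF that proj_coord_in] .
  have jet1: "jet 1 (\<lambda>x z. P x z $ i)" for i
  proof -
    obtain ts where ts: "\<forall>(a, \<alpha>)\<in>set ts. holo_map A a \<and> sum \<alpha> UNIV = 0 \<and> transversal k \<alpha>"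
      "jet 1 (\<lambda>x z. P x z $ i - P x (proj_coord k z) $ i - (\<Sum>(a, \<alpha>)\<leftarrow>ts. a x * monomial \<alpha> z))"
      using jet_transversal_terms[OF jet0[of i]] by auto
    have "ts = []"
    proof (rule ccontr)
      assume "ts \<noteq> []"
      then obtain a \<alpha> where "(a, \<alpha>) \<in> set ts" by (cases ts) auto
      then have "sum \<alpha> UNIV = 0" "transversal k \<alpha>" using ts(1) by auto
      then show False by (auto simp: transversal_def)
    qed
    then have "jet 1 (\<lambda>x z. (P x z $ i - P x (proj_coord k z) $ i) + proj_coord k z $ i)"
      using ts(2) by (intro jet.add jet_proj) simp
    then show ?thesis by (rule jet_cong) (simp add: P_proj)
  qed
  have ex: "\<exists>ts. (\<forall>(a, \<alpha>)\<in>set ts. holo_map A a \<and> sum \<alpha> UNIV = 1 \<and> transversal k \<alpha>) \<and>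
    jet 2 (\<lambda>x z. P x z $ i - proj_coord k z $ i - (\<Sum>(a, \<alpha>)\<leftarrow>ts. a x * monomial \<alpha> z))" for i
  proof -
    obtain ts where ts: "\<forall>(a, \<alpha>)\<in>set ts. holo_map A a \<and> sum \<alpha> UNIV = 1 \<and> transversal k \<alpha>"
      "jet 2 (\<lambda>x z. P x z $ i - P x (proj_coord k z) $ i - (\<Sum>(a, \<alpha>)\<leftarrow>ts. a x * monomial \<alpha> z))"
      using jet_transversal_terms[OF jet1[of i]] by (auto simp: numeral_2_eq_2)
    have "jet 2 (\<lambda>x z. P x z $ i - proj_coord k z $ i - (\<Sum>(a, \<alpha>)\<leftarrow>ts. a x * monomial \<alpha> z))"
      by (rule jet_cong[OF ts(2)]) (simp add: P_proj)
    then show ?thesis using ts(1) by blast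
  qed
  from choice[OF allI[OF ex]] obtain ts where *: "\<forall>i. (\<forall>(a, \<alpha>)\<in>set (ts i). holo_map A a \<and> sum \<alpha> UNIV = 1 \<and> transversal k \<alpha>) \<and>
      jet 2 (\<lambda>x z. P x z $ i - proj_coord k z $ i - (\<Sum>(a, \<alpha>)\<leftarrow>ts i. a x * monomial \<alpha> z))" ..
  note ts = conjunct1[OF spec[OF *]] conjunct2[OF spec[OF *]]
  define L where "L = (\<lambda>i x z. \<Sum>(a, \<alpha>)\<leftarrow>ts i. a x * monomial \<alpha> z)"
  have lin: "(\<Sum>(a, \<alpha>)\<leftarrow>us. a x * monomial \<alpha> z) =
      (\<Sum>l\<in>UNIV. (\<Sum>(a, \<alpha>)\<leftarrow>us. a x * monomial \<alpha> (axis l 1)) * z $ l)"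
    if "\<forall>(a, \<alpha>)\<in>set us. sum \<alpha> UNIV = 1" for us :: "(('a \<Rightarrow> complex) \<times> ('n \<Rightarrow> nat)) list" and x z
    using that
  proof (induction us)
    case (Cons u us)
    obtain a \<alpha> where u: "u = (a, \<alpha>)" by force
    have "monomial \<alpha> z = (\<Sum>l\<in>UNIV. monomial \<alpha> (axis l 1) * z $ l)"
      using Cons.prems by (intro monomial_degree_one) (simp add: u)
    then have "a x * monomial \<alpha> z = (\<Sum>l\<in>UNIV. a x * monomial \<alpha> (axis l 1) * z $ l)"
      by (simp add: sum_distrib_left mult.assoc)
    then show ?case using Cons by (simp add: u distrib_right sum.distrib)
  qed simp
  have L_lin: "L i x z = (\<Sum>l\<in>UNIV. L i x (axis l 1) * z $ l)" for i x z
    unfolding L_def using ts(1)[of i] by (intro lin) auto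
  have L_hol: "holo_map A (\<lambda>x. L i x w)" for i w
  proof -
    have "holo_map A (\<lambda>x. \<Sum>(a, \<alpha>)\<leftarrow>us. a x * monomial \<alpha> w)"
      if "\<forall>(a, \<alpha>)\<in>set us. holo_map A a" for us
      using that
      by (induction us) (auto intro!: holo_map_const holo_map_add holo_map_mult)
    then show ?thesis unfolding L_def using ts(1)[of i] by fastforce
  qed
  have L_van: "L i x z = 0" if "z \<in> coord_subspace k" for i x z
  proof -
    have eq: "map (\<lambda>(a, \<alpha>). a x * monomial \<alpha> z) (ts i) = map (\<lambda>_. 0) (ts i)"
      using ts(1)[of i] that by (auto simp: monomial_transversal_vanishes)
    show ?thesis unfolding L_def eq by simp
  qed
  define M :: "'a \<Rightarrow> ((complex, 'n) vec, 'n) vec" where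
    "M = (\<lambda>x. \<chi> i l. proj_coord k (axis l 1) $ i + L i x (axis l 1))"
  have Mz: "(M x *v z) $ i = proj_coord k z $ i + L i x z" for x z i
  proof -
    have "proj_coord k z $ i = (\<Sum>l\<in>UNIV. proj_coord k (axis l 1) $ i * z $ l)"
      by (simp add: proj_coord_def axis_def mult_delta_left)
    then show ?thesis
      by (simp add: matrix_vector_mult_def M_def distrib_right sum.distrib L_lin[of i x z])
  qed
  show thesis
  proof
    show "holo_map A (\<lambda>x. M x $ i $ l)" for i l
      by (simp add: M_def holo_map_add holo_map_const L_hol)
    show "M x *v z = z" if "z \<in> coord_subspace k" for x z
      using that by (simp add: vec_eq_iff Mz L_van proj_coord_id)
    show "jet 2 (\<lambda>x z. P x z $ i - (M x *v z) $ i)" for i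
      using ts(2)[of i] by (simp add: Mz L_def diff_diff_add)
  qed
qed

end

text \<open>For \<open>z\<close> in the kernel, \<open>P\<close> along the line through
  \<open>z\<close> would be of order 2, whereas \<open>flow_jet_derivative\<close> gives a component
  with nonzero derivative.\<close>

lemma flow_jet_linear_part_inj:
  fixes M :: "((complex, 'n::{finite,linorder}) vec, 'n::{finite,linorder}) vec"
  assumes P: "P \<in> flow_jets00 K (vanishing_fields k)" and K: "1 \<le> K"
    and M: "\<And>i. bigo_at_0 2 (\<lambda>z. P z $ i - (M *v z) $ i)"
  shows "inj ((*v) M)"
proof -
  have "z = 0" if z: "M *v z = 0" for z
  proof (rule ccontr)
    assume "z \<noteq> 0"
    then obtain i D where D: "D \<noteq> 0" "((\<lambda>s. P (s *\<^sub>C z) $ i) has_field_derivative D) (at 0)"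
      using flow_jet_derivative[OF P K] by blast
    obtain C d where C: "d > 0" "\<And>w. norm w < d \<Longrightarrow> norm (P w $ i - (M *v w) $ i) \<le> C * norm w ^ 2"
      using M[of i] unfolding bigo_at_0_def eventually_nhds_metric by (auto simp: dist_norm)
    have "M *v (s *\<^sub>C z) = 0" for s
    proof -
      have "s *\<^sub>C z = s *s z" by (simp add: vec_eq_iff)
      then show ?thesis using z by (simp add: vector_scalar_commute)
    qed
    then have bd: "norm (P (s *\<^sub>C z) $ i) \<le> C * (norm s * norm z) ^ 2" if "norm s * norm z < d" for s
      using C(2)[of "s *\<^sub>C z"] that by (simp add: norm_scaleC)
    have P0: "P 0 $ i = 0" using bd[of 0] C(1) by simp
    have "((\<lambda>s. P (s *\<^sub>C z) $ i / s) \<longlongrightarrow> D) (at 0)"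
      using D(2) P0 by (simp add: has_field_derivative_iff)
    moreover have "((\<lambda>s. P (s *\<^sub>C z) $ i / s) \<longlongrightarrow> 0) (at 0)"
    proof (rule Lim_null_comparison)
      have "eventually (\<lambda>s. s \<in> ball 0 (d / norm z) - {0}) (at (0::complex))"
        using C(1) \<open>z \<noteq> 0\<close> by (intro eventually_at_in_open) auto
      then show "eventually (\<lambda>s. norm (P (s *\<^sub>C z) $ i / s) \<le> C * norm z ^ 2 * norm s) (at 0)"
      proof eventually_elim
        case (elim s)
        then have "norm s * norm z < d" using \<open>z \<noteq> 0\<close> by (simp add: field_simps)
        then have "norm (P (s *\<^sub>C z) $ i) \<le> C * norm z ^ 2 * norm s * norm s"
          using bd by (simp add: power2_eq_square algebra_simps)
        then show ?case using elim by (simp add: norm_divide divide_le_eq)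
      qed
      have "((\<lambda>s::complex. C * norm z ^ 2 * norm s) \<longlongrightarrow> C * norm z ^ 2 * 0) (at 0)"
        by (intro tendsto_mult tendsto_const tendsto_norm_zero tendsto_ident_at)
      then show "((\<lambda>s::complex. C * norm z ^ 2 * norm s) \<longlongrightarrow> 0) (at 0)" by simp
    qed
    ultimately show False using D(1) tendsto_unique[OF at_neq_bot] by blast
  qed
  then show ?thesis
    by (metis (no_types) matrix_left_invertible_ker matrix_left_invertible_injective)
qed

section \<open>Holomorphic inversion of the linear part\<close>

lemma holo_map_det:
  fixes M :: "'a \<Rightarrow> complex ^ 'n ^ 'n"
  assumes "\<And>i l. holo_map A (\<lambda>x. M x $ i $ l)"
  shows "holo_map A (\<lambda>x. det (M x))"
  unfolding det_def by (intro holo_map_sum holo_map_mult holo_map_prod holo_map_const assms)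

text \<open>Cramer's rule: column \<open>l\<close> of the inverse solves the system with right-hand
  side \<open>axis l 1\<close>, so its entries are determinants of holomorphic matrices divided by
  \<open>det (M x)\<close>.\<close>

lemma holo_map_matrix_inverse:
  fixes M :: "'a \<Rightarrow> complex ^ 'n ^ 'n"
  assumes M: "\<And>i l. holo_map A (\<lambda>x. M x $ i $ l)"
    and det: "\<And>x. x \<in> (\<Union>(U, \<phi>)\<in>A. U) \<Longrightarrow> det (M x) \<noteq> 0"
  obtains N :: "'a \<Rightarrow> complex ^ 'n ^ 'n" where "\<And>i l. holo_map A (\<lambda>x. N x $ i $ l)"
    "\<And>x. x \<in> (\<Union>(U, \<phi>)\<in>A. U) \<Longrightarrow> N x ** M x = mat 1"
proof -
  define N :: "'a \<Rightarrow> complex ^ 'n ^ 'n" where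
    "N = (\<lambda>x. \<chi> q l. det (\<chi> i j. if j = q then axis l 1 $ i else M x $ i $ j) * inverse (det (M x)))"
  show thesis
  proof
    show "holo_map A (\<lambda>x. N x $ q $ l)" for q l
    proof -
      have "holo_map A (\<lambda>x. if j = q then axis l 1 $ i else M x $ i $ j)" for i j
        by (cases "j = q") (auto intro: M holo_map_const)
      then have "holo_map A (\<lambda>x. det (\<chi> i j. if j = q then axis l 1 $ i else M x $ i $ j))"
        by (intro holo_map_det) simp
      then show ?thesis
        unfolding N_def vec_lambda_beta
        by (intro holo_map_mult holo_map_inverse holo_map_det[OF M] det)
    qed
    fix x assume x: "x \<in> (\<Union>(U, \<phi>)\<in>A. U)"
    obtain B where B: "M x ** B = mat 1"
      using det[OF x] invertible_det_nz[of "M x"] by (auto simp: invertible_def)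
    have "B = N x"
    proof -
      have "B *v axis l 1 = N x *v axis l 1" for l
      proof -
        have "M x *v (B *v axis l 1) = axis l 1" by (simp add: matrix_vector_mul_assoc B)
        then have "B *v axis l 1 =
            (\<chi> q. det (\<chi> i j. if j = q then axis l 1 $ i else M x $ i $ j) / det (M x))"
          using cramer[OF det[OF x]] by blast
        also have "\<dots> = N x *v axis l 1"
          by (simp add: vec_eq_iff N_def matrix_vector_mult_def axis_def mult_delta_right divide_inverse)
        finally show ?thesis .
      qed
      then have "(B *v axis l 1) $ i = (N x *v axis l 1) $ i" for i l by simp
      then show ?thesis
        by (simp add: vec_eq_iff matrix_vector_mult_def axis_def mult_delta_right)
    qed
    then show "N x ** M x = mat 1" using B matrix_left_right_inverse by blast
  qed
qed

section \<open>Combination of the linear part with the correction tangent to the identity\<close>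

theorem theorem3p7:
  fixes X :: "'a topology"
    and E :: "(complex ^ 'm) set"
    and A :: "('a, complex ^ 'm) atlas"
    and P :: "'a \<Rightarrow> complex ^ 'n::{finite,linorder} \<Rightarrow> complex ^ 'n::{finite,linorder}"
    and k K :: nat
  assumes "1 \<le> k" and "k < CARD('n)" and "1 \<le> K"
    and "stein_manifold X E A"
    and "\<And>x. x \<in> topspace X \<Longrightarrow> P x \<in> flow_jets00 K (vanishing_fields k)"
    and "\<And>x z. x \<in> topspace X \<Longrightarrow> z \<in> coord_subspace k \<Longrightarrow> P x z = z"
    and "holo_poly_family X A K P"
  shows "\<exists>F :: 'a \<Rightarrow> (complex, 'n) vec \<Rightarrow> (complex, 'n) vec.
    (\<forall>x\<in>topspace X. F x \<in> Aut_fields (vanishing_fields k)) \<and>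
    holo_map (atlas_times_UNIV A) (\<lambda>(x, z). F x z) \<and>
    (\<forall>x\<in>topspace X.
       (\<lambda>z. norm (F x z - P x z)) \<in> O[at 0](\<lambda>z. norm z ^ (K + 1)) \<and>
       (\<forall>z\<in>coord_subspace k. F x z = z))"
proof -
  have manifold: "complex_manifold X E A" using assms(4) by (simp add: stein_manifold_def)
  interpret holo_families X E A k K by standard (use manifold assms(3) in auto)
  have cover: "(\<Union>(U, \<phi>)\<in>A. U) = topspace X" using manifold by (simp add: complex_manifold_def)
  obtain M :: "'a \<Rightarrow> ((complex, 'n) vec, 'n) vec" where M: "\<And>i l. holo_map A (\<lambda>x. M x $ i $ l)"
    "\<And>x z. z \<in> coord_subspace k \<Longrightarrow> M x *v z = z"
    "\<And>i. jet 2 (\<lambda>x z. P x z $ i - (M x *v z) $ i)"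
    using poly_family_linear_part[OF assms(6,7)] by blast
  \<comment> \<open>\<open>jet 2\<close> yields a genuine bound of order 2 because
    \<open>2 \<le> K + 1\<close>.\<close>
  have inj: "inj ((*v) (M x))" if "x \<in> topspace X" for x
    by (rule flow_jet_linear_part_inj[OF assms(5)[OF that] assms(3) jet_bigo[OF M(3) _ that]])
      (use assms(3) in simp)
  then have "det (M x) \<noteq> 0" if "x \<in> topspace X" for x
    using that matrix_left_invertible_injective[of "M x"] invertible_left_inverse[of "M x"]
      invertible_det_nz[of "M x"] by blast
  then obtain N :: "'a \<Rightarrow> ((complex, 'n) vec, 'n) vec" where N: "\<And>i l. holo_map A (\<lambda>x. N x $ i $ l)"
    "\<And>x. x \<in> topspace X \<Longrightarrow> N x ** M x = mat 1"
    using holo_map_matrix_inverse[of A M] M(1) unfolding cover by blast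
  have MN: "M x *v (N x *v z) = z" "N x *v (M x *v z) = z" if "x \<in> topspace X" for x z
    using N(2)[OF that] matrix_left_right_inverse[of "N x" "M x"] by (auto simp: matrix_vector_mul_assoc)
  \<comment> \<open>The family \<open>N x *v P x z\<close> is tangent to the identity and still
    fixes the subspace; \<open>K - 1 + 2\<close> equals \<open>K + 1\<close> since
    \<open>1 \<le> K\<close>.\<close>
  have "\<exists>F. admissible F \<and> (\<forall>i. jet (K - 1 + 2) (\<lambda>x z. (N x *v P x z) $ i - F x z $ i))"
  proof (rule tangent_to_id_realized[OF assms(1)])
    show "N x *v P x z = z" if "x \<in> topspace X" "z \<in> coord_subspace k" for x z
      using MN(2)[OF that(1), of z] M(2)[OF that(2)] assms(6)[OF that] by simp
    fix i
    have "jet 2 (\<lambda>x z. \<Sum>l\<in>UNIV. N x $ i $ l * (P x z $ l - (M x *v z) $ l))"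
      by (intro jet_sum jet_scale N M)
    then show "jet 2 (\<lambda>x z. (N x *v P x z) $ i - z $ i)"
    proof (rule jet_cong)
      fix x and z :: "(complex, 'n) vec" assume "x \<in> topspace X"
      then have "(N x *v P x z) $ i - z $ i = (N x *v P x z) $ i - (N x *v (M x *v z)) $ i"
        by (simp add: MN)
      then show "(\<Sum>l\<in>UNIV. N x $ i $ l * (P x z $ l - (M x *v z) $ l)) = (N x *v P x z) $ i - z $ i"
        by (simp add: matrix_vector_mult_def[of "N x"] sum_subtractf right_diff_distrib)
    qed
  qed
  then obtain F where F: "admissible F"
    "\<And>i. jet (K + 1) (\<lambda>x z. (N x *v P x z) $ i - F x z $ i)"
    using assms(3) by auto
  \<comment> \<open>\<open>P x z - G x z\<close> is \<open>M x\<close> applied to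
    \<open>N x *v P x z - F x z\<close>, and so of the same order.\<close>
  define G where "G = (\<lambda>x z. M x *v F x z)"
  show ?thesis
  proof (intro exI[of _ G] conjI ballI)
    fix x assume x: "x \<in> topspace X"
    have "(*v) (M x) \<in> Aut_fields (vanishing_fields k)"
    proof (rule linear_Aut)
      show "clinear_map ((*v) (M x))"
        by (auto simp: clinear_map_def matrix_vector_mult_def vec_eq_iff sum.distrib sum_distrib_left algebra_simps)
    qed (use inj[OF x] M(2) in auto)
    then have "(*v) (M x) \<circ> F x \<in> Aut_fields (vanishing_fields k)"
      using F(1) x by (intro Aut_fields_comp) (auto simp: admissible_def)
    then show "G x \<in> Aut_fields (vanishing_fields k)" by (simp add: G_def o_def)
    show "G x z = z" if "z \<in> coord_subspace k" for z
      using F(1) x M(2) that by (simp add: G_def admissible_def)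
    have "bigo_at_0 (K + 1) (\<lambda>z. P x z $ i - G x z $ i)" for i
    proof -
      have "jet (K + 1) (\<lambda>x z. \<Sum>l\<in>UNIV. M x $ i $ l * ((N x *v P x z) $ l - F x z $ l))"
        by (intro jet_sum jet_scale F M)
      from jet_bigo[OF this _ x]
      have "bigo_at_0 (K + 1) (\<lambda>z. (M x *v (N x *v P x z)) $ i - (M x *v F x z) $ i)"
        by (simp add: matrix_vector_mult_def[of "M x"] sum_subtractf right_diff_distrib)
      then show ?thesis by (simp add: MN x G_def)
    qed
    then have ex: "\<exists>C. eventually (\<lambda>z. norm (P x z $ i - G x z $ i) \<le> C * norm z ^ (K + 1)) (nhds 0)" for i
      unfolding bigo_at_0_def by blast
    from choice[OF allI[OF ex]] obtain C where
      C: "\<forall>i. eventually (\<lambda>z. norm (P x z $ i - G x z $ i) \<le> C i * norm z ^ (K + 1)) (nhds 0)" ..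
    have "eventually (\<lambda>z. \<forall>i. norm (P x z $ i - G x z $ i) \<le> C i * norm z ^ (K + 1)) (nhds 0)"
      using C by (simp add: eventually_all_finite)
    then have "eventually (\<lambda>z. norm (G x z - P x z) \<le> (\<Sum>i\<in>UNIV. C i) * norm z ^ (K + 1)) (nhds 0)"
    proof eventually_elim
      case (elim z)
      have "norm (G x z - P x z) \<le> (\<Sum>i\<in>UNIV. norm ((G x z - P x z) $ i))"
        unfolding norm_vec_def by (intro L2_set_le_sum) simp
      also have "\<dots> \<le> (\<Sum>i\<in>UNIV. C i * norm z ^ (K + 1))"
        using elim by (intro sum_mono) (simp add: norm_minus_commute)
      finally show ?case by (simp add: sum_distrib_right)
    qed
    then have "eventually (\<lambda>z. norm (norm (G x z - P x z)) \<le> (\<Sum>i\<in>UNIV. C i) * norm (norm z ^ (K + 1))) (at 0)"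
      by (simp add: eventually_nhds_conv_at)
    then show "(\<lambda>z. norm (G x z - P x z)) \<in> O[at 0](\<lambda>z. norm z ^ (K + 1))"
      by (rule bigoI)
  next
    have "holo_map (atlas_times_UNIV A) (\<lambda>w. G (fst w) (snd w) $ i)" for i
      unfolding G_def matrix_vector_mult_def vec_lambda_beta
      using F(1) by (intro holo_map_sum holo_map_mult
          holo_map_times_fst[OF manifold M(1), unfolded case_prod_beta]) (auto simp: admissible_def)
    then show "holo_map (atlas_times_UNIV A) (\<lambda>(x, z). G x z)"
      unfolding case_prod_beta' by (subst holo_map_vec_iff) blast
  qed
qed

end
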